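(* Let $\Omega$ be a complex manifold which is biholomorphic to a bounded strongly (strictly) pseudoconvex domain with $C^2$-boundary in some $\mathbb{C}^n$. Let $d_\Omega$ be the Kobayashi distance on $\Omega$, fix $x_0\in\Omega$, and put $$\langle x\,|\,y\rangle^{\Omega}_{x_0}=\tfrac12\bigl(d_\Omega(x_0,x)+d_\Omega(x_0,y)-d_\Omega(x,y)\bigr)\qquad (x,y\in\Omega).$$ Let $f,g\colon\mathbb{D}\to\Omega$ be holomorphic mappings from the unit disk $\mathbb{D}\subset\mathbb{C}$. Suppose that there is a measurable set $E\subset\partial\mathbb{D}$ of positive linear measure such that for any $z_0\in E$ there is a sequence $\{z_n\}_{n=1}^\infty\subset\mathbb{D}$ such that $z_n\to z_0$ nontangentially and $\langle f(z_n)\,|\,g(z_n)\rangle^{\Omega}_{x_0}\to\infty$ as $n\to\infty$. Then $f(z)=g(z)$ for all $z\in\mathbb{D}$.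
   Context: The Kobayashi distance $d_\Omega$ is the largest pseudodistance on $\Omega$ such that $d_\Omega(\phi(a),\phi(b))\le d_{\mathbb{D}}(a,b)$ for all holomorphic $\phi\colon\mathbb{D}\to\Omega$ and $a,b\in\mathbb{D}$, where $d_{\mathbb{D}}$ is the Poincaré distance of curvature $-4$, i.e. $d_{\mathbb{D}}(0,z)=\frac12\log\frac{1+|z|}{1-|z|}$. Linear measure on $\partial\mathbb{D}$ is arc-length (Lebesgue) measure. A sequence in $\mathbb{D}$ converges to $z_0\in\partial\mathbb{D}$ nontangentially if it converges to $z_0$ while staying inside some fixed Stolz region with vertex at $z_0$ (a set of the form $\{z\in\mathbb{D}: |z-z_0|<C(1-|z|)\}$ with $C>1$). *)

theory Defs
  imports "HOL-Complex_Analysis.Complex_Analysis"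
begin

section \<open>Holomorphic maps in several complex variables\<close>

text \<open>The domain of the map is meant to be open. Multiplication of a vector by a complex scalar
  is \<open>(*s)\<close>; the derivative is the (a priori only real-linear) Frechet derivative.\<close>

definition holo_map_on ::
    "(complex^'n \<Rightarrow> complex^'m) \<Rightarrow> (complex^'n) set \<Rightarrow> bool" (infixl "holo'_map'_on" 50) where
  "F holo_map_on S \<longleftrightarrow>
     (\<forall>z\<in>S. \<exists>F'. (F has_derivative F') (at z) \<and> (\<forall>c v. F' (c *s v) = c *s F' v))"


section \<open>Complex manifolds\<close>

text \<open>A chart is a pair of its domain and its coordinate map.\<close>

type_synonym ('a, 'n) chart = "'a set \<times> ('a \<Rightarrow> complex^'n)"

definition complex_manifold :: "'a topology \<Rightarrow> ('a, 'n::finite) chart set \<Rightarrow> bool" where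
  "complex_manifold X \<A> \<longleftrightarrow>
     Hausdorff_space X \<and> second_countable X \<and>
     topspace X = (\<Union>(U, \<phi>)\<in>\<A>. U) \<and>
     (\<forall>(U, \<phi>)\<in>\<A>. openin X U \<and> open (\<phi> ` U) \<and>
        homeomorphic_map (subtopology X U) (top_of_set (\<phi> ` U)) \<phi>) \<and>
     (\<forall>(U, \<phi>)\<in>\<A>. \<forall>(V, \<psi>)\<in>\<A>. (\<psi> \<circ> inv_into U \<phi>) holo_map_on (\<phi> ` (U \<inter> V)))"

definition holo_curve ::
    "'a topology \<Rightarrow> ('a, 'n::finite) chart set \<Rightarrow> complex set \<Rightarrow> (complex \<Rightarrow> 'a) \<Rightarrow> bool" where
  "holo_curve X \<A> S f \<longleftrightarrow>
     continuous_map (top_of_set S) X f \<and>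
     (\<forall>(U, \<phi>)\<in>\<A>. \<forall>j. (\<lambda>z. \<phi> (f z) $ j) holomorphic_on {z\<in>S. f z \<in> U})"

definition biholomorphic_to ::
    "'a topology \<Rightarrow> ('a, 'n::finite) chart set \<Rightarrow> (complex^'n) set \<Rightarrow> bool" where
  "biholomorphic_to X \<A> D \<longleftrightarrow>
     (\<exists>F G. homeomorphic_maps X (top_of_set D) F G \<and>
        (\<forall>(U, \<phi>)\<in>\<A>. (F \<circ> inv_into U \<phi>) holo_map_on (\<phi> ` U)) \<and>
        (\<forall>(U, \<phi>)\<in>\<A>. (\<phi> \<circ> G) holo_map_on {z\<in>D. G z \<in> U}))"


section \<open>Bounded strongly pseudoconvex domains with boundary of class C2\<close>

definition C2_on :: "('v::real_normed_vector \<Rightarrow> real) \<Rightarrow> 'v set \<Rightarrow> bool" where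
  "C2_on r U \<longleftrightarrow>
     (\<exists>(r' :: 'v \<Rightarrow> 'v \<Rightarrow>\<^sub>L real) (r'' :: 'v \<Rightarrow> 'v \<Rightarrow>\<^sub>L 'v \<Rightarrow>\<^sub>L real).
        (\<forall>z\<in>U. (r has_derivative blinfun_apply (r' z)) (at z)) \<and>
        (\<forall>z\<in>U. (r' has_derivative blinfun_apply (r'' z)) (at z)) \<and>
        continuous_on U r'')"

definition dir_deriv :: "(complex^'n \<Rightarrow> complex) \<Rightarrow> complex^'n \<Rightarrow> complex^'n \<Rightarrow> complex" where
  "dir_deriv h v p = vector_derivative (\<lambda>t. h (p + t *\<^sub>R v)) (at 0)"

text \<open>The Wirtinger derivatives with respect to the \<open>j\<close>-th variable and its conjugate.\<close>

definition dz :: "'n::finite \<Rightarrow> (complex^'n \<Rightarrow> complex) \<Rightarrow> complex^'n \<Rightarrow> complex" where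
  "dz j h p = (dir_deriv h (axis j 1) p - \<i> * dir_deriv h (axis j \<i>) p) / 2"

definition dzbar :: "'n::finite \<Rightarrow> (complex^'n \<Rightarrow> complex) \<Rightarrow> complex^'n \<Rightarrow> complex" where
  "dzbar j h p = (dir_deriv h (axis j 1) p + \<i> * dir_deriv h (axis j \<i>) p) / 2"

text \<open>For \<open>r\<close> of class C2 the double sum is real, so that \<open>Re\<close> is only a coercion.\<close>

definition levi_form :: "(complex^'n \<Rightarrow> real) \<Rightarrow> complex^'n \<Rightarrow> complex^'n \<Rightarrow> real" where
  "levi_form r p w =
     Re (\<Sum>j\<in>UNIV. \<Sum>k\<in>UNIV. dz j (dzbar k (\<lambda>z. complex_of_real (r z))) p * w $ j * cnj (w $ k))"

definition complex_tangent_space :: "(complex^'n \<Rightarrow> real) \<Rightarrow> complex^'n \<Rightarrow> (complex^'n) set" where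
  "complex_tangent_space r p = {w. (\<Sum>j\<in>UNIV. dz j (\<lambda>z. complex_of_real (r z)) p * w $ j) = 0}"

definition strongly_pseudoconvex_domain :: "(complex^'n) set \<Rightarrow> bool" where
  "strongly_pseudoconvex_domain D \<longleftrightarrow>
     open D \<and> connected D \<and> D \<noteq> {} \<and> bounded D \<and>
     (\<exists>U r. open U \<and> frontier D \<subseteq> U \<and> C2_on r U \<and>
        D \<inter> U = {z\<in>U. r z < 0} \<and>
        (\<forall>p\<in>frontier D. frechet_derivative r (at p) \<noteq> (\<lambda>v. 0)) \<and>
        (\<forall>p\<in>frontier D. \<forall>w\<in>complex_tangent_space r p. w \<noteq> 0 \<longrightarrow> levi_form r p w > 0))"


section \<open>The Kobayashi distance and the Gromov product\<close>

text \<open>The Poincare distance of curvature \<open>-4\<close>: the Moebius-invariant distance on the unit disk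
  with value \<open>ln ((1 + \<bar>z\<bar>) / (1 - \<bar>z\<bar>)) / 2\<close> at \<open>(0, z)\<close>.\<close>

definition poincare_dist :: "complex \<Rightarrow> complex \<Rightarrow> real" where
  "poincare_dist a b =
     (let \<rho> = cmod ((a - b) / (1 - cnj a * b)) in ln ((1 + \<rho>) / (1 - \<rho>)) / 2)"

definition pseudodistance_on :: "'a set \<Rightarrow> ('a \<Rightarrow> 'a \<Rightarrow> real) \<Rightarrow> bool" where
  "pseudodistance_on M d \<longleftrightarrow>
     (\<forall>x\<in>M. d x x = 0) \<and>
     (\<forall>x\<in>M. \<forall>y\<in>M. 0 \<le> d x y \<and> d x y = d y x) \<and>
     (\<forall>x\<in>M. \<forall>y\<in>M. \<forall>z\<in>M. d x z \<le> d x y + d y z)"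

definition disk_contracting ::
    "'a topology \<Rightarrow> ('a, 'n::finite) chart set \<Rightarrow> ('a \<Rightarrow> 'a \<Rightarrow> real) \<Rightarrow> bool" where
  "disk_contracting X \<A> d \<longleftrightarrow>
     pseudodistance_on (topspace X) d \<and>
     (\<forall>\<phi>. holo_curve X \<A> (ball 0 1) \<phi> \<longrightarrow>
        (\<forall>a\<in>ball 0 1. \<forall>b\<in>ball 0 1. d (\<phi> a) (\<phi> b) \<le> poincare_dist a b))"

text \<open>On a connected manifold this supremum is finite and is itself the largest disk-contracting
  pseudodistance; see \<open>kobayashi_dist_greatest\<close> below.\<close>

definition kobayashi_dist ::
    "'a topology \<Rightarrow> ('a, 'n::finite) chart set \<Rightarrow> 'a \<Rightarrow> 'a \<Rightarrow> real" where
  "kobayashi_dist X \<A> x y = (SUP d\<in>Collect (disk_contracting X \<A>). d x y)"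

definition gromov_product ::
    "'a topology \<Rightarrow> ('a, 'n::finite) chart set \<Rightarrow> 'a \<Rightarrow> 'a \<Rightarrow> 'a \<Rightarrow> real" where
  "gromov_product X \<A> x0 x y =
     (kobayashi_dist X \<A> x0 x + kobayashi_dist X \<A> x0 y - kobayashi_dist X \<A> x y) / 2"

lemma pseudodistance_on_triangle:
  assumes "pseudodistance_on M d" "x \<in> M" "y \<in> M" "z \<in> M"
  shows "d x z \<le> d x y + d y z"
  using assms unfolding pseudodistance_on_def by blast

lemma disk_contracting_locally_bounded:
  fixes \<A> :: "('a, 'n::finite) chart set"
  assumes M: "complex_manifold X \<A>" and x: "x \<in> topspace X"
  obtains V K where "openin X V" "x \<in> V" "\<And>y d. y \<in> V \<Longrightarrow> disk_contracting X \<A> d \<Longrightarrow> d x y \<le> K"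
proof -
  obtain U \<phi> where U: "(U, \<phi>) \<in> \<A>" "x \<in> U"
    using M x unfolding complex_manifold_def by auto
  have oU: "openin X U" and op: "open (\<phi> ` U)"
    and hom: "homeomorphic_map (subtopology X U) (top_of_set (\<phi> ` U)) \<phi>"
    using M U unfolding complex_manifold_def by auto
  have tU: "topspace (subtopology X U) = U"
    using openin_subset[OF oU] by auto
  have inj: "inj_on \<phi> U"
    using homeomorphic_imp_injective_map[OF hom] tU by simp
  have cont: "continuous_map (subtopology X U) (top_of_set (\<phi> ` U)) \<phi>"
    using hom by (rule homeomorphic_imp_continuous_map)
  obtain \<phi>' where maps: "homeomorphic_maps (subtopology X U) (top_of_set (\<phi> ` U)) \<phi> \<phi>'"
    using hom homeomorphic_map_maps by blast
  have inv_eq: "\<phi>' y = inv_into U \<phi> y" if "y \<in> \<phi> ` U" for y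
    using maps that inj tU unfolding homeomorphic_maps_def by auto
  have icont: "continuous_map (top_of_set (\<phi> ` U)) (subtopology X U) (inv_into U \<phi>)"
    using maps inv_eq unfolding homeomorphic_maps_def
    by (auto intro: continuous_map_eq)
  obtain e where e: "e > 0" "ball (\<phi> x) e \<subseteq> \<phi> ` U"
    using op U open_contains_ball by blast
  define V where "V = {y \<in> U. \<phi> y \<in> ball (\<phi> x) (e/2)}"
  have "openin (subtopology X U) {y \<in> topspace (subtopology X U). \<phi> y \<in> \<phi> ` U \<inter> ball (\<phi> x) (e/2)}"
    using cont by (intro openin_continuous_map_preimage[OF cont]) (simp add: openin_open_Int)
  moreover have "{y \<in> topspace (subtopology X U). \<phi> y \<in> \<phi> ` U \<inter> ball (\<phi> x) (e/2)} = V"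
    unfolding V_def tU by auto
  ultimately have oV: "openin X V"
    using oU openin_trans_full by fastforce
  have xV: "x \<in> V" using U e by (auto simp: V_def)
  have bound: "d x y \<le> poincare_dist 0 (1/2)" if y: "y \<in> V" and d: "disk_contracting X \<A> d" for y d
  proof -
    define v where "v = \<phi> y - \<phi> x"
    have yU: "y \<in> U" and nv: "norm v < e/2"
      using y by (auto simp: V_def v_def dist_norm norm_minus_commute)
    define L where "L = (\<lambda>\<zeta>::complex. \<phi> x + (2 * \<zeta>) *s v)"
    have nsc: "norm (c *s v) = cmod c * norm v" for c
      by (simp add: norm_vec_def norm_mult L2_set_right_distrib)
    have LU: "L \<zeta> \<in> \<phi> ` U" if "\<zeta> \<in> ball 0 1" for \<zeta>
    proof -
      have "norm ((2 * \<zeta>) *s v) = 2 * cmod \<zeta> * norm v"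
        unfolding nsc by (simp add: norm_mult)
      also have "\<dots> \<le> 2 * 1 * norm v"
        using that by (intro mult_right_mono mult_left_mono) auto
      also have "\<dots> < e" using nv by simp
      finally have "L \<zeta> \<in> ball (\<phi> x) e" by (simp add: L_def dist_norm)
      then show ?thesis using e by blast
    qed
    have bl: "bounded_linear (\<lambda>\<zeta>::complex. (2 * \<zeta>) *s v)"
      by (rule linear_conv_bounded_linear[THEN iffD1], rule linearI)
         (auto simp: vec_eq_iff algebra_simps)
    have Lder: "(L has_derivative (\<lambda>\<zeta>. (2 * \<zeta>) *s v)) (at z)" for z
      using has_derivative_add[OF has_derivative_const bounded_linear_imp_has_derivative[OF bl]]
      unfolding L_def by simp
    have Lc: "continuous_on S L" for S
      by (rule continuous_at_imp_continuous_on) (simp add: has_derivative_continuous[OF Lder])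
    define h where "h = inv_into U \<phi> \<circ> L"
    have hU: "h \<zeta> \<in> U" if "\<zeta> \<in> ball 0 1" for \<zeta>
      using LU[OF that] by (auto simp: h_def intro: inv_into_into)
    have "continuous_map (top_of_set (ball 0 1)) (subtopology X U) h"
      unfolding h_def by (rule continuous_map_compose[OF _ icont]) (use LU Lc in auto)
    then have hc: "continuous_map (top_of_set (ball 0 1)) X h"
      using continuous_map_in_subtopology by blast
    have hh: "(\<lambda>z. \<psi> (h z) $ j) holomorphic_on {z\<in>ball 0 1. h z \<in> W}" if W: "(W, \<psi>) \<in> \<A>"
      for W j and \<psi> :: "'a \<Rightarrow> complex^'n"
    proof -
      have "\<exists>f'. ((\<lambda>z. \<psi> (h z) $ j) has_field_derivative f') (at z)" if z: "z \<in> ball 0 1" "h z \<in> W" for z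
      proof -
        have "L z \<in> \<phi> ` (U \<inter> W)"
        proof -
          have "\<phi> (h z) = L z"
            using LU[OF z(1)] by (simp add: h_def f_inv_into_f)
          then show ?thesis
            using hU[OF z(1)] z(2) by (metis IntI imageI)
        qed
        moreover have "(\<psi> \<circ> inv_into U \<phi>) holo_map_on (\<phi> ` (U \<inter> W))"
          using M U(1) W unfolding complex_manifold_def by blast
        ultimately obtain F' where F': "((\<psi> \<circ> inv_into U \<phi>) has_derivative F') (at (L z))"
           "\<And>c v. F' (c *s v) = c *s F' v"
          unfolding holo_map_on_def by meson
        have "((\<psi> \<circ> inv_into U \<phi>) \<circ> L has_derivative F' \<circ> (\<lambda>\<zeta>. (2 * \<zeta>) *s v)) (at z)"
          by (rule diff_chain_at[OF Lder F'(1)])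
        then have "((\<lambda>w. ((\<psi> \<circ> inv_into U \<phi>) \<circ> L) w $ j) has_derivative
              (\<lambda>w. (F' \<circ> (\<lambda>\<zeta>. (2 * \<zeta>) *s v)) w $ j)) (at z)"
          by (rule bounded_linear.has_derivative[OF bounded_linear_vec_nth])
        moreover have "(\<lambda>w. (F' \<circ> (\<lambda>\<zeta>. (2 * \<zeta>) *s v)) w $ j) = (*) (2 * F' v $ j)"
          by (auto simp: F'(2) fun_eq_iff)
        ultimately have "((\<lambda>z. \<psi> (h z) $ j) has_field_derivative (2 * F' v $ j)) (at z)"
          unfolding has_field_derivative_def h_def by (simp add: o_def)
        then show ?thesis by blast
      qed
      then show ?thesis
        unfolding holomorphic_on_def field_differentiable_def
        by (blast intro: has_field_derivative_at_within)
    qed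
    have "holo_curve X \<A> (ball 0 1) h"
      unfolding holo_curve_def using hc hh by blast
    moreover have "(0::complex) \<in> ball 0 1" "(1/2::complex) \<in> ball 0 1"
      by (simp_all add: norm_divide)
    ultimately have "d (h 0) (h (1/2)) \<le> poincare_dist 0 (1/2)"
      using d unfolding disk_contracting_def by blast
    moreover have "h 0 = x" "h (1/2) = y"
      using U yU inj by (auto simp: h_def L_def v_def)
    ultimately show ?thesis by simp
  qed
  show ?thesis by (rule that[of V "poincare_dist 0 (1/2)", OF oV xV]) (rule bound)
qed

lemma disk_contracting_bounded:
  fixes \<A> :: "('a, 'n::finite) chart set"
  assumes M: "complex_manifold X \<A>" and con: "connected_space X"
    and x: "x \<in> topspace X" and y: "y \<in> topspace X"
  shows "bdd_above ((\<lambda>d. d x y) ` Collect (disk_contracting X \<A>))"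
proof -
  define S where "S = {y \<in> topspace X. \<exists>K. \<forall>d. disk_contracting X \<A> d \<longrightarrow> d x y \<le> K}"
  have nbhd: "\<exists>V. openin X V \<and> z \<in> V \<and> (V \<subseteq> S \<or> V \<inter> S = {})" if z: "z \<in> topspace X" for z
  proof -
    obtain V K where V: "openin X V" "z \<in> V"
      "\<And>y d. y \<in> V \<Longrightarrow> disk_contracting X \<A> d \<Longrightarrow> d z y \<le> K"
      using disk_contracting_locally_bounded[OF M z] by metis
    have VX: "V \<subseteq> topspace X" using V(1) openin_subset by blast
    have step: "d x b \<le> d x a + K + K"
      if "a \<in> V" "b \<in> V" "disk_contracting X \<A> d" for a b d
    proof -
      have p: "pseudodistance_on (topspace X) d"
        using that(3) by (simp add: disk_contracting_def)
      have aX: "a \<in> topspace X" and bX: "b \<in> topspace X" using that VX by auto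
      have "d x b \<le> d x a + d a b"
        by (rule pseudodistance_on_triangle[OF p x aX bX])
      moreover have "d a b \<le> d a z + d z b"
        by (rule pseudodistance_on_triangle[OF p aX z bX])
      moreover have "d a z = d z a"
        using p aX z unfolding pseudodistance_on_def by blast
      ultimately show ?thesis using V(3)[OF that(1,3)] V(3)[OF that(2,3)] by linarith
    qed
    have "V \<subseteq> S" if "a \<in> V" "a \<in> S" for a
    proof
      fix b assume b: "b \<in> V"
      obtain K' where "\<And>d. disk_contracting X \<A> d \<Longrightarrow> d x a \<le> K'"
        using \<open>a \<in> S\<close> unfolding S_def by blast
      then have "d x b \<le> K' + K + K" if "disk_contracting X \<A> d" for d
        using step[OF \<open>a \<in> V\<close> b that] that by fastforce
      then show "b \<in> S" using b VX unfolding S_def by blast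
    qed
    then show ?thesis using V by blast
  qed
  have "\<exists>V. openin X V \<and> z \<in> V \<and> V \<subseteq> S" if "z \<in> S" for z
    using nbhd[of z] that S_def by auto
  then have "openin X S" by (subst openin_subopen) simp
  moreover have "\<exists>V. openin X V \<and> z \<in> V \<and> V \<subseteq> topspace X - S" if z: "z \<in> topspace X - S" for z
  proof -
    obtain V where "openin X V" "z \<in> V" "V \<subseteq> S \<or> V \<inter> S = {}"
      using nbhd[of z] z by auto
    then show ?thesis using z openin_subset[of X V] by (intro exI[of _ V]) auto
  qed
  then have "openin X (topspace X - S)" by (subst openin_subopen) simp
  moreover have "x \<in> S"
    using x unfolding S_def disk_contracting_def pseudodistance_on_def by force
  ultimately have "S = topspace X"
    using con openin_subset[of X S] unfolding connected_space_clopen_in closedin_def by auto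
  then show ?thesis using y unfolding S_def bdd_above_def by blast
qed

lemma disk_contracting_zero:
  "disk_contracting X \<A> (\<lambda>x y. 0)"
proof -
  have "poincare_dist a b \<ge> 0" if "a \<in> ball 0 1" "b \<in> ball 0 1" for a b
  proof -
    have n: "norm a < 1" "norm b < 1" using that by auto
    have "(cmod (1 - cnj a * b))\<^sup>2 - (cmod (a - b))\<^sup>2 = (1 - (cmod a)\<^sup>2) * (1 - (cmod b)\<^sup>2)"
      by (simp add: cmod_power2 algebra_simps) (simp add: power2_eq_square algebra_simps)
    also have "\<dots> > 0" using n by (simp add: power_less_one_iff abs_square_less_1)
    finally have "cmod (a - b) < cmod (1 - cnj a * b)"
      by (simp add: power2_less_imp_less)
    then have "cmod ((a - b) / (1 - cnj a * b)) < 1"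
      by (auto simp: norm_divide divide_less_eq_1)
    then show ?thesis unfolding poincare_dist_def Let_def
      by (intro divide_nonneg_pos ln_ge_zero) (auto simp: field_simps)
  qed
  then show ?thesis by (simp add: disk_contracting_def pseudodistance_on_def)
qed

theorem kobayashi_dist_greatest:
  fixes \<A> :: "('a, 'n::finite) chart set"
  assumes M: "complex_manifold X \<A>" and con: "connected_space X"
  shows "disk_contracting X \<A> (kobayashi_dist X \<A>)"
    and "\<And>d x y. \<lbrakk>disk_contracting X \<A> d; x \<in> topspace X; y \<in> topspace X\<rbrakk>
           \<Longrightarrow> d x y \<le> kobayashi_dist X \<A> x y"
proof -
  let ?C = "Collect (disk_contracting X \<A>)" and ?k = "kobayashi_dist X \<A>"
  have ne: "?C \<noteq> {}" using disk_contracting_zero by blast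
  show upper: "d x y \<le> ?k x y"
    if "disk_contracting X \<A> d" "x \<in> topspace X" "y \<in> topspace X" for d x y
    unfolding kobayashi_dist_def
    by (rule cSUP_upper) (use that disk_contracting_bounded[OF M con] in auto)
  have least: "?k x y \<le> K" if "\<And>d. disk_contracting X \<A> d \<Longrightarrow> d x y \<le> K" for x y K
    unfolding kobayashi_dist_def by (rule cSUP_least[OF ne]) (use that in auto)
  have ps: "pseudodistance_on (topspace X) d" if "disk_contracting X \<A> d" for d
    using that by (simp add: disk_contracting_def)
  have nonneg: "0 \<le> ?k x y" if "x \<in> topspace X" "y \<in> topspace X" for x y
    using upper[OF disk_contracting_zero that] .
  have refl: "?k x x = 0" if "x \<in> topspace X" for x
  proof (rule antisym[OF _ nonneg[OF that that]])
    show "?k x x \<le> 0"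
      by (rule least) (use ps that in \<open>force simp: pseudodistance_on_def\<close>)
  qed
  have symle: "?k x y \<le> ?k y x" if "x \<in> topspace X" "y \<in> topspace X" for x y
  proof (rule least)
    fix d assume d: "disk_contracting X \<A> d"
    then have "d x y = d y x" using ps[OF d] that unfolding pseudodistance_on_def by blast
    then show "d x y \<le> ?k y x" using upper[OF d that(2,1)] by simp
  qed
  have tri: "?k x z \<le> ?k x y + ?k y z"
    if "x \<in> topspace X" "y \<in> topspace X" "z \<in> topspace X" for x y z
  proof (rule least)
    fix d assume d: "disk_contracting X \<A> d"
    show "d x z \<le> ?k x y + ?k y z"
      using pseudodistance_on_triangle[OF ps[OF d] that] upper[OF d that(1,2)] upper[OF d that(2,3)]
      by linarith
  qed
  have contr: "?k (h a) (h b) \<le> poincare_dist a b"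
    if "holo_curve X \<A> (ball 0 1) h" "a \<in> ball 0 1" "b \<in> ball 0 1" for h a b
    by (rule least) (use that in \<open>auto simp: disk_contracting_def\<close>)
  show "disk_contracting X \<A> ?k"
    unfolding disk_contracting_def pseudodistance_on_def
    using nonneg refl symle tri contr by (auto intro: antisym)
qed

lemma biholomorphic_to_domain_connected:
  assumes "strongly_pseudoconvex_domain D" "biholomorphic_to X \<A> D"
  shows "connected_space X"
proof -
  have "X homeomorphic_space (top_of_set D)"
    using assms(2) unfolding biholomorphic_to_def homeomorphic_space_def by blast
  moreover have "connected_space (top_of_set D)"
    using assms(1) by (intro connected_space_subtopology) (simp add: strongly_pseudoconvex_domain_def)
  ultimately show ?thesis
    by (simp add: homeomorphic_connected_space)
qed

section \<open>Linear measure on the unit circle and nontangential convergence\<close>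

definition circle_angles :: "complex set \<Rightarrow> real set" where
  "circle_angles E = {t\<in>{0..<2*pi}. cis t \<in> E}"

definition linearly_measurable :: "complex set \<Rightarrow> bool" where
  "linearly_measurable E \<longleftrightarrow> E \<subseteq> sphere 0 1 \<and> circle_angles E \<in> sets lebesgue"

definition linear_measure :: "complex set \<Rightarrow> ennreal" where
  "linear_measure E = emeasure lebesgue (circle_angles E)"

definition stolz_region :: "complex \<Rightarrow> real \<Rightarrow> complex set" where
  "stolz_region z0 C = {z\<in>ball 0 1. cmod (z - z0) < C * (1 - cmod z)}"

definition converges_nontangentially :: "(nat \<Rightarrow> complex) \<Rightarrow> complex \<Rightarrow> bool" where
  "converges_nontangentially z z0 \<longleftrightarrow>
     z \<longlonglongrightarrow> z0 \<and> (\<exists>C>1. \<forall>n. z n \<in> stolz_region z0 C)"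

end

theory Submission
  imports Defs
begin


text \<open>Let \<open>\<delta>\<close> be the distance to the boundary of the strongly pseudoconvex model domain \<open>D\<close>. The key
  point is that the Gromov product of \<open>x\<close> and \<open>y\<close> stays bounded as long as \<open>|x - y|\<close> is bounded
  below. Affine discs in inner tangent position give \<open>d(x\<^sub>0, x) \<le> - ln (\<delta> x) / 2 + C\<close>. For a lower
  bound of \<open>d(x, y)\<close> it suffices to exhibit a real function \<open>u\<close> on \<open>D\<close> that is 1-Lipschitz along
  every holomorphic disc and to use the pseudodistance \<open>|u x - u y|\<close>. With \<open>P\<close> the Levi polynomial
  at a boundary point near \<open>x\<close>, the function \<open>- ln |P| / 2\<close> is 1-Lipschitz along discs that stay
  near that point, because \<open>P\<close> maps into a half-plane. A disc with centre at depth \<open>\<delta>\<close> does stay there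
  up to radius \<open>1 - B \<delta>\<^sup>\<alpha>\<close>, by the Schwarz lemma and iterated Harnack estimates, and this loss is
  integrable, so a bounded correction of \<open>- ln |P| / 2\<close> absorbs it. The difference of two such
  functions with disjoint supports near \<open>x\<close> and \<open>y\<close> is the required \<open>u\<close>.

  Hence \<open>f - g\<close>, read in \<open>\<complex>\<^sup>n\<close>, tends to \<open>0\<close> along a nontangential sequence at each point of \<open>E\<close>.
  By Fatou's theorem (from a weak type estimate for the maximal function) the bounded function
  \<open>f - g\<close> has radial limit \<open>0\<close> almost everywhere on \<open>E\<close>, so it vanishes by Jensen's inequality.\<close>

section \<open>Holomorphic discs and contracting functions\<close>

text \<open>The coefficient 1/2 must be exact on both sides: in the Gromov product the terms
  \<open>- ln (\<delta> x) / 2\<close> and \<open>- ln (\<delta> y) / 2\<close> have to cancel, and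
  the loss of any fixed factor would leave an unbounded remainder. Its source is that
  \<open>- ln |P| / 2\<close> is exactly 1-Lipschitz for the hyperbolic distance of a half-plane.
  The obstacle is that a disc centred near a boundary point may run far away, where \<open>P\<close>
  is no longer controlled. Restricting it to radius \<open>t\<close> costs a factor
  \<open>1 / t\<close>; with \<open>t = 1 - B w\<^sup>\<alpha>\<close> the slope of the logarithm is
  reduced by \<open>t\<close>, and the accumulated reduction, the integral of
  \<open>w powr (\<alpha> - 1)\<close> near 0, is finite. The iteration yields a power loss of this
  kind: from depth \<delta> a disc needs about \<open>ln (1 / \<delta>)\<close> steps to get away,
  and each step shrinks the remaining distance to the unit circle by a fixed factor. Lower bounds
  come from functions because the Kobayashi distance is by definition the largest contracting
  pseudodistance.\<close>

definition disc_into :: "(complex^'n) set \<Rightarrow> (complex \<Rightarrow> complex^'n) \<Rightarrow> bool" where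
  "disc_into D \<phi> \<longleftrightarrow> (\<forall>j. (\<lambda>z. \<phi> z $ j) holomorphic_on ball 0 1) \<and> \<phi> ` ball 0 1 \<subseteq> D"

lemma disc_into_mem: "disc_into D \<phi> \<Longrightarrow> cmod z < 1 \<Longrightarrow> \<phi> z \<in> D"
  unfolding disc_into_def by auto

lemma disc_into_compose:
  assumes "disc_into D \<phi>" "h holomorphic_on ball 0 1" "h ` ball 0 1 \<subseteq> ball 0 1"
  shows "disc_into D (\<phi> \<circ> h)"
  using assms holomorphic_on_compose_gen[OF assms(2) _ assms(3)]
  unfolding disc_into_def by (fastforce simp: o_def)

section \<open>Moebius maps and Schwarz-type estimates\<close>

definition moebius :: "complex \<Rightarrow> complex \<Rightarrow> complex" where
  "moebius a w = (w + a) / (1 + cnj a * w)"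

lemma moebius_eq: "moebius a = Moebius_function 0 (- a)"
  by (auto simp: moebius_def Moebius_function_simple)

lemma moebius_holomorphic: "cmod a < 1 \<Longrightarrow> moebius a holomorphic_on ball 0 1"
  unfolding moebius_eq by (rule Moebius_function_holomorphic) simp

lemma moebius_norm_lt_1: "cmod a < 1 \<Longrightarrow> cmod w < 1 \<Longrightarrow> cmod (moebius a w) < 1"
  unfolding moebius_eq by (rule Moebius_function_norm_lt_1) simp_all

lemma moebius_0 [simp]: "moebius a 0 = a"
  by (simp add: moebius_def)

lemma one_minus_cnj_mult_nonzero:
  assumes "cmod a < 1" "cmod b < 1" shows "1 - cnj a * b \<noteq> 0"
proof
  assume "1 - cnj a * b = 0"
  then have "cnj a * b = 1" by simp
  then have "cmod a * cmod b = 1" by (metis complex_mod_cnj norm_mult norm_one)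
  moreover have "cmod a * cmod b < 1 * 1"
    using assms by (intro mult_strict_mono') auto
  ultimately show False by simp
qed

lemma moebius_inverse:
  assumes "cmod a < 1" "cmod b < 1"
  shows "moebius a ((b - a) / (1 - cnj a * b)) = b" "cmod ((b - a) / (1 - cnj a * b)) < 1"
proof -
  have nz: "1 - cnj a * b \<noteq> 0" "1 - cnj a * a \<noteq> 0"
    using one_minus_cnj_mult_nonzero assms by auto
  have "1 + cnj a * ((b - a) / (1 - cnj a * b)) = (1 - cnj a * a) / (1 - cnj a * b)"
    using nz by (simp add: field_simps)
  moreover have "(b - a) / (1 - cnj a * b) + a = b * (1 - cnj a * a) / (1 - cnj a * b)"
    using nz by (simp add: field_simps)
  ultimately show "moebius a ((b - a) / (1 - cnj a * b)) = b"
    using nz by (simp add: moebius_def)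
  have "moebius (- a) b = (b - a) / (1 - cnj a * b)" by (simp add: moebius_def)
  then show "cmod ((b - a) / (1 - cnj a * b)) < 1"
    using moebius_norm_lt_1[of "- a" b] assms by simp
qed

lemma disc_into_moebius:
  assumes "disc_into D \<phi>" "cmod a < 1"
  shows "disc_into D (\<phi> \<circ> moebius a)"
  using assms moebius_norm_lt_1[OF assms(2)]
  by (intro disc_into_compose moebius_holomorphic) auto

text \<open>Schwarz lemma for \<open>(f - f 0) / (3 * M)\<close>. The difference is at most
  \<open>2 * M\<close>, so the factor 3 leaves the strict inequality that the Schwarz lemma
  wants.\<close>

lemma schwarz_difference:
  assumes f: "f holomorphic_on ball 0 1" and M: "\<And>z. cmod z < 1 \<Longrightarrow> cmod (f z) \<le> M" "M > 0"
    and z: "cmod z < 1"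
  shows "cmod (f z - f 0) \<le> 3 * M * cmod z"
proof -
  define g where "g w = (f w - f 0) / (3 * M)" for w
  have "cmod (g w) < 1" if "cmod w < 1" for w
  proof -
    have "cmod (f w - f 0) \<le> M + M"
      using norm_triangle_ineq4[of "f w" "f 0"] M(1)[OF that] M(1)[of 0] by simp
    then show ?thesis using M(2) by (simp add: g_def norm_divide norm_mult field_simps)
  qed
  moreover have "g holomorphic_on ball 0 1"
    unfolding g_def using M by (intro holomorphic_intros f) auto
  ultimately have "cmod (g z) \<le> cmod z"
    using Schwarz_Lemma(1)[of g z] z by (simp add: g_def)
  then show ?thesis using M(2) by (simp add: g_def norm_divide norm_mult field_simps)
qed

text \<open>The Cayley transform of the left half-plane that sends \<open>q 0\<close> to 0 turns
  \<open>q\<close> into a self-map of the disc fixing 0, to which the Schwarz lemma applies. To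
  first order at the centre the bound is \<open>2 * |z| * |Re (q 0)| / t\<close>, which is sharp;
  the exact constant in the contraction of \<open>- ln |P| / 2\<close> comes from here.\<close>

lemma half_plane_harnack:
  assumes q: "q holomorphic_on ball 0 t" and neg: "\<And>z. cmod z < t \<Longrightarrow> Re (q z) < 0"
    and z: "cmod z < t"
  shows "cmod (q z - q 0) * (t - cmod z) \<le> 2 * cmod z * \<bar>Re (q 0)\<bar>"
proof -
  have t: "t > 0" using z by (meson norm_ge_zero order_le_less_trans)
  define p where "p w = (q (t * w) - q 0) / (q (t * w) + cnj (q 0))" for w :: complex
  have tw: "cmod (t * w) < t" if "cmod w < 1" for w :: complex
    using that t by (simp add: norm_mult)
  have nz: "q (t * w) + cnj (q 0) \<noteq> 0" if "cmod w < 1" for w :: complex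
  proof -
    have "Re (q (t * w) + cnj (q 0)) < 0"
      using neg[OF tw[OF that]] neg[of 0] t by simp
    then show ?thesis by (metis less_irrefl zero_complex.sel(1))
  qed
  have hq: "(\<lambda>w. q (t * w)) holomorphic_on ball 0 1"
    by (rule holomorphic_on_compose_gen[OF _ q, unfolded o_def])
       (use tw in \<open>auto intro!: holomorphic_intros\<close>)
  have "p holomorphic_on ball 0 1"
    unfolding p_def using nz by (intro holomorphic_intros hq) auto
  moreover have "cmod (p w) < 1" if "cmod w < 1" for w
  proof -
    have a: "Re (q (t * w)) < 0" "Re (q 0) < 0" using neg[OF tw[OF that]] neg[of 0] t by auto
    have "(cmod (q (t * w) - q 0))\<^sup>2 < (cmod (q (t * w) + cnj (q 0)))\<^sup>2"
      using mult_neg_neg[OF a] unfolding cmod_power2 by (simp add: power2_eq_square algebra_simps)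
    then have "cmod (q (t * w) - q 0) < cmod (q (t * w) + cnj (q 0))"
      by (simp add: power2_less_imp_less)
    then show ?thesis
      unfolding p_def norm_divide using nz[OF that] by (simp add: divide_less_eq_1)
  qed
  moreover have zt: "cmod (z / t) < 1" using z t by (simp add: norm_divide)
  moreover have "p 0 = 0" by (simp add: p_def)
  ultimately have "cmod (p (z / t)) \<le> cmod (z / t)"
    using Schwarz_Lemma(1)[of p "z / t"] by blast
  moreover have "t * (z / t) = z" using t by simp
  moreover have nz': "q z + cnj (q 0) \<noteq> 0" using nz[OF zt] t by simp
  ultimately have "cmod (q z - q 0) * t \<le> cmod z * cmod (q z + cnj (q 0))"
    using t by (simp add: p_def norm_divide field_simps)
  moreover have "q z + cnj (q 0) = (q z - q 0) + of_real (2 * Re (q 0))"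
    by (simp add: complex_eq_iff)
  then have "cmod (q z + cnj (q 0)) \<le> cmod (q z - q 0) + cmod (of_real (2 * Re (q 0)) :: complex)"
    by (simp only: norm_triangle_ineq)
  then have "cmod (q z + cnj (q 0)) \<le> cmod (q z - q 0) + 2 * \<bar>Re (q 0)\<bar>"
    unfolding norm_of_real abs_mult by simp
  then have "cmod z * cmod (q z + cnj (q 0)) \<le> cmod z * (cmod (q z - q 0) + 2 * \<bar>Re (q 0)\<bar>)"
    by (intro mult_left_mono) auto
  ultimately show ?thesis by (simp add: algebra_simps)
qed

section \<open>The Poincare distance along a radius\<close>

definition artanh_norm :: "real \<Rightarrow> real" where
  "artanh_norm t = ln ((1 + t) / (1 - t)) / 2"

text \<open>The subtraction formula of the inverse hyperbolic tangent. It says that the Poincare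
  distance is additive along a radius; the quotient is the pseudohyperbolic distance of
  \<open>a\<close> and \<open>b\<close>.\<close>

lemma artanh_norm_diff:
  assumes "0 \<le> a" "a \<le> b" "b < 1"
  shows "artanh_norm b - artanh_norm a = artanh_norm ((b - a) / (1 - a * b))"
proof -
  have ab: "1 - a * b > 0"
    using assms mult_strict_mono'[of a 1 b 1] by simp
  have "artanh_norm b - artanh_norm a = ln (((1 + b) / (1 - b)) / ((1 + a) / (1 - a))) / 2"
    using assms ln_div[of "(1 + b) / (1 - b)" "(1 + a) / (1 - a)"]
    by (simp add: artanh_norm_def diff_divide_distrib)
  also have "1 + (b - a) / (1 - a * b) = (1 + b) * (1 - a) / (1 - a * b)"
       and "1 - (b - a) / (1 - a * b) = (1 - b) * (1 + a) / (1 - a * b)"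
    using ab by (auto simp: field_simps)
  then have "((1 + b) / (1 - b)) / ((1 + a) / (1 - a))
      = (1 + (b - a) / (1 - a * b)) / (1 - (b - a) / (1 - a * b))"
    using ab assms by simp
  finally show ?thesis by (simp add: artanh_norm_def)
qed

lemma artanh_norm_ge: "0 \<le> t \<Longrightarrow> t < 1 \<Longrightarrow> t \<le> artanh_norm t"
proof -
  assume t: "0 \<le> t" "t < 1"
  have "((\<lambda>x. artanh_norm x - x) has_real_derivative (1 / (1 - x\<^sup>2) - 1)) (at x)"
    if "0 \<le> x" "x \<le> t" for x
  proof -
    have "1 - x\<^sup>2 = (1 - x) * (1 + x)" by (simp add: power2_eq_square algebra_simps)
    then show ?thesis
      unfolding artanh_norm_def using that t
      by (auto intro!: derivative_eq_intros) (simp add: divide_simps)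
  qed
  moreover have "1 / (1 - x\<^sup>2) - 1 \<ge> 0" if "0 \<le> x" "x \<le> t" for x
  proof -
    have "x\<^sup>2 < 1" using that t by (simp add: abs_square_less_1)
    then show ?thesis by (simp add: field_simps)
  qed
  ultimately have "artanh_norm 0 - 0 \<le> artanh_norm t - t"
    by (intro DERIV_nonneg_imp_nondecreasing[OF t(1), of "\<lambda>x. artanh_norm x - x"]) blast+
  then show ?thesis by (simp add: artanh_norm_def)
qed

lemma poincare_dist_artanh:
  "poincare_dist a b = artanh_norm (cmod ((b - a) / (1 - cnj a * b)))"
  by (simp add: poincare_dist_def artanh_norm_def Let_def norm_divide norm_minus_commute)

text \<open>Subdividing a radius turns an infinitesimal Lipschitz estimate into a global one.\<close>

lemma infinitesimally_contracting_radial: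
  fixes g :: "real \<Rightarrow> real"
  assumes b: "0 \<le> b" "b < 1"
    and loc: "\<And>\<tau> \<epsilon>. 0 \<le> \<tau> \<Longrightarrow> \<tau> \<le> b \<Longrightarrow> \<epsilon> > 0 \<Longrightarrow> \<exists>d>0. \<forall>s. 0 \<le> s \<and> s < 1 \<and> \<bar>s - \<tau>\<bar> < d \<longrightarrow>
        \<bar>g s - g \<tau>\<bar> \<le> (1 + \<epsilon>) * \<bar>artanh_norm s - artanh_norm \<tau>\<bar>"
  shows "\<bar>g b - g 0\<bar> \<le> artanh_norm b"
proof -
  have mono: "artanh_norm s \<le> artanh_norm t" if "0 \<le> s" "s \<le> t" "t < 1" for s t
  proof -
    have "s * t < 1" using that mult_strict_mono'[of s 1 t 1] by simp
    moreover have "(t - s) / (1 - s * t) < 1"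
    proof -
      have "(1 - t) * (1 + s) > 0" using that by simp
      then show ?thesis using \<open>s * t < 1\<close> by (simp add: field_simps)
    qed
    ultimately have "0 \<le> artanh_norm ((t - s) / (1 - s * t))"
      using that artanh_norm_ge[of "(t - s) / (1 - s * t)"] by (smt (verit) divide_nonneg_nonneg)
    then show ?thesis using artanh_norm_diff[OF that] by simp
  qed
  have eps: "\<bar>g b - g 0\<bar> \<le> (1 + \<epsilon>) * artanh_norm b" if e: "\<epsilon> > 0" for \<epsilon>
  proof -
    \<comment> \<open>A property of intervals that is additive under subdivision and holds on every
      short interval around a given point; bisection then yields it on
      \<open>{0..b}\<close>.\<close>
    define P where "P x y \<longleftrightarrow> 0 \<le> x \<and> x \<le> y \<and> y \<le> b \<longrightarrow>
      \<bar>g y - g x\<bar> \<le> (1 + \<epsilon>) * (artanh_norm y - artanh_norm x)" for x y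
    have "P 0 b"
    proof (rule Bolzano[OF b(1)])
      fix x y z assume "P x y" "P y z" "x \<le> y" "y \<le> z"
      then show "P x z" unfolding P_def by (smt (verit) distrib_left mult_minus_right)
    next
      fix x assume x: "0 \<le> x" "x \<le> b"
      obtain d where d: "d > 0" "\<And>s. 0 \<le> s \<Longrightarrow> s < 1 \<Longrightarrow> \<bar>s - x\<bar> < d \<Longrightarrow>
          \<bar>g s - g x\<bar> \<le> (1 + \<epsilon>) * \<bar>artanh_norm s - artanh_norm x\<bar>"
        using loc[OF x e] by blast
      have "P u v" if uv: "u \<le> x" "x \<le> v" "v - u < d" for u v
        unfolding P_def
      proof
        assume *: "0 \<le> u \<and> u \<le> v \<and> v \<le> b"
        have "\<bar>g u - g x\<bar> \<le> (1 + \<epsilon>) * \<bar>artanh_norm u - artanh_norm x\<bar>"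
          by (rule d(2)) (use * uv b in auto)
        moreover have "\<bar>g v - g x\<bar> \<le> (1 + \<epsilon>) * \<bar>artanh_norm v - artanh_norm x\<bar>"
          by (rule d(2)) (use * uv b in auto)
        moreover have "artanh_norm u \<le> artanh_norm x" "artanh_norm x \<le> artanh_norm v"
          using mono[of u x] mono[of x v] * uv b by auto
        ultimately show "\<bar>g v - g u\<bar> \<le> (1 + \<epsilon>) * (artanh_norm v - artanh_norm u)"
          by (smt (verit) distrib_left mult_minus_right)
      qed
      then show "\<exists>d>0. \<forall>u v. u \<le> x \<and> x \<le> v \<and> v - u < d \<longrightarrow> P u v" using d(1) by blast
    qed
    then show ?thesis using b by (simp add: P_def artanh_norm_def)
  qed
  have A: "0 \<le> artanh_norm b" using artanh_norm_ge[OF b] b by simp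
  show ?thesis
  proof (rule field_le_epsilon)
    fix e :: real assume e: "e > 0"
    have "\<bar>g b - g 0\<bar> \<le> (1 + e / (1 + artanh_norm b)) * artanh_norm b"
      using eps[of "e / (1 + artanh_norm b)"] e A by simp
    also have "e / (1 + artanh_norm b) * artanh_norm b \<le> e"
      using e A by (simp add: field_simps)
    then have "(1 + e / (1 + artanh_norm b)) * artanh_norm b \<le> artanh_norm b + e"
      by (simp add: distrib_right)
    finally show "\<bar>g b - g 0\<bar> \<le> artanh_norm b + e" .
  qed
qed

definition infinitesimally_contracting :: "(complex^'n) set \<Rightarrow> (complex^'n \<Rightarrow> real) \<Rightarrow> bool" where
  "infinitesimally_contracting D u \<longleftrightarrow> (\<forall>\<phi>. disc_into D \<phi> \<longrightarrow>
     (\<forall>\<epsilon>>0. \<exists>d>0. \<forall>w. cmod w < d \<and> cmod w < 1 \<longrightarrow> \<bar>u (\<phi> w) - u (\<phi> 0)\<bar> \<le> (1 + \<epsilon>) * cmod w))"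

text \<open>Reparametrising the disc so that \<open>a\<close> becomes the centre turns the geodesic
  from \<open>a\<close> to \<open>b\<close> into a radius, and
  \<open>infinitesimally_contracting_radial\<close> is applied along it. Its local hypothesis at a
  point \<open>p\<close> of the radius comes from a second automorphism, which moves
  \<open>p\<close> to the centre.\<close>

lemma infinitesimally_contracting_imp_contracting:
  assumes u: "infinitesimally_contracting D u" and phi: "disc_into D \<phi>"
    and ab: "cmod a < 1" "cmod b < 1"
  shows "\<bar>u (\<phi> a) - u (\<phi> b)\<bar> \<le> poincare_dist a b"
proof -
  define \<psi> where "\<psi> = \<phi> \<circ> moebius a"
  define w where "w = (b - a) / (1 - cnj a * b)"
  have psi: "disc_into D \<psi>" unfolding \<psi>_def by (rule disc_into_moebius[OF phi ab(1)])
  have w: "cmod w < 1" "\<psi> w = \<phi> b" "\<psi> 0 = \<phi> a"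
    using moebius_inverse[OF ab] by (auto simp: w_def \<psi>_def)
  \<comment> \<open>Unit direction of \<open>w\<close>; for \<open>w = 0\<close> any unimodular
    number will serve.\<close>
  define e where "e = (if w = 0 then 1 else sgn w)"
  have e: "cmod e = 1" "w = cmod w * e"
    using norm_sgn[of w] by (auto simp: e_def sgn_eq)
  define g where "g \<tau> = u (\<psi> (of_real \<tau> * e))" for \<tau>
  have "\<bar>g (cmod w) - g 0\<bar> \<le> artanh_norm (cmod w)"
  proof (rule infinitesimally_contracting_radial)
    fix \<tau> \<epsilon> :: real assume tau: "0 \<le> \<tau>" "\<tau> \<le> cmod w" and eps: "\<epsilon> > 0"
    define p where "p = of_real \<tau> * e"
    have np: "cmod p < 1" "cmod p = \<tau>" using tau w e by (auto simp: p_def norm_mult)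
    obtain d where d: "d > 0" "\<And>v. cmod v < d \<Longrightarrow> cmod v < 1 \<Longrightarrow>
        \<bar>u ((\<psi> \<circ> moebius p) v) - u ((\<psi> \<circ> moebius p) 0)\<bar> \<le> (1 + \<epsilon>) * cmod v"
      using u disc_into_moebius[OF psi np(1)] eps unfolding infinitesimally_contracting_def by meson
    \<comment> \<open>The factor \<open>1 - \<tau>\<close> converts Euclidean into pseudohyperbolic
      closeness: \<open>|v| = |s - \<tau>| / (1 - \<tau> * s)\<close>, and the denominator is at
      least \<open>1 - \<tau>\<close>.\<close>
    have "\<bar>g s - g \<tau>\<bar> \<le> (1 + \<epsilon>) * \<bar>artanh_norm s - artanh_norm \<tau>\<bar>"
      if s: "0 \<le> s" "s < 1" "\<bar>s - \<tau>\<bar> < d * (1 - \<tau>)" for s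
    proof -
      define r where "r = of_real s * e"
      define v where "v = (r - p) / (1 - cnj p * r)"
      have nr: "cmod r < 1" using s e by (simp add: r_def norm_mult)
      have t1: "\<tau> < 1" using np by simp
      have "s * \<tau> \<le> 1 * \<tau>" using s tau by (intro mult_right_mono) auto
      then have st: "1 - \<tau> * s \<ge> 1 - \<tau>" "1 - \<tau> * s > 0" using t1 by (auto simp: mult.commute)
      have "e * cnj e = 1" using e by (simp add: complex_norm_square[symmetric])
      then have "cnj p * r = of_real (\<tau> * s)"
        by (simp add: p_def r_def algebra_simps)
      then have "1 - cnj p * r = of_real (1 - \<tau> * s)" by simp
      moreover have "r - p = of_real (s - \<tau>) * e" by (simp add: r_def p_def algebra_simps)
      ultimately have "cmod v = \<bar>s - \<tau>\<bar> * cmod e / \<bar>1 - \<tau> * s\<bar>"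
        unfolding v_def by (simp only: norm_divide norm_mult norm_of_real)
      then have nv: "cmod v = \<bar>s - \<tau>\<bar> / (1 - \<tau> * s)" using e st by simp
      have "\<bar>s - \<tau>\<bar> < d * (1 - \<tau> * s)"
        using s(3) d(1) mult_left_mono[OF st(1), of d] by linarith
      then have "cmod v < d" using st by (simp add: nv divide_less_eq)
      moreover have v1: "cmod v < 1" "moebius p v = r"
        using moebius_inverse[OF np(1) nr] by (auto simp: v_def)
      ultimately have "\<bar>g s - g \<tau>\<bar> \<le> (1 + \<epsilon>) * cmod v"
        using d(2)[of v] by (simp add: g_def r_def p_def)
      also have "cmod v \<le> artanh_norm (cmod v)" using v1 by (intro artanh_norm_ge) auto
      also have "artanh_norm (cmod v) = \<bar>artanh_norm s - artanh_norm \<tau>\<bar>"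
      proof (cases "\<tau> \<le> s")
        case True
        then have "artanh_norm s - artanh_norm \<tau> = artanh_norm (cmod v)"
          using artanh_norm_diff[of \<tau> s] tau s nv by simp
        moreover have "artanh_norm (cmod v) \<ge> 0"
          using artanh_norm_ge[of "cmod v"] v1 by (smt (verit) norm_ge_zero)
        ultimately show ?thesis by simp
      next
        case False
        then have "artanh_norm \<tau> - artanh_norm s = artanh_norm (cmod v)"
          using artanh_norm_diff[of s \<tau>] tau s t1 nv by (simp add: mult.commute)
        moreover have "artanh_norm (cmod v) \<ge> 0"
          using artanh_norm_ge[of "cmod v"] v1 by (smt (verit) norm_ge_zero)
        ultimately show ?thesis by simp
      qed
      finally show ?thesis using eps by simp
    qed
    moreover have "d * (1 - \<tau>) > 0" using d np by simp
    ultimately show "\<exists>d>0. \<forall>s. 0 \<le> s \<and> s < 1 \<and> \<bar>s - \<tau>\<bar> < d \<longrightarrow>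
        \<bar>g s - g \<tau>\<bar> \<le> (1 + \<epsilon>) * \<bar>artanh_norm s - artanh_norm \<tau>\<bar>"
      by blast
  qed (use w in auto)
  then have "\<bar>u (\<phi> b) - u (\<phi> a)\<bar> \<le> artanh_norm (cmod w)"
    using e(2) w by (simp add: g_def)
  then show ?thesis
    by (simp add: poincare_dist_artanh w_def abs_minus_commute)
qed


section \<open>Localization of discs at peak points\<close>

text \<open>Holomorphic on the whole space: the functions to be used are polynomials, so no domain
  has to be tracked.\<close>

definition holo_fun :: "(complex^'n \<Rightarrow> complex) \<Rightarrow> bool" where
  "holo_fun P \<longleftrightarrow> (\<forall>z. \<exists>P'. (P has_derivative P') (at z) \<and> (\<forall>c v. P' (c *s v) = c * P' v))"

lemma has_derivative_cart_complex:
  fixes f :: "complex \<Rightarrow> complex^'n"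
  assumes "\<And>j. ((\<lambda>z. f z $ j) has_field_derivative d j) (at z)"
  shows "(f has_derivative (\<lambda>h. h *s (\<chi> j. d j))) (at z)"
proof -
  have "((\<lambda>z. f z \<bullet> i) has_derivative (\<lambda>h. (h *s (\<chi> j. d j)) \<bullet> i)) (at z)" if i: "i \<in> Basis" for i
  proof -
    obtain j b where jb: "i = axis j b" using i by (auto simp: Basis_vec_def)
    have "((\<lambda>z. f z $ j) has_derivative (\<lambda>h. h * d j)) (at z)"
      using assms[of j] unfolding has_field_derivative_def by (simp add: mult.commute[of _ "d j"])
    then have "((\<lambda>z. (f z $ j) \<bullet> b) has_derivative (\<lambda>h. (h * d j) \<bullet> b)) (at z)"
      by (rule bounded_linear.has_derivative[OF bounded_linear_inner_left])
    then show ?thesis by (simp add: jb inner_axis)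
  qed
  then show ?thesis by (subst has_derivative_componentwise_within) blast
qed

lemma holo_fun_compose:
  fixes f :: "complex \<Rightarrow> complex^'n"
  assumes P: "holo_fun P" and f: "\<And>j. (\<lambda>z. f z $ j) holomorphic_on S" and S: "open S"
  shows "(\<lambda>z. P (f z)) holomorphic_on S"
proof -
  have "\<exists>l. ((\<lambda>z. P (f z)) has_field_derivative l) (at z)" if z: "z \<in> S" for z
  proof -
    have "\<exists>d. ((\<lambda>z. f z $ j) has_field_derivative d) (at z)" for j
      using f[of j] S z by (meson field_differentiable_def holomorphic_on_imp_differentiable_at)
    then obtain d where d: "\<And>j. ((\<lambda>z. f z $ j) has_field_derivative d j) (at z)" by metis
    obtain P' where P': "(P has_derivative P') (at (f z))" "\<And>c v. P' (c *s v) = c * P' v"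
      using P unfolding holo_fun_def by meson
    have "(P \<circ> f has_derivative P' \<circ> (\<lambda>h. h *s (\<chi> j. d j))) (at z)"
      by (rule diff_chain_at[OF has_derivative_cart_complex[OF d] P'(1)])
    then have "((\<lambda>z. P (f z)) has_field_derivative P' (\<chi> j. d j)) (at z)"
      unfolding has_field_derivative_def by (simp add: o_def P'(2) mult.commute[of _ "P' _"])
    then show ?thesis by blast
  qed
  then show ?thesis
    unfolding holomorphic_on_def field_differentiable_def
    by (blast intro: has_field_derivative_at_within)
qed

lemma norm_cart_le_sum: "norm (x :: complex^'n) \<le> (\<Sum>j\<in>UNIV. cmod (x $ j))"
  unfolding norm_vec_def by (rule L2_set_le_sum) simp

text \<open>All that the estimates of discs take from the boundary is a family of local peak
  functions with common constants. \<open>R\<close> is a parameter so that it can later be shrunk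
  below the separation of two given points.\<close>

locale peak_domain =
  fixes D :: "(complex^'n) set" and M R c C :: real
  assumes open_D: "open D" and D_nonempty: "D \<noteq> {}"
    and norm_D: "\<And>z. z \<in> D \<Longrightarrow> norm z \<le> M"
    and R_pos: "R > 0" and c_pos: "c > 0" and C_pos: "C > 0"
    and peak: "\<And>\<zeta>. \<zeta> \<in> frontier D \<Longrightarrow> \<exists>P. holo_fun P \<and> (\<forall>z\<in>D. norm (z - \<zeta>) < R \<longrightarrow>
      Re (P z) \<le> - c * (norm (z - \<zeta>))\<^sup>2 \<and> Re (P z) \<le> - c * infdist z (frontier D) \<and>
      cmod (P z) \<le> C * norm (z - \<zeta>))"
begin

abbreviation \<delta> :: "complex^'n \<Rightarrow> real" where "\<delta> z \<equiv> infdist z (frontier D)"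

lemma M_nonneg: "M \<ge> 0"
  using D_nonempty norm_D norm_ge_zero order_trans by blast

lemma bounded_D: "bounded D"
  using norm_D by (auto simp: bounded_iff)

lemma frontier_nonempty: "frontier D \<noteq> {}"
  using D_nonempty bounded_D by (metis frontier_not_empty not_bounded_UNIV)

lemma \<delta>_pos: "z \<in> D \<Longrightarrow> \<delta> z > 0"
  using frontier_nonempty open_D
  by (intro infdist_pos_not_in_closed) (auto simp: frontier_def interior_open)

lemma \<delta>_attained: obtains \<zeta> where "\<zeta> \<in> frontier D" "\<delta> z = norm (z - \<zeta>)"
  using infdist_attains_inf[OF frontier_closed frontier_nonempty, of z] by (metis dist_norm)

section \<open>How far a disc centred near the boundary can stray\<close>

lemma disc_lipschitz:
  "\<exists>N>0. \<forall>\<phi> z. disc_into D \<phi> \<longrightarrow> cmod z < 1 \<longrightarrow> norm (\<phi> z - \<phi> 0) \<le> N * cmod z"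
proof (intro exI conjI allI impI)
  show "real CARD('n) * (3 * (M + 1)) > 0" using M_nonneg by simp
  fix \<phi> z assume phi: "disc_into D \<phi>" and z: "cmod z < 1"
  have "cmod ((\<phi> z - \<phi> 0) $ j) \<le> 3 * (M + 1) * cmod z" for j
  proof -
    have "cmod (\<phi> w $ j) \<le> M + 1" if "cmod w < 1" for w
      using Finite_Cartesian_Product.norm_nth_le[of "\<phi> w" j] norm_D[OF disc_into_mem[OF phi that]] by linarith
    then show ?thesis
      using schwarz_difference[of "\<lambda>z. \<phi> z $ j" "M + 1" z] phi M_nonneg z
      unfolding disc_into_def by simp
  qed
  then have "(\<Sum>j\<in>UNIV. cmod ((\<phi> z - \<phi> 0) $ j)) \<le> (\<Sum>j\<in>(UNIV :: 'n set). 3 * (M + 1) * cmod z)"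
    by (intro sum_mono)
  then show "norm (\<phi> z - \<phi> 0) \<le> real CARD('n) * (3 * (M + 1)) * cmod z"
    using norm_cart_le_sum[of "\<phi> z - \<phi> 0"] by simp
qed

text \<open>On a small disc about 0 the image stays near the foot point \<open>\<zeta>\<close> of
  \<open>\<phi> 0\<close>, so \<open>P\<close> composed with \<open>\<phi>\<close> lies in the left
  half-plane and the Harnack estimate keeps \<open>- Re P\<close> below a constant times
  \<open>\<delta> (\<phi> 0)\<close>. The two peak inequalities translate this into a bound on the
  boundary distance and a square root bound on the displacement.\<close>

lemma disc_step:
  "\<exists>\<beta> e1 C1 C2. 0 < \<beta> \<and> \<beta> \<le> 1/2 \<and> e1 > 0 \<and> C1 \<ge> 4 \<and> C2 > 0 \<and>
    (\<forall>\<phi> w. disc_into D \<phi> \<longrightarrow> \<delta> (\<phi> 0) \<le> e1 \<longrightarrow> cmod w \<le> \<beta> \<longrightarrow>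
       \<delta> (\<phi> w) \<le> C1 * \<delta> (\<phi> 0) \<and> norm (\<phi> w - \<phi> 0) \<le> C2 * sqrt (\<delta> (\<phi> 0)))"
proof -
  obtain N where N: "N > 0" "\<And>\<phi> z. disc_into D \<phi> \<Longrightarrow> cmod z < 1 \<Longrightarrow> norm (\<phi> z - \<phi> 0) \<le> N * cmod z"
    using disc_lipschitz by blast
  \<comment> \<open>\<open>t\<close> keeps the disc within \<open>R / 2\<close> of
    \<open>\<phi> 0\<close>, and \<open>e1\<close> puts the foot point within \<open>R / 2\<close>
    of it. The 3 in \<open>C1\<close> is 1 from the value at the centre plus 2 from the Harnack
    estimate on radius \<open>t / 2\<close>.\<close>
  define t where "t = min 1 (R / (2 * N))"
  define e1 where "e1 = min 1 (R / 2)"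
  define C1 where "C1 = max 4 (3 * C / c)"
  have t: "0 < t" "t \<le> 1" "N * t \<le> R / 2"
    using N(1) R_pos by (auto simp: t_def min_def field_simps)
  have C1: "C1 \<ge> 4" "3 * C / c \<le> C1" by (auto simp: C1_def)
  have main: "\<delta> (\<phi> w) \<le> C1 * \<delta> (\<phi> 0) \<and> norm (\<phi> w - \<phi> 0) \<le> (sqrt C1 + 1) * sqrt (\<delta> (\<phi> 0))"
    if phi: "disc_into D \<phi>" and small: "\<delta> (\<phi> 0) \<le> e1" and w: "cmod w \<le> t / 2" for \<phi> w
  proof -
    obtain \<zeta> where z: "\<zeta> \<in> frontier D" "\<delta> (\<phi> 0) = norm (\<phi> 0 - \<zeta>)" by (rule \<delta>_attained)
    obtain P where P: "holo_fun P" "\<And>z. z \<in> D \<Longrightarrow> norm (z - \<zeta>) < R \<Longrightarrow>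
      Re (P z) \<le> - c * (norm (z - \<zeta>))\<^sup>2 \<and> Re (P z) \<le> - c * \<delta> z \<and> cmod (P z) \<le> C * norm (z - \<zeta>)"
      using peak[OF z(1)] by blast
    define q where "q v = P (\<phi> v)" for v
    have inD: "\<phi> v \<in> D" if "cmod v < t" for v
      using disc_into_mem[OF phi] that t by simp
    have near: "norm (\<phi> v - \<zeta>) < R" if "cmod v < t" for v
    proof -
      have "norm (\<phi> v - \<phi> 0) \<le> N * cmod v" using N(2)[OF phi, of v] that t by simp
      also have "\<dots> < N * t" using N(1) that by simp
      finally have "norm (\<phi> v - \<phi> 0) < R / 2" using t by simp
      moreover have "norm (\<phi> v - \<zeta>) \<le> norm (\<phi> v - \<phi> 0) + norm (\<phi> 0 - \<zeta>)"
        using norm_triangle_ineq[of "\<phi> v - \<phi> 0" "\<phi> 0 - \<zeta>"] by simp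
      ultimately show ?thesis using small z(2) by (simp add: e1_def)
    qed
    have hol: "q holomorphic_on ball 0 t"
      unfolding q_def
    proof (rule holo_fun_compose[OF P(1)])
      show "(\<lambda>z. \<phi> z $ j) holomorphic_on ball 0 t" for j
        by (rule holomorphic_on_subset[of _ "ball 0 1"]) (use phi t in \<open>auto simp: disc_into_def\<close>)
    qed simp
    have neg: "Re (q v) < 0" if "cmod v < t" for v
    proof -
      have "c * \<delta> (\<phi> v) > 0" using \<delta>_pos[OF inD[OF that]] c_pos by simp
      then show ?thesis using P(2)[OF inD[OF that] near[OF that]] by (simp add: q_def)
    qed
    have wt: "cmod w < t" using w t by simp
    have "cmod (q w - q 0) * (t - cmod w) \<le> 2 * cmod w * \<bar>Re (q 0)\<bar>"
      by (rule half_plane_harnack[OF hol neg wt])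
    also have "\<dots> \<le> 2 * (t - cmod w) * \<bar>Re (q 0)\<bar>"
      using w by (intro mult_right_mono) auto
    finally have "cmod (q w - q 0) * (t - cmod w) \<le> (2 * \<bar>Re (q 0)\<bar>) * (t - cmod w)"
      by (simp add: algebra_simps)
    then have "cmod (q w - q 0) \<le> 2 * \<bar>Re (q 0)\<bar>"
      using wt by simp
    moreover have "\<bar>Re (q w) - Re (q 0)\<bar> \<le> cmod (q w - q 0)"
      using abs_Re_le_cmod[of "q w - q 0"] by simp
    moreover have "\<bar>Re (q 0)\<bar> \<le> cmod (q 0)" by (rule abs_Re_le_cmod)
    moreover have "cmod (q 0) \<le> C * \<delta> (\<phi> 0)"
      using P(2)[OF inD near, of 0] t z by (simp add: q_def)
    ultimately have "- Re (q w) \<le> 3 * C * \<delta> (\<phi> 0)" by linarith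
    then have "c * (norm (\<phi> w - \<zeta>))\<^sup>2 \<le> 3 * C * \<delta> (\<phi> 0)" "c * \<delta> (\<phi> w) \<le> 3 * C * \<delta> (\<phi> 0)"
      using P(2)[OF inD[OF wt] near[OF wt]] by (auto simp: q_def)
    then have a: "(norm (\<phi> w - \<zeta>))\<^sup>2 \<le> 3 * C / c * \<delta> (\<phi> 0)" "\<delta> (\<phi> w) \<le> 3 * C / c * \<delta> (\<phi> 0)"
      using c_pos by (auto simp: field_simps)
    moreover have b: "3 * C / c * \<delta> (\<phi> 0) \<le> C1 * \<delta> (\<phi> 0)"
      using C1 by (intro mult_right_mono infdist_nonneg) auto
    ultimately have "norm (\<phi> w - \<zeta>) \<le> sqrt (C1 * \<delta> (\<phi> 0))"
      by (intro real_le_rsqrt) linarith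
    moreover have "\<delta> (\<phi> 0) \<le> sqrt (\<delta> (\<phi> 0))"
    proof (rule real_le_rsqrt)
      show "(\<delta> (\<phi> 0))\<^sup>2 \<le> \<delta> (\<phi> 0)"
        using small infdist_nonneg[of "\<phi> 0" "frontier D"] mult_right_mono[of "\<delta> (\<phi> 0)" 1 "\<delta> (\<phi> 0)"]
        by (simp add: e1_def power2_eq_square)
    qed
    moreover have "norm (\<phi> w - \<phi> 0) \<le> norm (\<phi> w - \<zeta>) + norm (\<phi> 0 - \<zeta>)"
      using norm_triangle_ineq4[of "\<phi> w - \<zeta>" "\<phi> 0 - \<zeta>"] by simp
    ultimately have "norm (\<phi> w - \<phi> 0) \<le> (sqrt C1 + 1) * sqrt (\<delta> (\<phi> 0))"
      using z(2) by (simp add: real_sqrt_mult distrib_right)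
    then show ?thesis using a b by linarith
  qed
  have "0 < t / 2" "t / 2 \<le> 1 / 2" "e1 > 0" "sqrt C1 + 1 > 0"
    using t C1 R_pos by (auto simp: e1_def intro: add_nonneg_pos)
  then show ?thesis using main C1(1) by blast
qed

text \<open>One step moves a fixed hyperbolic distance and multiplies the boundary distance by at most \<open>C1\<close>;
  since \<open>C1 \<ge> 4\<close>, the displacements form a geometric series dominated by its last term.\<close>

lemma disc_iterated:
  assumes b: "0 < \<beta>" "\<beta> \<le> 1/2" and C1: "C1 \<ge> 4" and C2: "C2 > 0"
    and step: "\<And>\<phi> w. disc_into D \<phi> \<Longrightarrow> \<delta> (\<phi> 0) \<le> e1 \<Longrightarrow> cmod w \<le> \<beta> \<Longrightarrow>
       \<delta> (\<phi> w) \<le> C1 * \<delta> (\<phi> 0) \<and> norm (\<phi> w - \<phi> 0) \<le> C2 * sqrt (\<delta> (\<phi> 0))"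
    and phi: "disc_into D \<phi>" and small: "C1 ^ k * \<delta> (\<phi> 0) \<le> e1" and w: "cmod w \<le> 1 - (1 - \<beta>) ^ k"
  shows "\<delta> (\<phi> w) \<le> C1 ^ k * \<delta> (\<phi> 0) \<and> norm (\<phi> w - \<phi> 0) \<le> C2 * sqrt (C1 ^ k * \<delta> (\<phi> 0))"
  using small w
proof (induction k arbitrary: w)
  case 0
  then have "w = 0" by simp
  then show ?case using C2 infdist_nonneg[of "\<phi> 0" "frontier D"] by simp
next
  case (Suc k)
  let ?s = "C1 ^ k * \<delta> (\<phi> 0)"
  have s0: "?s \<ge> 0" using C1 by (intro mult_nonneg_nonneg zero_le_power infdist_nonneg) auto
  have ss: "C1 ^ Suc k * \<delta> (\<phi> 0) = C1 * ?s" by simp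
  have s1: "4 * ?s \<le> C1 * ?s" using s0 C1 by (intro mult_right_mono) auto
  have s: "?s \<le> e1" using s0 s1 Suc.prems(1) unfolding ss by linarith
  \<comment> \<open>Because \<open>C1 \<ge> 4\<close>, the new bound is at least twice the old one:
    it covers both the displacement so far and that of the next step.\<close>
  have sq: "2 * sqrt ?s \<le> sqrt (C1 * ?s)"
    using s0 s1 by (intro real_le_rsqrt) (simp add: power_mult_distrib)
  show ?case
  proof (cases "cmod w \<le> 1 - (1 - \<beta>) ^ k")
    case True
    have "sqrt ?s \<le> sqrt (C1 * ?s)" using sq real_sqrt_ge_zero[OF s0] by linarith
    then have "C2 * sqrt ?s \<le> C2 * sqrt (C1 * ?s)" using C2 by simp
    then show ?thesis using Suc.IH[OF s True] s1 s0 unfolding ss by linarith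
  next
    case False
    define l where "l = (1 - \<beta>) ^ k"
    have l: "0 < l" "l \<le> 1" using b by (auto simp: l_def power_le_one)
    define A where "A = 1 - l"
    have A: "0 \<le> A" "A < 1" "A < cmod w" using l False by (auto simp: A_def l_def)
    have "cmod w \<le> 1 - (1 - \<beta>) * l" using Suc.prems(2) by (simp add: l_def)
    then have wA: "cmod w - A \<le> \<beta> * (1 - A)" by (simp add: A_def algebra_simps)
    have "(1 - \<beta>) * l > 0" using l b by simp
    with \<open>cmod w \<le> 1 - (1 - \<beta>) * l\<close> have w1: "cmod w < 1" by linarith
    \<comment> \<open>The point of modulus \<open>1 - (1 - \<beta>) ^ k\<close> on the radius
      through \<open>w\<close>. Once an automorphism has moved \<open>a\<close> to the centre,
      \<open>w\<close> lies within \<open>\<beta>\<close> of it, so one more step reaches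
      it.\<close>
    define a where "a = of_real (A / cmod w) * w"
    have w0: "cmod w > 0" using A by linarith
    have na: "cmod a = A"
      unfolding a_def norm_mult norm_of_real using w0 A by (simp add: abs_mult)
    define v where "v = (w - a) / (1 - cnj a * w)"
    have v: "moebius a v = w" using moebius_inverse[of a w] na A w1 by (simp add: v_def)
    have "w \<noteq> 0" using A by auto
    have "w - a = of_real (1 - A / cmod w) * w" by (simp add: a_def algebra_simps)
    then have "cmod (w - a) = \<bar>1 - A / cmod w\<bar> * cmod w" by (simp only: norm_mult norm_of_real)
    also have "\<dots> = cmod w - A" using A w0 by (simp add: abs_if field_simps)
    finally have n1: "cmod (w - a) = cmod w - A" .
    have "cmod (1 - cnj a * w) \<ge> 1 - cmod (cnj a * w)"
      using norm_triangle_ineq2[of 1 "cnj a * w"] by simp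
    moreover have "cmod (cnj a * w) \<le> A * 1"
      unfolding norm_mult complex_mod_cnj na using A w1 by (intro mult_left_mono) auto
    ultimately have n2: "cmod (1 - cnj a * w) \<ge> 1 - A" by simp
    have "cmod v \<le> (cmod w - A) / (1 - A)"
      unfolding v_def norm_divide n1 using n2 A by (intro divide_left_mono mult_pos_pos) auto
    also have "\<dots> \<le> \<beta>" using wA A by (simp add: divide_le_eq)
    finally have nv: "cmod v \<le> \<beta>" .
    have IH: "\<delta> (\<phi> a) \<le> ?s" "norm (\<phi> a - \<phi> 0) \<le> C2 * sqrt ?s"
      using Suc.IH[OF s, of a] na by (auto simp: A_def l_def)
    have st: "\<delta> (\<phi> w) \<le> C1 * \<delta> (\<phi> a)" "norm (\<phi> w - \<phi> a) \<le> C2 * sqrt (\<delta> (\<phi> a))"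
      using step[OF disc_into_moebius[OF phi, of a], of v] na A nv IH(1) s v by auto
    have "C1 * \<delta> (\<phi> a) \<le> C1 * ?s" using IH(1) C1 by (intro mult_left_mono) auto
    moreover have "C2 * sqrt (\<delta> (\<phi> a)) \<le> C2 * sqrt ?s" using IH(1) C2 by simp
    moreover have "norm (\<phi> w - \<phi> 0) \<le> norm (\<phi> w - \<phi> a) + norm (\<phi> a - \<phi> 0)"
      using norm_triangle_ineq[of "\<phi> w - \<phi> a" "\<phi> a - \<phi> 0"] by simp
    moreover have "2 * (C2 * sqrt ?s) \<le> C2 * sqrt (C1 * ?s)"
      using mult_left_mono[OF sq, of C2] C2 by simp
    ultimately show ?thesis using st IH unfolding ss by linarith
  qed
qed

text \<open>The iteration may continue while \<open>C1 ^ k * \<delta> (\<phi> 0)\<close> stays below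
  \<open>e2\<close>, a number of rounds logarithmic in the depth, and \<open>k\<close> rounds reach
  the radius \<open>1 - (1 - \<beta>) ^ k\<close>. The rim that is not reached is therefore a power
  of the depth.\<close>

lemma disc_localization:
  "\<exists>\<alpha> B e2. \<alpha> > 0 \<and> B > 0 \<and> e2 > 0 \<and> (\<forall>\<phi> w. disc_into D \<phi> \<longrightarrow> \<delta> (\<phi> 0) \<le> e2 \<longrightarrow>
     cmod w < 1 - B * \<delta> (\<phi> 0) powr \<alpha> \<longrightarrow> norm (\<phi> w - \<phi> 0) < R / 2)"
proof -
  obtain \<beta> e1 C1 C2 where b: "0 < \<beta>" "\<beta> \<le> 1/2" and e1: "e1 > 0" and C1: "C1 \<ge> 4" and C2: "C2 > 0"
    and step: "\<And>\<phi> w. disc_into D \<phi> \<Longrightarrow> \<delta> (\<phi> 0) \<le> e1 \<Longrightarrow> cmod w \<le> \<beta> \<Longrightarrow>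
       \<delta> (\<phi> w) \<le> C1 * \<delta> (\<phi> 0) \<and> norm (\<phi> w - \<phi> 0) \<le> C2 * sqrt (\<delta> (\<phi> 0))"
    using disc_step by blast
  define e2 where "e2 = min e1 ((R / (4 * C2))\<^sup>2)"
  have e2: "e2 > 0" "e2 \<le> e1" using e1 R_pos C2 by (auto simp: e2_def)
  have "C2 * sqrt e2 \<le> C2 * sqrt ((R / (4 * C2))\<^sup>2)"
    using C2 by (intro mult_left_mono real_sqrt_le_mono) (auto simp: e2_def)
  also have "\<dots> = R / 4" using C2 R_pos by simp
  finally have e2R: "C2 * sqrt e2 < R / 2" using R_pos by simp
  define l where "l = 1 - \<beta>"
  have l: "0 < l" "l < 1" using b by (auto simp: l_def)
  \<comment> \<open>Chosen so that \<open>l ^ k = (1 / C1 ^ k) powr \<alpha>\<close>. The factor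
    \<open>1 / l\<close> in \<open>B\<close> pays for the passage from \<open>k\<close> to
    \<open>Suc k\<close>: the comparison with the depth uses the first power of \<open>C1\<close>
    that is too large.\<close>
  define \<alpha> where "\<alpha> = - ln l / ln C1"
  have al: "\<alpha> > 0" using l C1 by (auto simp: \<alpha>_def intro!: divide_neg_pos)
  define B where "B = (1 / l) * (1 / e2) powr \<alpha>"
  have B: "B > 0" using l e2 by (simp add: B_def)
  have "norm (\<phi> w - \<phi> 0) < R / 2"
    if phi: "disc_into D \<phi>" and small: "\<delta> (\<phi> 0) \<le> e2" and w: "cmod w < 1 - B * \<delta> (\<phi> 0) powr \<alpha>" for \<phi> w
  proof -
    define s where "s = \<delta> (\<phi> 0)"
    have s: "s > 0" using \<delta>_pos[OF disc_into_mem[OF phi]] by (simp add: s_def)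
    have "\<exists>n. e2 / s < C1 ^ n" using C1 by (intro real_arch_pow) auto
    then obtain n where n: "e2 / s < C1 ^ n" "\<And>m. m < n \<Longrightarrow> \<not> e2 / s < C1 ^ m"
      using exists_least_iff[of "\<lambda>n. e2 / s < C1 ^ n"] by blast
    have "n \<noteq> 0" using n(1) small s by (auto simp: s_def field_simps intro!: Nat.gr0I)
    then obtain k where k: "n = Suc k" using not0_implies_Suc by blast
    have k1: "C1 ^ k * s \<le> e2" using n(2)[of k] s by (simp add: k field_simps)
    have k2: "e2 < C1 ^ Suc k * s" using n(1) s by (simp add: k field_simps)
    have "l ^ Suc k = exp (real (Suc k) * ln l)" 
      using l exp_of_nat_mult[of "Suc k" "ln l"] by (simp del: of_nat_Suc)
    also have "real (Suc k) * ln l = - (real (Suc k) * ln C1) * \<alpha>" using C1 by (simp add: \<alpha>_def)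
    also have "real (Suc k) * ln C1 = ln (C1 ^ Suc k)" using C1 by (simp only: ln_realpow)
    also have "exp (- ln (C1 ^ Suc k) * \<alpha>) = (1 / C1 ^ Suc k) powr \<alpha>"
      using C1 by (simp add: powr_def ln_div mult.commute)
    also have "\<dots> \<le> (s / e2) powr \<alpha>"
      using k2 C1 s e2 al by (intro powr_mono2) (auto simp: field_simps)
    also have "\<dots> = (1 / e2) powr \<alpha> * s powr \<alpha>"
      using s e2 by (subst powr_mult[symmetric]) auto
    finally have "l ^ k \<le> B * s powr \<alpha>" using l by (simp add: B_def field_simps)
    then have w': "cmod w \<le> 1 - (1 - \<beta>) ^ k" using w by (simp add: s_def l_def)
    have "norm (\<phi> w - \<phi> 0) \<le> C2 * sqrt (C1 ^ k * \<delta> (\<phi> 0))"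
      using disc_iterated[OF b C1 C2 step phi _ w'] k1 e2 unfolding s_def by fastforce
    also have "\<dots> \<le> C2 * sqrt e2" using k1 C2 by (simp add: s_def)
    finally show ?thesis using e2R by simp
  qed
  then show ?thesis using al B e2(1) by blast
qed

end

text \<open>The profile solves \<open>h' = - (1 - B w\<^sup>\<alpha>) / (2 w)\<close>: the factor \<open>1 - B w\<^sup>\<alpha>\<close> pays for the radius
  lost in the localization.\<close>

definition bump_profile :: "real \<Rightarrow> real \<Rightarrow> real \<Rightarrow> real" where
  "bump_profile \<alpha> B w = B / (2 * \<alpha>) * w powr \<alpha> - ln w / 2"

lemma bump_profile_deriv:
  assumes "\<alpha> > 0" "w > 0"
  shows "(bump_profile \<alpha> B has_real_derivative - (1 - B * w powr \<alpha>) / (2 * w)) (at w)"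
proof -
  have "(bump_profile \<alpha> B has_real_derivative B / (2 * \<alpha>) * (\<alpha> * w powr (\<alpha> - 1)) - 1 / w / 2) (at w)"
    unfolding bump_profile_def using assms by (auto intro!: derivative_eq_intros)
  also have "B / (2 * \<alpha>) * (\<alpha> * w powr (\<alpha> - 1)) - 1 / w / 2 = - (1 - B * w powr \<alpha>) / (2 * w)"
    using assms by (simp add: powr_diff field_simps)
  finally show ?thesis .
qed

text \<open>Subtracting the value at \<open>w0\<close> makes the truncation at
  \<open>cmod (P z) = w0\<close> continuous. The condition on the ball confines the function to
  where \<open>P\<close> is controlled; for small \<open>w0\<close> it causes no jump, by
  \<open>boundary_bump_far\<close>.\<close>

definition boundary_bump ::
    "(complex^'n \<Rightarrow> complex) \<Rightarrow> complex^'n \<Rightarrow> real \<Rightarrow> real \<Rightarrow> real \<Rightarrow> real \<Rightarrow> complex^'n \<Rightarrow> real" where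
  "boundary_bump P \<zeta> r \<alpha> B w0 z =
     (if norm (z - \<zeta>) < r \<and> cmod (P z) < w0
      then bump_profile \<alpha> B (cmod (P z)) - bump_profile \<alpha> B w0 else 0)"

section \<open>Contraction of the truncated logarithm\<close>

context peak_domain
begin

lemma disc_near:
  assumes "disc_into D \<phi>" "e > 0"
  shows "\<exists>d>0. \<forall>w. cmod w < d \<and> cmod w < 1 \<longrightarrow> norm (\<phi> w - \<phi> 0) < e"
proof -
  obtain N where N: "N > 0" "\<And>\<phi> z. disc_into D \<phi> \<Longrightarrow> cmod z < 1 \<Longrightarrow> norm (\<phi> z - \<phi> 0) \<le> N * cmod z"
    using disc_lipschitz by blast
  have "norm (\<phi> w - \<phi> 0) < e" if "cmod w < e / N" "cmod w < 1" for w
    using N(2)[OF assms(1) that(2)] that(1) N(1) by (simp add: field_simps)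
  then show ?thesis using N(1) assms(2) by (intro exI[of _ "e / N"]) auto
qed

definition is_peak :: "(complex^'n \<Rightarrow> complex) \<Rightarrow> complex^'n \<Rightarrow> bool" where
  "is_peak P \<zeta> \<longleftrightarrow> holo_fun P \<and> (\<forall>z\<in>D. norm (z - \<zeta>) < R \<longrightarrow>
      Re (P z) \<le> - c * (norm (z - \<zeta>))\<^sup>2 \<and> Re (P z) \<le> - c * \<delta> z \<and> cmod (P z) \<le> C * norm (z - \<zeta>))"

lemma is_peak_bounds:
  assumes "is_peak P \<zeta>" "z \<in> D" "norm (z - \<zeta>) < R"
  shows "c * (norm (z - \<zeta>))\<^sup>2 \<le> cmod (P z)" "c * \<delta> z \<le> cmod (P z)" "cmod (P z) > 0"
    "Re (P z) < 0" "cmod (P z) \<le> C * norm (z - \<zeta>)"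
proof -
  have a: "Re (P z) \<le> - c * (norm (z - \<zeta>))\<^sup>2" "Re (P z) \<le> - c * \<delta> z" "cmod (P z) \<le> C * norm (z - \<zeta>)"
    using assms unfolding is_peak_def by auto
  have b: "\<bar>Re (P z)\<bar> \<le> cmod (P z)" by (rule abs_Re_le_cmod)
  have "c * \<delta> z > 0" using \<delta>_pos[OF assms(2)] c_pos by simp
  then show "c * (norm (z - \<zeta>))\<^sup>2 \<le> cmod (P z)" "c * \<delta> z \<le> cmod (P z)" "cmod (P z) > 0"
    "Re (P z) < 0" "cmod (P z) \<le> C * norm (z - \<zeta>)"
    using a b by auto
qed

text \<open>From distance \<open>R / 4\<close> on, the quadratic peak inequality forces
  \<open>cmod (P z)\<close> to be at least \<open>c * R\<^sup>2 / 16\<close>. The gap between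
  \<open>R / 4\<close> and \<open>R / 2\<close> lets a disc whose centre is at distance at least
  \<open>R / 2\<close> see only zeros nearby.\<close>

lemma boundary_bump_far:
  assumes P: "is_peak P \<zeta>" and w0: "w0 < c * R\<^sup>2 / 16" and z: "z \<in> D" "norm (z - \<zeta>) \<ge> R / 4"
  shows "boundary_bump P \<zeta> (R / 2) \<alpha> B w0 z = 0"
proof (cases "norm (z - \<zeta>) < R / 2")
  case True
  have "c * (R / 4)\<^sup>2 \<le> c * (norm (z - \<zeta>))\<^sup>2"
    using z(2) R_pos c_pos by (intro mult_left_mono power_mono) auto
  then have "w0 < cmod (P z)"
    using is_peak_bounds(1)[OF P z(1)] True R_pos w0 by (simp add: power_divide)
  then show ?thesis by (simp add: boundary_bump_def)
qed (simp add: boundary_bump_def)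

lemma boundary_bump_far_disc:
  assumes P: "is_peak P \<zeta>" and w0: "w0 < c * R\<^sup>2 / 16" and phi: "disc_into D \<phi>"
    and z: "norm (\<phi> 0 - \<zeta>) \<ge> R / 2"
  shows "\<exists>d>0. \<forall>w. cmod w < d \<and> cmod w < 1 \<longrightarrow> boundary_bump P \<zeta> (R / 2) \<alpha> B w0 (\<phi> w) = 0"
proof -
  obtain d where d: "d > 0" "\<And>w. cmod w < d \<Longrightarrow> cmod w < 1 \<Longrightarrow> norm (\<phi> w - \<phi> 0) < R / 4"
    using disc_near[OF phi, where e = "R / 4"] R_pos by auto
  have "norm (\<phi> w - \<zeta>) \<ge> R / 4" if "cmod w < d" "cmod w < 1" for w
    using norm_triangle_ineq4[of "\<phi> w - \<zeta>" "\<phi> w - \<phi> 0"] d(2)[OF that] z by simp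
  then show ?thesis using boundary_bump_far[OF P w0] disc_into_mem[OF phi] d(1) by blast
qed

text \<open>Let \<open>y0\<close> be \<open>|P|\<close> at the centre. On the radius
  \<open>t = 1 - B * y0 powr \<alpha>\<close> the disc stays where \<open>P\<close> is controlled,
  so by the Harnack estimate \<open>|P|\<close> changes by at most about
  \<open>2 * |w| * y0 / t\<close>. The profile has slope \<open>- t / (2 * y0)\<close> at
  \<open>y0\<close>, and the product is \<open>|w|\<close>. The hypothesis \<open>loc\<close> speaks
  of \<open>c * \<delta>\<close> because this is the quantity that \<open>|P|\<close>
  dominates.\<close>

lemma boundary_bump_contracting:
  assumes P: "is_peak P \<zeta>" and al: "\<alpha> > 0" and B: "B > 0"
    and w0: "0 < w0" "w0 < c * R\<^sup>2 / 16" "B * w0 powr \<alpha> \<le> 1 / 2"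
    and loc: "\<And>\<phi> w. disc_into D \<phi> \<Longrightarrow> \<delta> (\<phi> 0) \<le> w0 / c \<Longrightarrow>
       cmod w < 1 - B * (c * \<delta> (\<phi> 0)) powr \<alpha> \<Longrightarrow> norm (\<phi> w - \<phi> 0) < R / 2"
  shows "infinitesimally_contracting D (boundary_bump P \<zeta> (R / 2) \<alpha> B w0)"
  unfolding infinitesimally_contracting_def
proof (intro allI impI)
  fix \<phi> and \<epsilon>' :: real assume phi: "disc_into D \<phi>" and eps': "\<epsilon>' > 0"
  let ?u = "boundary_bump P \<zeta> (R / 2) \<alpha> B w0" and ?h = "bump_profile \<alpha> B"
  define \<epsilon> where "\<epsilon> = min 1 \<epsilon>'"
  have eps: "0 < \<epsilon>" "\<epsilon> \<le> 1" "\<epsilon> \<le> \<epsilon>'" using eps' by (auto simp: \<epsilon>_def)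
  have inD: "\<phi> w \<in> D" if "cmod w < 1" for w by (rule disc_into_mem[OF phi that])
  show "\<exists>d>0. \<forall>w. cmod w < d \<and> cmod w < 1 \<longrightarrow> \<bar>?u (\<phi> w) - ?u (\<phi> 0)\<bar> \<le> (1 + \<epsilon>') * cmod w"
  proof (cases "norm (\<phi> 0 - \<zeta>) \<ge> R / 2")
    case True
    obtain d where d: "d > 0" "\<And>w. cmod w < d \<Longrightarrow> cmod w < 1 \<Longrightarrow> ?u (\<phi> w) = 0"
      using boundary_bump_far_disc[OF P w0(2) phi True] by metis
    have "\<bar>?u (\<phi> w) - ?u (\<phi> 0)\<bar> \<le> (1 + \<epsilon>') * cmod w" if "cmod w < d" "cmod w < 1" for w
      using d(2)[OF that] d(2)[of 0] d(1) eps' by simp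
    then show ?thesis using d(1) by blast
  next
    case False
    then have n0: "norm (\<phi> 0 - \<zeta>) < R / 2" by simp
    define q where "q v = P (\<phi> v)" for v
    have hq1: "q holomorphic_on ball 0 1"
      unfolding q_def
    proof (rule holo_fun_compose)
      show "holo_fun P" using P by (simp add: is_peak_def)
      show "(\<lambda>z. \<phi> z $ j) holomorphic_on ball 0 1" for j using phi by (simp add: disc_into_def)
    qed simp
    obtain d1 where d1: "d1 > 0" "\<And>w. cmod w < d1 \<Longrightarrow> cmod w < 1 \<Longrightarrow> norm (\<phi> w - \<phi> 0) < R / 2 - norm (\<phi> 0 - \<zeta>)"
      using disc_near[OF phi, of "R / 2 - norm (\<phi> 0 - \<zeta>)"] n0 by auto
    have near: "norm (\<phi> w - \<zeta>) < R / 2" if "cmod w < d1" "cmod w < 1" for w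
      using norm_triangle_ineq[of "\<phi> w - \<phi> 0" "\<phi> 0 - \<zeta>"] d1(2)[OF that] by simp
    define y0 where "y0 = cmod (q 0)"
    \<comment> \<open>Strictly above \<open>w0\<close> the bump vanishes on a neighbourhood, by
      continuity; the borderline \<open>y0 = w0\<close> is left to the main estimate.\<close>
    show ?thesis
    proof (cases "y0 > w0")
      case True
      have iso: "isCont q 0"
        using holomorphic_on_imp_continuous_on[OF hq1] by (simp add: continuous_on_eq_continuous_at)
      obtain d2 where d2: "d2 > 0" "\<And>w. cmod w < d2 \<Longrightarrow> cmod (q w - q 0) < y0 - w0"
        using LIM_D[OF iso[unfolded isCont_def], of "y0 - w0"] True by (metis diff_gt_0_iff_gt diff_zero norm_zero right_minus_eq)
      have far: "?u (\<phi> w) = 0" if "cmod w < d2" for w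
      proof -
        have "cmod (q w) > w0"
          using d2(2)[OF that] norm_triangle_ineq3[of "q w" "q 0"] by (simp add: y0_def)
        then show ?thesis by (simp add: boundary_bump_def q_def)
      qed
      have "\<bar>?u (\<phi> w) - ?u (\<phi> 0)\<bar> \<le> (1 + \<epsilon>') * cmod w" if "cmod w < d2" "cmod w < 1" for w
        using far[OF that(1)] far[of 0] d2(1) eps' by simp
      then show ?thesis using d2(1) by blast
    next
      case False
      then have y0w: "y0 \<le> w0" by simp
      have n0R: "norm (\<phi> 0 - \<zeta>) < R" using n0 R_pos by simp
      have y0: "y0 > 0" "c * \<delta> (\<phi> 0) \<le> y0"
        using is_peak_bounds(2,3)[OF P inD n0R] by (auto simp: y0_def q_def)
      define t where "t = 1 - B * y0 powr \<alpha>"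
      have "y0 powr \<alpha> \<le> w0 powr \<alpha>" using y0 y0w al by (intro powr_mono2) auto
      then have "B * y0 powr \<alpha> \<le> B * w0 powr \<alpha>" using B by simp
      moreover have "B * y0 powr \<alpha> > 0" using B y0 by simp
      ultimately have t: "1 / 2 \<le> t" "t < 1" unfolding t_def using w0(3) by linarith+
      have nearR: "norm (\<phi> w - \<zeta>) < R" if "cmod w < t" for w
      proof -
        have "(c * \<delta> (\<phi> 0)) powr \<alpha> \<le> y0 powr \<alpha>"
          using y0 al c_pos infdist_nonneg[of "\<phi> 0" "frontier D"] by (intro powr_mono2) auto
        then have "B * (c * \<delta> (\<phi> 0)) powr \<alpha> \<le> B * y0 powr \<alpha>" using B by simp
        then have "norm (\<phi> w - \<phi> 0) < R / 2"
          using that y0 y0w c_pos by (intro loc[OF phi]) (auto simp: t_def field_simps)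
        then show ?thesis using norm_triangle_ineq[of "\<phi> w - \<phi> 0" "\<phi> 0 - \<zeta>"] n0 by simp
      qed
      have hq: "q holomorphic_on ball 0 t"
        by (rule holomorphic_on_subset[OF hq1]) (use t in auto)
      have neg: "Re (q w) < 0" if "cmod w < t" for w
        unfolding q_def using is_peak_bounds(4)[OF P inD nearR[OF that]] that t by simp
      have D: "(?h has_derivative (*) (- (1 - B * y0 powr \<alpha>) / (2 * y0))) (at y0)"
        using bump_profile_deriv[OF al y0(1), of B] by (simp add: has_field_derivative_def)
      \<comment> \<open>The slope \<open>t / (2 * y0)\<close> may be exceeded by the relative amount
        \<open>\<epsilon> / 4\<close>, which gives the tolerance
        \<open>t * \<epsilon> / (8 * y0)\<close>.\<close>
      have "t * \<epsilon> / (8 * y0) > 0" using t y0 eps by simp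
      then obtain d3 where "d3 > 0" "\<forall>y. norm (y - y0) < d3 \<longrightarrow>
          norm (?h y - ?h y0 - (- (1 - B * y0 powr \<alpha>) / (2 * y0)) * (y - y0)) \<le> (t * \<epsilon> / (8 * y0)) * norm (y - y0)"
        using D unfolding has_derivative_at_alt by blast
      then have d3: "d3 > 0" "\<And>y. \<bar>y - y0\<bar> < d3 \<Longrightarrow>
          \<bar>?h y - ?h y0 - (- t / (2 * y0)) * (y - y0)\<bar> \<le> (t * \<epsilon> / (8 * y0)) * \<bar>y - y0\<bar>"
        by (simp_all add: t_def)
      have d3': "\<bar>?h y - ?h y0\<bar> \<le> t / (2 * y0) * (1 + \<epsilon> / 4) * \<bar>y - y0\<bar>" if "\<bar>y - y0\<bar> < d3" for y
      proof -
        have "\<bar>?h y - ?h y0\<bar> \<le> \<bar>(- t / (2 * y0)) * (y - y0)\<bar> + (t * \<epsilon> / (8 * y0)) * \<bar>y - y0\<bar>"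
          using d3(2)[OF that] by linarith
        also have "\<bar>(- t / (2 * y0)) * (y - y0)\<bar> = t / (2 * y0) * \<bar>y - y0\<bar>"
          using t y0 by (simp add: abs_mult)
        finally show ?thesis by (simp add: algebra_simps)
      qed
      \<comment> \<open>The three bounds keep the disc inside the ball, make
        \<open>t / (t - cmod w)\<close> at most \<open>1 + \<epsilon> / 4\<close>, and keep
        \<open>y\<close> within \<open>d3\<close> of \<open>y0\<close>. Two factors
        \<open>1 + \<epsilon> / 4\<close> stay below \<open>1 + \<epsilon>\<close> since
        \<open>\<epsilon> \<le> 1\<close>.\<close>
      define d where "d = Min {d1, t * \<epsilon> / 8, d3 * t / (4 * y0)}"
      have d: "d > 0" "d \<le> d1" "d \<le> t * \<epsilon> / 8" "d \<le> d3 * t / (4 * y0)"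
        using d1 d3 t y0 eps by (auto simp: d_def)
      have "\<bar>?u (\<phi> w) - ?u (\<phi> 0)\<bar> \<le> (1 + \<epsilon>') * cmod w" if w: "cmod w < d" "cmod w < 1" for w
      proof -
        have "t * \<epsilon> \<le> t * 1" using t eps by (intro mult_left_mono) auto
        then have wt: "cmod w < t" "cmod w \<le> t / 2" using w(1) d(3) t by linarith+
        \<comment> \<open>Truncation is the map \<open>min _ w0\<close>, which is 1-Lipschitz and
          fixes \<open>y0\<close>; this treats both branches of the bump at once.\<close>
        define y where "y = min (cmod (q w)) w0"
        have u: "?u (\<phi> w) = ?h y - ?h w0" "?u (\<phi> 0) = ?h y0 - ?h w0"
          using near[of w] w d n0 y0w by (auto simp: boundary_bump_def y_def y0_def q_def min_def)
        have "\<bar>y - y0\<bar> \<le> \<bar>cmod (q w) - y0\<bar>" using y0w by (auto simp: y_def min_def)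
        also have "\<dots> \<le> cmod (q w - q 0)" unfolding y0_def by (rule norm_triangle_ineq3)
        finally have yy: "\<bar>y - y0\<bar> \<le> cmod (q w - q 0)" .
        have "cmod (q w - q 0) * (t - cmod w) \<le> 2 * cmod w * \<bar>Re (q 0)\<bar>"
          by (rule half_plane_harnack[OF hq neg wt(1)])
        also have "\<dots> \<le> 2 * cmod w * y0"
          unfolding y0_def by (intro mult_left_mono abs_Re_le_cmod) auto
        finally have "cmod (q w - q 0) \<le> 2 * cmod w * y0 / (t - cmod w)"
          using wt by (simp add: pos_le_divide_eq)
        then have H: "\<bar>y - y0\<bar> \<le> 2 * cmod w * y0 / (t - cmod w)" using yy by linarith
        have H': "2 * cmod w * y0 / (t - cmod w) \<le> 2 * cmod w * y0 / (t / 2)"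
          using wt t y0 by (intro divide_left_mono mult_pos_pos mult_nonneg_nonneg) auto
        have "cmod w * (4 * y0) < d * (4 * y0)" using w y0 by (intro mult_strict_right_mono) auto
        also have "d * (4 * y0) \<le> d3 * t" using d(4) y0 by (simp add: le_divide_eq)
        finally have "2 * cmod w * y0 / (t / 2) < d3" using t by (simp add: divide_less_eq mult_ac)
        then have "\<bar>?h y - ?h y0\<bar> \<le> t / (2 * y0) * (1 + \<epsilon> / 4) * \<bar>y - y0\<bar>"
          using H H' by (intro d3') linarith
        also have "\<dots> \<le> t / (2 * y0) * (1 + \<epsilon> / 4) * (2 * cmod w * y0 / (t - cmod w))"
          using t y0 eps by (intro mult_left_mono H) auto
        also have "\<dots> = (1 + \<epsilon> / 4) * (t / (t - cmod w)) * cmod w"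
          using y0 wt by (simp add: field_simps)
        also have "\<dots> \<le> (1 + \<epsilon> / 4) * (1 + \<epsilon> / 4) * cmod w"
        proof (intro mult_right_mono mult_left_mono)
          have "t / (t - cmod w) \<le> t / (t - t * \<epsilon> / 8)"
            using w d t eps wt by (intro divide_left_mono mult_pos_pos) auto
          also have "\<dots> = 1 / (1 - \<epsilon> / 8)" using t eps by (simp add: field_simps)
          also have "\<dots> \<le> 1 + \<epsilon> / 4"
          proof -
            have "\<epsilon> * \<epsilon> \<le> \<epsilon> * 1" using eps by (intro mult_left_mono) auto
            then show ?thesis using eps by (simp add: field_simps)
          qed
          finally show "t / (t - cmod w) \<le> 1 + \<epsilon> / 4" .
        qed (use eps in auto)
        also have "\<dots> \<le> (1 + \<epsilon>') * cmod w"
        proof (rule mult_right_mono)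
          have "\<epsilon> * \<epsilon> \<le> \<epsilon>" using mult_left_mono[of \<epsilon> 1 \<epsilon>] eps by simp
          moreover have "(1 + \<epsilon> / 4) * (1 + \<epsilon> / 4) = 1 + \<epsilon> / 2 + (\<epsilon> * \<epsilon>) / 16" by (simp add: field_simps)
          ultimately show "(1 + \<epsilon> / 4) * (1 + \<epsilon> / 4) \<le> 1 + \<epsilon>'" using eps by linarith
        qed simp
        finally show ?thesis using u by simp
      qed
      then show ?thesis using d(1) by blast
    qed
  qed
qed

text \<open>Every point is at distance at least \<open>R / 2\<close> from \<open>\<zeta>\<close> or
  from \<open>\<xi>\<close>, so near the centre of any disc one of the two bumps vanishes
  identically and the difference inherits the estimate of the other. Without the separation, a
  difference of two contracting functions would in general be only 2-Lipschitz.\<close>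

lemma boundary_bump_difference_contracting:
  assumes P: "is_peak P \<zeta>" and Q: "is_peak Q \<xi>" and w0: "w0 < c * R\<^sup>2 / 16"
    and u: "infinitesimally_contracting D (boundary_bump P \<zeta> (R / 2) \<alpha> B w0)"
    and v: "infinitesimally_contracting D (boundary_bump Q \<xi> (R / 2) \<alpha> B w0)"
    and far: "norm (\<zeta> - \<xi>) \<ge> R"
  shows "infinitesimally_contracting D
    (\<lambda>z. boundary_bump P \<zeta> (R / 2) \<alpha> B w0 z - boundary_bump Q \<xi> (R / 2) \<alpha> B w0 z)"
  unfolding infinitesimally_contracting_def
proof (intro allI impI)
  fix \<phi> and \<epsilon> :: real assume phi: "disc_into D \<phi>" and eps: "\<epsilon> > 0"
  let ?u = "boundary_bump P \<zeta> (R / 2) \<alpha> B w0" and ?v = "boundary_bump Q \<xi> (R / 2) \<alpha> B w0"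
  obtain d1 where d1: "d1 > 0" "\<And>w. cmod w < d1 \<Longrightarrow> cmod w < 1 \<Longrightarrow> \<bar>?u (\<phi> w) - ?u (\<phi> 0)\<bar> \<le> (1 + \<epsilon>) * cmod w"
    using u phi eps unfolding infinitesimally_contracting_def by meson
  obtain d2 where d2: "d2 > 0" "\<And>w. cmod w < d2 \<Longrightarrow> cmod w < 1 \<Longrightarrow> \<bar>?v (\<phi> w) - ?v (\<phi> 0)\<bar> \<le> (1 + \<epsilon>) * cmod w"
    using v phi eps unfolding infinitesimally_contracting_def by meson
  have "norm (\<phi> 0 - \<zeta>) \<ge> R / 2 \<or> norm (\<phi> 0 - \<xi>) \<ge> R / 2"
    using far norm_triangle_ineq4[of "\<phi> 0 - \<xi>" "\<phi> 0 - \<zeta>"] by auto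
  then obtain d3 where d3: "d3 > 0" "(\<forall>w. cmod w < d3 \<and> cmod w < 1 \<longrightarrow> ?u (\<phi> w) = 0) \<or>
      (\<forall>w. cmod w < d3 \<and> cmod w < 1 \<longrightarrow> ?v (\<phi> w) = 0)"
    using boundary_bump_far_disc[OF P w0 phi, of \<alpha> B] boundary_bump_far_disc[OF Q w0 phi, of \<alpha> B] by blast
  have "\<bar>(?u (\<phi> w) - ?v (\<phi> w)) - (?u (\<phi> 0) - ?v (\<phi> 0))\<bar> \<le> (1 + \<epsilon>) * cmod w"
    if w: "cmod w < Min {d1, d2, d3}" "cmod w < 1" for w
  proof -
    have w': "cmod w < d1" "cmod w < d2" "cmod w < d3" using w by auto
    from d3(2) show ?thesis
    proof
      assume *: "\<forall>w. cmod w < d3 \<and> cmod w < 1 \<longrightarrow> ?u (\<phi> w) = 0"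
      then have "?u (\<phi> w) = 0" "?u (\<phi> 0) = 0" using w' w d3(1) by auto
      then show ?thesis using d2(2)[OF w'(2) w(2)] by linarith
    next
      assume *: "\<forall>w. cmod w < d3 \<and> cmod w < 1 \<longrightarrow> ?v (\<phi> w) = 0"
      then have "?v (\<phi> w) = 0" "?v (\<phi> 0) = 0" using w' w d3(1) by auto
      then show ?thesis using d1(2)[OF w'(1) w(2)] by linarith
    qed
  qed
  moreover have "Min {d1, d2, d3} > 0" using d1 d2 d3 by simp
  ultimately show "\<exists>d>0. \<forall>w. cmod w < d \<and> cmod w < 1 \<longrightarrow>
      \<bar>(?u (\<phi> w) - ?v (\<phi> w)) - (?u (\<phi> 0) - ?v (\<phi> 0))\<bar> \<le> (1 + \<epsilon>) * cmod w" by blast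
qed

text \<open>If \<open>P\<close> peaks at the foot point of \<open>x\<close>, then \<open>|P|\<close>
  at \<open>x\<close> is at most \<open>C * \<delta> x\<close>, so the bump is at least
  \<open>- ln (\<delta> x) / 2\<close> up to a constant; the term with
  \<open>w powr \<alpha>\<close> in the profile only helps. With bumps at the foot points of
  \<open>x\<close> and \<open>y\<close> the two logarithms add up in
  \<open>u x - u y\<close>.\<close>

theorem contracting_function_separating:
  "\<exists>e K. e > 0 \<and> (\<forall>x\<in>D. \<forall>y\<in>D. \<delta> x < e \<longrightarrow> \<delta> y < e \<longrightarrow> norm (x - y) \<ge> 2 * R \<longrightarrow>
     (\<exists>u. infinitesimally_contracting D u \<and> u x - u y \<ge> - ln (\<delta> x) / 2 - ln (\<delta> y) / 2 - K))"
proof -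
  obtain \<alpha> B' e2 where al: "\<alpha> > 0" and B': "B' > 0" and e2: "e2 > 0"
    and loc: "\<And>\<phi> w. disc_into D \<phi> \<Longrightarrow> \<delta> (\<phi> 0) \<le> e2 \<Longrightarrow>
       cmod w < 1 - B' * \<delta> (\<phi> 0) powr \<alpha> \<Longrightarrow> norm (\<phi> w - \<phi> 0) < R / 2"
    using disc_localization by blast
  define B where "B = B' / c powr \<alpha>"
  have B: "B > 0" using B' c_pos by (simp add: B_def)
  have BB: "B * (c * s) powr \<alpha> = B' * s powr \<alpha>" if "s \<ge> 0" for s
    using that c_pos by (simp add: B_def powr_mult)
  \<comment> \<open>In order: localization is available, the support lies well inside the ball, and
    \<open>B * w0 powr \<alpha> \<le> 1 / 2\<close>.\<close>
  define w0 where "w0 = Min {c * e2, c * R\<^sup>2 / 32, (1 / (2 * B)) powr (1 / \<alpha>)}"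
  have w0: "0 < w0" "w0 \<le> c * e2" "w0 \<le> c * R\<^sup>2 / 32" "w0 \<le> (1 / (2 * B)) powr (1 / \<alpha>)"
    using c_pos e2 R_pos B by (auto simp: w0_def)
  have "c * R\<^sup>2 > 0" using c_pos R_pos by simp
  then have w0R: "w0 < c * R\<^sup>2 / 16" using w0 by linarith
  have "w0 powr \<alpha> \<le> ((1 / (2 * B)) powr (1 / \<alpha>)) powr \<alpha>"
    using w0 al by (intro powr_mono2) auto
  also have "\<dots> = 1 / (2 * B)" using al B by (simp add: powr_powr)
  finally have w0B: "B * w0 powr \<alpha> \<le> 1 / 2" using B by (simp add: field_simps)
  let ?h = "bump_profile \<alpha> B"
  have contr: "infinitesimally_contracting D (boundary_bump P \<zeta> (R / 2) \<alpha> B w0)" if "is_peak P \<zeta>" for P \<zeta>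
  proof (rule boundary_bump_contracting[OF that al B w0(1) w0R w0B])
    fix \<phi> w assume *: "disc_into D \<phi>" "\<delta> (\<phi> 0) \<le> w0 / c" "cmod w < 1 - B * (c * \<delta> (\<phi> 0)) powr \<alpha>"
    have "w0 / c \<le> e2" using w0(2) c_pos by (simp add: divide_le_eq mult.commute)
    then have "\<delta> (\<phi> 0) \<le> e2" using *(2) by linarith
    then show "norm (\<phi> w - \<phi> 0) < R / 2"
      using loc[OF *(1)] *(3) BB[of "\<delta> (\<phi> 0)"] infdist_nonneg[of "\<phi> 0" "frontier D"] by simp
  qed
  define K where "K = ln C + 2 * ?h w0"
  define e where "e = min (R / 2) (w0 / C)"
  have e: "e > 0" "e \<le> R / 2" "e \<le> w0 / C"
    using R_pos w0 C_pos min.cobounded1[of "R / 2" "w0 / C"] min.cobounded2[of "R / 2" "w0 / C"]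
    by (auto simp add: e_def simp del: min.cobounded1 min.cobounded2)
  have low: "boundary_bump P \<zeta> (R / 2) \<alpha> B w0 x \<ge> - ln (\<delta> x) / 2 - K / 2"
    if "is_peak P \<zeta>" "x \<in> D" "\<delta> x < e" "\<delta> x = norm (x - \<zeta>)" for P \<zeta> x
  proof -
    have xR: "norm (x - \<zeta>) < R" "norm (x - \<zeta>) < R / 2" using that e R_pos by auto
    have y: "cmod (P x) > 0" "cmod (P x) \<le> C * \<delta> x"
      using is_peak_bounds(3,5)[OF that(1,2) xR(1)] that(4) by auto
    have "C * \<delta> x < C * (w0 / C)" using that(3) e C_pos by (intro mult_strict_left_mono) auto
    then have "cmod (P x) < w0" using y C_pos by simp
    then have "boundary_bump P \<zeta> (R / 2) \<alpha> B w0 x = ?h (cmod (P x)) - ?h w0"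
      using xR by (simp add: boundary_bump_def)
    moreover have "?h (cmod (P x)) \<ge> - ln (cmod (P x)) / 2"
      using B al by (simp add: bump_profile_def)
    moreover have "ln (cmod (P x)) \<le> ln (C * \<delta> x)"
      using y by (intro ln_mono) auto
    moreover have "ln (C * \<delta> x) = ln C + ln (\<delta> x)"
      using \<delta>_pos[OF that(2)] C_pos by (simp add: ln_mult)
    moreover have "- b / 2 - (a + 2 * h') / 2 \<le> u"
      if "u = h - h'" "- p / 2 \<le> h" "p \<le> s" "s = a + b" for a b p h h' u s :: real
      using that by (simp add: field_simps)
    ultimately show ?thesis unfolding K_def by blast
  qed
  have "\<exists>u. infinitesimally_contracting D u \<and> u x - u y \<ge> - ln (\<delta> x) / 2 - ln (\<delta> y) / 2 - K"
    if x: "x \<in> D" "\<delta> x < e" and y: "y \<in> D" "\<delta> y < e" and xy: "norm (x - y) \<ge> 2 * R" for x y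
  proof -
    obtain \<zeta> where z: "\<zeta> \<in> frontier D" "\<delta> x = norm (x - \<zeta>)" by (rule \<delta>_attained)
    obtain \<xi> where xi: "\<xi> \<in> frontier D" "\<delta> y = norm (y - \<xi>)" by (rule \<delta>_attained)
    obtain P where P: "is_peak P \<zeta>" using peak[OF z(1)] unfolding is_peak_def by blast
    obtain Q where Q: "is_peak Q \<xi>" using peak[OF xi(1)] unfolding is_peak_def by blast
    have t1: "norm (x - y) \<le> norm (x - \<zeta>) + norm (y - \<zeta>)"
      using norm_triangle_ineq4[of "x - \<zeta>" "y - \<zeta>"] by simp
    have t2: "norm (x - y) \<le> norm (x - \<xi>) + norm (y - \<xi>)"
      using norm_triangle_ineq4[of "x - \<xi>" "y - \<xi>"] by simp
    have t3: "norm (y - \<zeta>) \<le> norm (y - \<xi>) + norm (\<zeta> - \<xi>)"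
      using norm_triangle_ineq4[of "y - \<xi>" "\<zeta> - \<xi>"] by simp
    have far: "norm (\<zeta> - \<xi>) \<ge> R" "norm (y - \<zeta>) \<ge> R / 4" "norm (x - \<xi>) \<ge> R / 4"
      using t1 t2 t3 xy x y z xi e R_pos by linarith+
    let ?u = "boundary_bump P \<zeta> (R / 2) \<alpha> B w0" and ?v = "boundary_bump Q \<xi> (R / 2) \<alpha> B w0"
    have "infinitesimally_contracting D (\<lambda>z. ?u z - ?v z)"
      by (rule boundary_bump_difference_contracting[OF P Q w0R contr[OF P] contr[OF Q] far(1)])
    moreover have "?u x \<ge> - ln (\<delta> x) / 2 - K / 2" by (rule low[OF P x z(2)])
    moreover have "?v y \<ge> - ln (\<delta> y) / 2 - K / 2" by (rule low[OF Q y xi(2)])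
    moreover have "?u y = 0" "?v x = 0"
      using boundary_bump_far[OF P w0R y(1) far(2)] boundary_bump_far[OF Q w0R x(1) far(3)] by auto
    ultimately show ?thesis by (intro exI[of _ "\<lambda>z. ?u z - ?v z"]) auto
  qed
  then show ?thesis using e(1) by blast
qed

end


section \<open>Strongly pseudoconvex boundaries\<close>

abbreviation mult_i :: "complex^'n \<Rightarrow> complex^'n" where "mult_i v \<equiv> \<i> *s v"

lemma scaleR_of_real_complex: "t *\<^sub>R complex_of_real x = complex_of_real (t * x)"
  by (simp add: scaleR_conv_of_real)

lemma norm_complex_smult: "norm (c *s (v :: complex^'n)) = cmod c * norm v"
  by (simp add: norm_vec_def norm_mult L2_set_right_distrib)

lemma bounded_linear_smult_right: "bounded_linear (\<lambda>v :: complex^'n. c *s v)"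
  by (rule linear_conv_bounded_linear[THEN iffD1], rule linearI) (auto simp: vec_eq_iff algebra_simps)

lemma smult_eq_Re_Im: "c *s (v :: complex^'n) = Re c *\<^sub>R v + Im c *\<^sub>R mult_i v"
  by (simp add: vec_eq_iff complex_eq_iff)

lemma mult_i_mult_i: "mult_i (mult_i v) = - v" for v :: "complex^'n"
  by (simp add: vec_eq_iff)

lemma cart_complex_expansion:
  "(w :: complex^'n) = (\<Sum>j\<in>UNIV. Re (w $ j) *\<^sub>R axis j 1 + Im (w $ j) *\<^sub>R axis j \<i>)"
proof -
  have "(\<Sum>j\<in>UNIV. Re (w $ j) *\<^sub>R axis j 1 + Im (w $ j) *\<^sub>R axis j \<i>) $ k = w $ k" for k
  proof -
    have "(\<Sum>j\<in>UNIV. Re (w $ j) *\<^sub>R axis j 1 + Im (w $ j) *\<^sub>R axis j \<i>) $ k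
        = (\<Sum>j\<in>UNIV. if j = k then w $ k else 0)"
      unfolding sum_component
      by (intro sum.cong refl) (auto simp: axis_def complex_eq_iff)
    then show ?thesis by simp
  qed
  then show ?thesis by (simp add: vec_eq_iff)
qed

text \<open>The sesquilinear form with coefficients \<open>\<partial>\<^sub>j\<partial>\<^sub>k r\<close> (barred in \<open>k\<close>) is the \<open>J\<close>-invariant part of
  the real Hessian, with \<open>J\<close> the multiplication by \<open>\<i>\<close>.\<close>

lemma hermitian_part_expansion:
  fixes B :: "(complex^'n) \<Rightarrow>\<^sub>L (complex^'n) \<Rightarrow>\<^sub>L real" and w :: "complex^'n"
  shows "Re (\<Sum>j\<in>UNIV. \<Sum>k\<in>UNIV. Complex ((B (axis j 1) (axis k 1) + B (axis j \<i>) (axis k \<i>)) / 4)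
        ((B (axis j 1) (axis k \<i>) - B (axis j \<i>) (axis k 1)) / 4) * w $ j * cnj (w $ k))
    = (B w w + B (mult_i w) (mult_i w)) / 4"
proof -
  define e where "e j = (axis j 1 :: complex^'n)" for j
  define e' where "e' j = (axis j \<i> :: complex^'n)" for j
  define a where "a j = Re (w $ j)" for j
  define b where "b j = Im (w $ j)" for j
  have w: "w = (\<Sum>j\<in>UNIV. a j *\<^sub>R e j + b j *\<^sub>R e' j)"
    unfolding a_def b_def e_def e'_def by (rule cart_complex_expansion)
  have "mult_i w = (\<Sum>j\<in>UNIV. mult_i (a j *\<^sub>R e j + b j *\<^sub>R e' j))"
    by (subst w) (rule linear_sum[OF bounded_linear.linear[OF bounded_linear_smult_right]])
  also have "\<dots> = (\<Sum>j\<in>UNIV. a j *\<^sub>R e' j - b j *\<^sub>R e j)"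
    by (intro sum.cong refl) (auto simp: e_def e'_def vec_eq_iff axis_def complex_eq_iff)
  finally have Jw: "mult_i w = (\<Sum>j\<in>UNIV. a j *\<^sub>R e' j - b j *\<^sub>R e j)" .
  have bil: "B (\<Sum>j\<in>UNIV. x j) (\<Sum>k\<in>UNIV. y k) = (\<Sum>j\<in>UNIV. \<Sum>k\<in>UNIV. B (x j) (y k))" for x y :: "'n \<Rightarrow> complex^'n"
    by (simp add: blinfun.sum_left blinfun.sum_right) (rule sum.swap)
  have E: "B w w + B (mult_i w) (mult_i w)
      = (\<Sum>j\<in>UNIV. \<Sum>k\<in>UNIV. B (a j *\<^sub>R e j + b j *\<^sub>R e' j) (a k *\<^sub>R e k + b k *\<^sub>R e' k)
          + B (a j *\<^sub>R e' j - b j *\<^sub>R e j) (a k *\<^sub>R e' k - b k *\<^sub>R e k))"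
  proof -
    have "B w w = (\<Sum>j\<in>UNIV. \<Sum>k\<in>UNIV. B (a j *\<^sub>R e j + b j *\<^sub>R e' j) (a k *\<^sub>R e k + b k *\<^sub>R e' k))"
      by (subst (1 2) w) (rule bil)
    moreover have "B (mult_i w) (mult_i w)
        = (\<Sum>j\<in>UNIV. \<Sum>k\<in>UNIV. B (a j *\<^sub>R e' j - b j *\<^sub>R e j) (a k *\<^sub>R e' k - b k *\<^sub>R e k))"
      unfolding Jw by (rule bil)
    ultimately show ?thesis by (simp add: sum.distrib)
  qed
  have "(B w w + B (mult_i w) (mult_i w)) / 4
      = (\<Sum>j\<in>UNIV. \<Sum>k\<in>UNIV. Re (Complex ((B (e j) (e k) + B (e' j) (e' k)) / 4)
        ((B (e j) (e' k) - B (e' j) (e k)) / 4) * w $ j * cnj (w $ k)))"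
    unfolding E sum_divide_distrib
    by (intro sum.cong refl)
       (simp add: a_def b_def blinfun.add_left blinfun.add_right blinfun.diff_left blinfun.diff_right
          blinfun.scaleR_left blinfun.scaleR_right field_simps)
  then show ?thesis by (simp add: e_def e'_def)
qed

text \<open>Half of \<open>l w - \<i> * l (mult_i w)\<close> is the complex-linear part of the real
  form \<open>l\<close>. For \<open>l = r' z\<close> its coefficients are the Wirtinger derivatives
  of \<open>r\<close>, and its kernel is the complex tangent space.\<close>

lemma complex_linear_part_expansion:
  fixes l :: "(complex^'n) \<Rightarrow>\<^sub>L real" and w :: "complex^'n"
  shows "(\<Sum>j\<in>UNIV. (of_real (l (axis j 1)) - \<i> * of_real (l (axis j \<i>))) / 2 * w $ j)
    = (of_real (l w) - \<i> * of_real (l (mult_i w))) / 2"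
proof -
  define e where "e j = (axis j 1 :: complex^'n)" for j
  define e' where "e' j = (axis j \<i> :: complex^'n)" for j
  have w: "w = (\<Sum>j\<in>UNIV. Re (w $ j) *\<^sub>R e j + Im (w $ j) *\<^sub>R e' j)"
    unfolding e_def e'_def by (rule cart_complex_expansion)
  have "mult_i w = (\<Sum>j\<in>UNIV. mult_i (Re (w $ j) *\<^sub>R e j + Im (w $ j) *\<^sub>R e' j))"
    by (subst w) (rule linear_sum[OF bounded_linear.linear[OF bounded_linear_smult_right]])
  also have "\<dots> = (\<Sum>j\<in>UNIV. Re (w $ j) *\<^sub>R e' j - Im (w $ j) *\<^sub>R e j)"
    by (intro sum.cong refl) (auto simp: e_def e'_def vec_eq_iff axis_def complex_eq_iff)
  finally have Jw: "mult_i w = (\<Sum>j\<in>UNIV. Re (w $ j) *\<^sub>R e' j - Im (w $ j) *\<^sub>R e j)" .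
  have "l w = (\<Sum>j\<in>UNIV. Re (w $ j) * l (e j) + Im (w $ j) * l (e' j))"
    by (subst w) (simp add: blinfun.sum_right blinfun.add_right blinfun.scaleR_right)
  moreover have "l (mult_i w) = (\<Sum>j\<in>UNIV. Re (w $ j) * l (e' j) - Im (w $ j) * l (e j))"
    unfolding Jw by (simp add: blinfun.sum_right blinfun.diff_right blinfun.scaleR_right)
  ultimately have "(of_real (l w) - \<i> * of_real (l (mult_i w))) / 2
     = (\<Sum>j\<in>UNIV. (of_real (l (e j)) - \<i> * of_real (l (e' j))) / 2 * w $ j)"
    by (simp only: of_real_sum sum_distrib_left sum_subtractf[symmetric] sum_divide_distrib)
       (intro sum.cong refl, simp add: complex_eq_iff field_simps)
  then show ?thesis by (simp add: e_def e'_def)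
qed

section \<open>The Levi form and the complex tangent space in terms of real derivatives\<close>

locale C2_function =
  fixes U :: "(complex^'n) set" and r :: "complex^'n \<Rightarrow> real"
    and r' :: "complex^'n \<Rightarrow> (complex^'n) \<Rightarrow>\<^sub>L real"
    and r'' :: "complex^'n \<Rightarrow> (complex^'n) \<Rightarrow>\<^sub>L (complex^'n) \<Rightarrow>\<^sub>L real"
  assumes open_U: "open U"
    and r': "\<And>z. z \<in> U \<Longrightarrow> (r has_derivative blinfun_apply (r' z)) (at z)"
    and r'': "\<And>z. z \<in> U \<Longrightarrow> (r' has_derivative blinfun_apply (r'' z)) (at z)"
    and cont_r'': "continuous_on U r''"
begin

lemma dir_deriv_of_real:
  assumes "z \<in> U" shows "dir_deriv (\<lambda>z. complex_of_real (r z)) v z = of_real (r' z v)"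
proof -
  have "((\<lambda>t. z + t *\<^sub>R v) has_derivative (\<lambda>t. t *\<^sub>R v)) (at 0)"
    by (auto intro!: derivative_eq_intros)
  moreover have "(r has_derivative r' z) (at (z + 0 *\<^sub>R v))" using r'[OF assms] by simp
  ultimately have "(r \<circ> (\<lambda>t. z + t *\<^sub>R v) has_derivative r' z \<circ> (\<lambda>t. t *\<^sub>R v)) (at 0)"
    by (rule diff_chain_at)
  then have "((\<lambda>t. complex_of_real (r (z + t *\<^sub>R v))) has_derivative (\<lambda>t. complex_of_real (r' z (t *\<^sub>R v)))) (at 0)"
    by (intro has_derivative_of_real) (simp add: o_def)
  then have "((\<lambda>t. complex_of_real (r (z + t *\<^sub>R v))) has_vector_derivative of_real (r' z v)) (at 0)"
    by (simp add: has_vector_derivative_def blinfun.scaleR_right scaleR_of_real_complex)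
  then show ?thesis unfolding dir_deriv_def by (rule vector_derivative_at)
qed

lemma dzbar_of_real:
  assumes "z \<in> U"
  shows "dzbar k (\<lambda>z. complex_of_real (r z)) z = (of_real (r' z (axis k 1)) + \<i> * of_real (r' z (axis k \<i>))) / 2"
  unfolding dzbar_def by (simp add: dir_deriv_of_real[OF assms])

lemma dz_of_real:
  assumes "z \<in> U"
  shows "dz k (\<lambda>z. complex_of_real (r z)) z = (of_real (r' z (axis k 1)) - \<i> * of_real (r' z (axis k \<i>))) / 2"
  unfolding dz_def by (simp add: dir_deriv_of_real[OF assms])

lemma dir_deriv_dzbar:
  assumes z: "z \<in> U"
  shows "dir_deriv (dzbar k (\<lambda>z. complex_of_real (r z))) v z
    = (of_real (r'' z v (axis k 1)) + \<i> * of_real (r'' z v (axis k \<i>))) / 2"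
proof -
  let ?g = "\<lambda>z. (complex_of_real (r' z (axis k 1)) + \<i> * of_real (r' z (axis k \<i>))) / 2"
  have line: "((\<lambda>t. z + t *\<^sub>R v) has_derivative (\<lambda>t. t *\<^sub>R v)) (at 0)"
    by (auto intro!: derivative_eq_intros)
  have "(r' has_derivative r'' z) (at (z + 0 *\<^sub>R v))" using r''[OF z] by simp
  from diff_chain_at[OF line this]
  have c: "((\<lambda>t. r' (z + t *\<^sub>R v)) has_derivative (\<lambda>t. r'' z (t *\<^sub>R v))) (at 0)" by (simp add: o_def)
  have a: "((\<lambda>t. complex_of_real (r' (z + t *\<^sub>R v) x)) has_derivative (\<lambda>t. complex_of_real (r'' z (t *\<^sub>R v) x))) (at 0)" for x
    by (intro has_derivative_of_real bounded_linear.has_derivative[OF blinfun.bounded_linear_left c])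
  have "((\<lambda>t. ?g (z + t *\<^sub>R v)) has_derivative
      (\<lambda>t. (complex_of_real (r'' z (t *\<^sub>R v) (axis k 1)) + \<i> * complex_of_real (r'' z (t *\<^sub>R v) (axis k \<i>))) / 2)) (at 0)"
    by (rule bounded_linear.has_derivative[OF bounded_linear_divide] has_derivative_add has_derivative_mult_right a)+
  then have 1: "((\<lambda>t. ?g (z + t *\<^sub>R v)) has_vector_derivative
      (of_real (r'' z v (axis k 1)) + \<i> * of_real (r'' z v (axis k \<i>))) / 2) (at 0)"
    unfolding has_vector_derivative_def
    by (rule has_derivative_eq_rhs)
      (simp add: blinfun.scaleR_left blinfun.scaleR_right complex_eq_iff fun_eq_iff field_simps)
  have "open ((\<lambda>t. z + t *\<^sub>R v) -` U)" by (intro open_vimage open_U continuous_intros)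
  moreover have "0 \<in> (\<lambda>t. z + t *\<^sub>R v) -` U" using z by simp
  ultimately have "((\<lambda>t. dzbar k (\<lambda>z. complex_of_real (r z)) (z + t *\<^sub>R v)) has_vector_derivative
      (of_real (r'' z v (axis k 1)) + \<i> * of_real (r'' z v (axis k \<i>))) / 2) (at 0)"
    by (rule has_vector_derivative_transform_within_open[OF 1]) (auto simp: dzbar_of_real)
  then show ?thesis unfolding dir_deriv_def by (rule vector_derivative_at)
qed

lemma levi_form_eq:
  assumes z: "z \<in> U"
  shows "levi_form r z w = (r'' z w w + r'' z (mult_i w) (mult_i w)) / 4"
proof -
  have "dz j (dzbar k (\<lambda>z. complex_of_real (r z))) z =
      Complex ((r'' z (axis j 1) (axis k 1) + r'' z (axis j \<i>) (axis k \<i>)) / 4)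
        ((r'' z (axis j 1) (axis k \<i>) - r'' z (axis j \<i>) (axis k 1)) / 4)" for j k
    unfolding dz_def dir_deriv_dzbar[OF z] by (simp add: complex_eq_iff field_simps)
  then show ?thesis unfolding levi_form_def by (simp only: hermitian_part_expansion)
qed

lemma complex_tangent_space_iff:
  assumes z: "z \<in> U"
  shows "w \<in> complex_tangent_space r z \<longleftrightarrow> r' z w = 0 \<and> r' z (mult_i w) = 0"
proof -
  have "w \<in> complex_tangent_space r z \<longleftrightarrow> (of_real (r' z w) - \<i> * of_real (r' z (mult_i w))) / 2 = (0::complex)"
    unfolding complex_tangent_space_def mem_Collect_eq dz_of_real[OF z] complex_linear_part_expansion by simp
  also have "\<dots> \<longleftrightarrow> r' z w = 0 \<and> r' z (mult_i w) = 0" by (simp add: complex_eq_iff)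
  finally show ?thesis .
qed

end

text \<open>A penalty argument: if the pairs \<open>c = 1 / n\<close>, \<open>A = n\<close> all
  failed, a limit point of the violating points would satisfy \<open>g = 0\<close> and
  \<open>f \<le> 0\<close>. It serves to extend positivity of the Levi form from the complex tangent
  space to all vectors, with \<open>g\<close> measuring the failure to be tangent.\<close>

lemma compact_positive_combination:
  fixes f g :: "'a::metric_space \<Rightarrow> real"
  assumes K: "compact K" and f: "continuous_on K f" and g: "continuous_on K g"
    and g0: "\<And>x. x \<in> K \<Longrightarrow> g x \<ge> 0" and pos: "\<And>x. x \<in> K \<Longrightarrow> g x = 0 \<Longrightarrow> f x > 0"
  shows "\<exists>c>0. \<exists>A>0. \<forall>x\<in>K. c - A * g x \<le> f x"
proof (rule ccontr)
  assume neg: "\<not> ?thesis"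
  have "\<exists>x\<in>K. f x < 1 / real (Suc n) - real (Suc n) * g x" for n
  proof -
    have "\<not> (\<forall>x\<in>K. 1 / real (Suc n) - real (Suc n) * g x \<le> f x)"
      using neg by (metis of_nat_0_less_iff zero_less_Suc zero_less_divide_1_iff)
    then show ?thesis by force
  qed
  then obtain x where x: "\<And>n. x n \<in> K" "\<And>n. f (x n) < 1 / real (Suc n) - real (Suc n) * g (x n)" by metis
  obtain l s where l: "l \<in> K" "strict_mono s" "(x \<circ> s) \<longlonglongrightarrow> l"
    using K x(1) unfolding compact_def by metis
  have fl: "(\<lambda>n. f (x (s n))) \<longlonglongrightarrow> f l"
    using continuous_on_tendsto_compose[OF f l(3) l(1)] x(1) by (simp add: o_def)
  have gl: "(\<lambda>n. g (x (s n))) \<longlonglongrightarrow> g l"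
    using continuous_on_tendsto_compose[OF g l(3) l(1)] x(1) by (simp add: o_def)
  have inv: "(\<lambda>n. 1 / real (Suc (s n))) \<longlonglongrightarrow> 0"
    using LIMSEQ_subseq_LIMSEQ[OF LIMSEQ_inverse_real_of_nat l(2)] by (simp add: o_def inverse_eq_divide)
  have "f l \<le> 0"
  proof (rule LIMSEQ_le[OF fl inv])
    have "f (x (s n)) \<le> 1 / real (Suc (s n))" for n
      using x(2)[of "s n"] mult_nonneg_nonneg[OF of_nat_0_le_iff[of "Suc (s n)"] g0[OF x(1)[of "s n"]]] by linarith
    then show "\<exists>N. \<forall>n\<ge>N. f (x (s n)) \<le> 1 / real (Suc (s n))" by blast
  qed
  moreover have "g l \<le> 0"
  proof -
    have "(\<lambda>n. (1 / real (Suc (s n))) * (1 / real (Suc (s n)) - f (x (s n)))) \<longlonglongrightarrow> 0 * (0 - f l)"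
      by (intro tendsto_intros inv fl)
    then have lim: "(\<lambda>n. (1 / real (Suc (s n))) * (1 / real (Suc (s n)) - f (x (s n)))) \<longlonglongrightarrow> 0" by simp
    have "g (x (s n)) \<le> (1 / real (Suc (s n))) * (1 / real (Suc (s n)) - f (x (s n)))" for n
    proof -
      have "real (Suc (s n)) * g (x (s n)) \<le> 1 / real (Suc (s n)) - f (x (s n))" using x(2)[of "s n"] by linarith
      then have "(1 / real (Suc (s n))) * (real (Suc (s n)) * g (x (s n)))
         \<le> (1 / real (Suc (s n))) * (1 / real (Suc (s n)) - f (x (s n)))" by (intro mult_left_mono) auto
      then show ?thesis by simp
    qed
    then show ?thesis by (intro LIMSEQ_le[OF gl lim]) blast
  qed
  ultimately show False using g0[OF l(1)] pos[OF l(1)] by simp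
qed


section \<open>The Levi polynomial\<close>

lemma holo_funI:
  assumes "\<And>z. (P has_derivative P' z) (at z)" "\<And>z h. P' z (mult_i h) = \<i> * P' z h"
  shows "holo_fun P"
  unfolding holo_fun_def
proof (intro allI exI conjI)
  fix z c v
  show "(P has_derivative P' z) (at z)" by (rule assms)
  have l: "linear (P' z)" using has_derivative_linear[OF assms(1)] .
  have "P' z (c *s v) = Re c *\<^sub>R P' z v + Im c *\<^sub>R P' z (mult_i v)"
    by (subst smult_eq_Re_Im) (simp only: linear_add[OF l] linear_scale[OF l])
  also have "\<dots> = c * P' z v" unfolding assms(2) by (simp add: complex_eq_iff)
  finally show "P' z (c *s v) = c * P' z v" .
qed

text \<open>The complex-linear form whose real part is \<open>l\<close>, that is, twice the
  complex-linear part of \<open>l\<close>.\<close>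

definition wirtinger :: "((complex^'n) \<Rightarrow>\<^sub>L real) \<Rightarrow> complex^'n \<Rightarrow> complex" where
  "wirtinger l v = Complex (l v) (- l (mult_i v))"

text \<open>A complex-bilinear form for symmetric and general \<open>B\<close> alike. On the
  diagonal its real part is, up to a factor 2, the part of \<open>B\<close> that changes sign under
  \<open>mult_i\<close>; a quarter of it plus the Levi form restores the Taylor term
  \<open>B v v / 2\<close>.\<close>

definition wirtinger2 :: "((complex^'n) \<Rightarrow>\<^sub>L (complex^'n) \<Rightarrow>\<^sub>L real) \<Rightarrow> complex^'n \<Rightarrow> complex^'n \<Rightarrow> complex" where
  "wirtinger2 B v h = Complex (B v h - B (mult_i v) (mult_i h)) (- (B v (mult_i h) + B (mult_i v) h))"

text \<open>At a boundary point the term \<open>A l\<^sup>2\<close> makes up for the missing positivity of the Levi form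
  transversally to the complex tangent space.\<close>

definition levi_polynomial ::
    "((complex^'n) \<Rightarrow>\<^sub>L real) \<Rightarrow> ((complex^'n) \<Rightarrow>\<^sub>L (complex^'n) \<Rightarrow>\<^sub>L real) \<Rightarrow> real \<Rightarrow> complex^'n \<Rightarrow> complex" where
  "levi_polynomial l B A v = wirtinger l v + wirtinger2 B v v / 4 + of_real A * (wirtinger l v)\<^sup>2"

lemma wirtinger_mult_i: "wirtinger l (mult_i h) = \<i> * wirtinger l h"
  by (simp add: wirtinger_def mult_i_mult_i blinfun.minus_right complex_eq_iff)

lemma wirtinger2_mult_i:
  "wirtinger2 B v (mult_i h) = \<i> * wirtinger2 B v h" "wirtinger2 B (mult_i v) h = \<i> * wirtinger2 B v h"
  by (simp_all add: wirtinger2_def mult_i_mult_i blinfun.minus_right blinfun.minus_left complex_eq_iff)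

lemma bounded_linear_wirtinger: "bounded_linear (wirtinger l)"
proof -
  have "wirtinger l = (\<lambda>v. of_real (l v) - \<i> * of_real (l (mult_i v)))"
    by (auto simp: wirtinger_def complex_eq_iff)
  moreover have "bounded_linear (\<lambda>v. complex_of_real (l v) - \<i> * of_real (l (mult_i v)))"
    by (intro bounded_linear_sub bounded_linear_const_mult
        bounded_linear_compose[OF bounded_linear_of_real] bounded_linear_compose[OF blinfun.bounded_linear_right]
        blinfun.bounded_linear_right bounded_linear_smult_right)
  ultimately show ?thesis by simp
qed

lemma norm_wirtinger2_le: "cmod (wirtinger2 B v h) \<le> 4 * norm B * norm v * norm h"
proof -
  have b: "\<bar>B x y\<bar> \<le> norm B * norm x * norm y" for x y
  proof -
    have "\<bar>B x y\<bar> \<le> norm (B x) * norm y" using norm_blinfun[of "B x" y] by simp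
    also have "\<dots> \<le> norm B * norm x * norm y" by (intro mult_right_mono norm_blinfun) auto
    finally show ?thesis .
  qed
  have "cmod (wirtinger2 B v h) \<le> \<bar>B v h - B (mult_i v) (mult_i h)\<bar> + \<bar>- (B v (mult_i h) + B (mult_i v) h)\<bar>"
    using cmod_le[of "wirtinger2 B v h"] by (simp add: wirtinger2_def)
  then show ?thesis
    using b[of v h] b[of "mult_i v" "mult_i h"] b[of v "mult_i h"] b[of "mult_i v" h]
    by (simp add: norm_complex_smult)
qed

lemma bounded_bilinear_wirtinger2: "bounded_bilinear (wirtinger2 B)"
proof -
  have eq: "wirtinger2 B = (\<lambda>v h. (of_real (B v h) - of_real (B (mult_i v) (mult_i h)))
      - \<i> * (of_real (B v (mult_i h)) + of_real (B (mult_i v) h)))"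
    by (auto simp: wirtinger2_def complex_eq_iff fun_eq_iff)
  show ?thesis
  proof
    show "wirtinger2 B (a + a') b = wirtinger2 B a b + wirtinger2 B a' b" for a a' b
      by (simp add: eq vector_add_ldistrib blinfun.add_left blinfun.add_right algebra_simps)
    show "wirtinger2 B a (b + b') = wirtinger2 B a b + wirtinger2 B a b'" for a b b'
      by (simp add: eq vector_add_ldistrib blinfun.add_right algebra_simps)
    have J: "mult_i (t *\<^sub>R v) = t *\<^sub>R mult_i v" for t and v :: "complex^'a"
      by (simp add: vec_eq_iff)
    show "wirtinger2 B (t *\<^sub>R a) b = t *\<^sub>R wirtinger2 B a b" for t a b
      by (simp add: wirtinger2_def J blinfun.scaleR_left blinfun.scaleR_right complex_eq_iff algebra_simps)
    show "wirtinger2 B a (t *\<^sub>R b) = t *\<^sub>R wirtinger2 B a b" for t a b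
      by (simp add: wirtinger2_def J blinfun.scaleR_right complex_eq_iff algebra_simps)
    have "norm (wirtinger2 B a b) \<le> norm a * norm b * (4 * norm B)" for a b
      using norm_wirtinger2_le[of B a b] by (simp add: mult_ac)
    then show "\<exists>K. \<forall>a b. norm (wirtinger2 B a b) \<le> norm a * norm b * K" by blast
  qed
qed

lemma norm_wirtinger_le: "cmod (wirtinger l v) \<le> 2 * norm l * norm v"
proof -
  have "cmod (wirtinger l v) \<le> \<bar>l v\<bar> + \<bar>l (mult_i v)\<bar>"
    using cmod_le[of "wirtinger l v"] by (simp add: wirtinger_def)
  then show ?thesis
    using norm_blinfun[of l v] norm_blinfun[of l "mult_i v"] by (simp add: norm_complex_smult)
qed

lemma holo_fun_levi_polynomial: "holo_fun (\<lambda>z. levi_polynomial l B A (z - \<zeta>))"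
proof (rule holo_funI)
  fix z
  have id: "((\<lambda>z. z - \<zeta>) has_derivative (\<lambda>h. h)) (at z)"
    by (auto intro!: derivative_eq_intros)
  have w: "((\<lambda>z. wirtinger l (z - \<zeta>)) has_derivative wirtinger l) (at z)"
    by (rule bounded_linear.has_derivative[OF bounded_linear_wirtinger id])
  have w2: "((\<lambda>z. wirtinger2 B (z - \<zeta>) (z - \<zeta>)) has_derivative
      (\<lambda>h. wirtinger2 B (z - \<zeta>) h + wirtinger2 B h (z - \<zeta>))) (at z)"
    by (rule bounded_bilinear.FDERIV[OF bounded_bilinear_wirtinger2 id id])
  show "((\<lambda>z. levi_polynomial l B A (z - \<zeta>)) has_derivative
     (\<lambda>h. wirtinger l h + (wirtinger2 B (z - \<zeta>) h + wirtinger2 B h (z - \<zeta>)) / 4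
        + of_real A * (wirtinger l (z - \<zeta>) * wirtinger l h + wirtinger l h * wirtinger l (z - \<zeta>)))) (at z)"
    unfolding levi_polynomial_def power2_eq_square
    by (rule has_derivative_add has_derivative_mult_right has_derivative_mult
        bounded_linear.has_derivative[OF bounded_linear_divide] w w2)+
qed (simp add: wirtinger_mult_i wirtinger2_mult_i algebra_simps add_divide_distrib)

section \<open>Uniform estimates near the boundary\<close>

locale C2_boundary = C2_function U r r' r'' for U :: "(complex^'n) set" and r r' r'' +
  fixes D :: "(complex^'n) set"
  assumes open_D: "open D" and D_nonempty: "D \<noteq> {}" and bounded_D: "bounded D"
    and frontier_U: "frontier D \<subseteq> U" and D_U: "D \<inter> U = {z\<in>U. r z < 0}"
    and gradient: "\<And>\<zeta>. \<zeta> \<in> frontier D \<Longrightarrow> r' \<zeta> \<noteq> 0"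
    and levi: "\<And>\<zeta> w. \<zeta> \<in> frontier D \<Longrightarrow> w \<noteq> 0 \<Longrightarrow> r' \<zeta> w = 0 \<Longrightarrow> r' \<zeta> (mult_i w) = 0 \<Longrightarrow>
       r'' \<zeta> w w + r'' \<zeta> (mult_i w) (mult_i w) > 0"
begin

lemma compact_frontier_D: "compact (frontier D)"
  by (rule compact_frontier_bounded[OF bounded_D])

lemma frontier_D_nonempty: "frontier D \<noteq> {}"
  using D_nonempty bounded_D by (metis frontier_not_empty not_bounded_UNIV)

lemma mem_D_iff: "z \<in> U \<Longrightarrow> z \<in> D \<longleftrightarrow> r z < 0"
  using D_U by blast

lemma continuous_r': "continuous_on U r'"
  by (rule continuous_at_imp_continuous_on) (use r'' has_derivative_continuous in blast)

lemma continuous_r: "continuous_on U r"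
  by (rule continuous_at_imp_continuous_on) (use r' has_derivative_continuous in blast)

lemma r_frontier:
  assumes z: "\<zeta> \<in> frontier D" shows "r \<zeta> = 0"
proof (rule antisym)
  have U: "\<zeta> \<in> U" using z frontier_U by blast
  have "\<zeta> \<notin> D" using z open_D by (simp add: frontier_def interior_open)
  then show "0 \<le> r \<zeta>" using mem_D_iff[OF U] by simp
  show "r \<zeta> \<le> 0"
  proof (rule ccontr)
    assume "\<not> r \<zeta> \<le> 0"
    have "open {x \<in> U. r x \<in> {0<..}}"
      using continuous_open_preimage[OF continuous_r open_U open_greaterThan[of 0]]
      by (simp add: vimage_def Int_def)
    moreover have "\<zeta> \<in> {x \<in> U. r x \<in> {0<..}}" using U \<open>\<not> r \<zeta> \<le> 0\<close> by simp
    moreover have "\<zeta> \<in> closure D" using z by (simp add: frontier_def)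
    ultimately have "{x \<in> U. r x \<in> {0<..}} \<inter> D \<noteq> {}"
      using open_Int_closure_eq_empty by blast
    then show False using mem_D_iff by fastforce
  qed
qed

text \<open>The estimates between two points are stated on balls about boundary points and not on
  the whole collar, since the mean value inequality needs convex sets.\<close>

definition collar_constants :: "real \<Rightarrow> real \<Rightarrow> real \<Rightarrow> real \<Rightarrow> bool" where
  "collar_constants e0 M1 M2 m \<longleftrightarrow> 0 < e0 \<and> 0 < M1 \<and> 0 < M2 \<and> 0 < m \<and>
     compact {z. infdist z (frontier D) \<le> e0} \<and> {z. infdist z (frontier D) \<le> e0} \<subseteq> U \<and>
     (\<forall>\<zeta>\<in>frontier D. m \<le> norm (r' \<zeta>)) \<and>
     (\<forall>\<zeta>\<in>frontier D. \<forall>a\<in>cball \<zeta> e0. \<forall>b\<in>cball \<zeta> e0. a \<in> U \<and> norm (r' a) \<le> M1 \<and> norm (r'' a) \<le> M2 \<and>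
        \<bar>r b - r a\<bar> \<le> M1 * norm (b - a) \<and> norm (r' b - r' a) \<le> M2 * norm (b - a) \<and>
        \<bar>r b - r a - r' a (b - a)\<bar> \<le> M2 * (norm (b - a))\<^sup>2)"

lemma collar_constants_exist: "\<exists>e0 M1 M2 m. collar_constants e0 M1 M2 m"
proof -
  let ?G = "frontier D"
  obtain e where e: "e > 0" "(\<Union>x\<in>?G. cball x e) \<subseteq> U"
    using compact_subset_open_imp_cball_epsilon_subset[OF compact_frontier_D open_U frontier_U] by metis
  define K where "K = {z. infdist z ?G \<le> e}"
  have KU: "K \<subseteq> U"
  proof
    fix z assume "z \<in> K"
    obtain \<zeta> where "\<zeta> \<in> ?G" "infdist z ?G = dist z \<zeta>"
      using infdist_attains_inf[OF frontier_closed frontier_D_nonempty] by metis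
    then have "z \<in> cball \<zeta> e" using \<open>z \<in> K\<close> by (simp add: K_def dist_commute)
    then show "z \<in> U" using e(2) \<open>\<zeta> \<in> ?G\<close> by blast
  qed
  have cK: "compact K"
    unfolding K_def by (rule compact_infdist_le[OF frontier_D_nonempty compact_frontier_D e(1)])
  have "bounded (r' ` K)" "bounded (r'' ` K)"
    using compact_continuous_image[OF continuous_on_subset[OF continuous_r' KU] cK]
      compact_continuous_image[OF continuous_on_subset[OF cont_r'' KU] cK] by (auto intro: compact_imp_bounded)
  then obtain M1 M2 where M: "0 < M1" "\<And>z. z \<in> K \<Longrightarrow> norm (r' z) \<le> M1" "0 < M2" "\<And>z. z \<in> K \<Longrightarrow> norm (r'' z) \<le> M2"
    unfolding bounded_pos by (metis imageI)
  obtain \<zeta>0 where z0: "\<zeta>0 \<in> ?G" "\<And>\<zeta>. \<zeta> \<in> ?G \<Longrightarrow> norm (r' \<zeta>0) \<le> norm (r' \<zeta>)"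
    using continuous_attains_inf[OF compact_frontier_D frontier_D_nonempty
        continuous_on_norm[OF continuous_on_subset[OF continuous_r' frontier_U]]] by blast
  have m: "norm (r' \<zeta>0) > 0" using gradient[OF z0(1)] by simp
  have est: "a \<in> U \<and> norm (r' a) \<le> M1 \<and> norm (r'' a) \<le> M2 \<and>
      \<bar>r b - r a\<bar> \<le> M1 * norm (b - a) \<and> norm (r' b - r' a) \<le> M2 * norm (b - a) \<and>
      \<bar>r b - r a - r' a (b - a)\<bar> \<le> M2 * (norm (b - a))\<^sup>2"
    if z: "\<zeta> \<in> ?G" and a: "a \<in> cball \<zeta> e" and b: "b \<in> cball \<zeta> e" for \<zeta> a b
  proof -
    have sK: "cball \<zeta> e \<subseteq> K"
    proof
      fix x assume "x \<in> cball \<zeta> e"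
      then show "x \<in> K" using infdist_le[OF z, of x] by (simp add: K_def dist_commute)
    qed
    have D1: "(r has_derivative r' x) (at x within S)" if "x \<in> cball \<zeta> e" for x S
      using r' sK KU that by (blast intro: has_derivative_at_withinI)
    have D2: "(r' has_derivative r'' x) (at x within S)" if "x \<in> cball \<zeta> e" for x S
      using r'' sK KU that by (blast intro: has_derivative_at_withinI)
    have e1: "norm (r b - r a) \<le> M1 * norm (b - a)"
      by (rule differentiable_bound[OF convex_cball D1 _ b a])
         (use M(2) sK in \<open>auto simp: norm_blinfun.rep_eq[symmetric]\<close>)
    have e2: "norm (r' y - r' x) \<le> M2 * norm (y - x)" if "x \<in> cball \<zeta> e" "y \<in> cball \<zeta> e" for x y
      by (rule differentiable_bound[OF convex_cball D2 _ that(2,1)])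
         (use M(4) sK in \<open>auto simp: norm_blinfun.rep_eq[symmetric]\<close>)
    have seg: "closed_segment a b \<subseteq> cball \<zeta> e" using a b by (simp add: closed_segment_subset)
    \<comment> \<open>The second order remainder comes from the mean value inequality for
      \<open>r - r' a\<close> on the segment from \<open>a\<close> to \<open>b\<close>, where its
      derivative is at most \<open>M2 * norm (b - a)\<close>.\<close>
    have "norm ((r b - r' a b) - (r a - r' a a)) \<le> (M2 * norm (b - a)) * norm (b - a)"
    proof (rule differentiable_bound[OF convex_closed_segment[of a b]])
      fix x assume x: "x \<in> closed_segment a b"
      then have xc: "x \<in> cball \<zeta> e" using seg by blast
      show "((\<lambda>z. r z - r' a z) has_derivative (r' x - r' a)) (at x within closed_segment a b)"
        unfolding minus_blinfun.rep_eq
        by (rule has_derivative_diff D1[OF xc] bounded_linear_imp_has_derivative[OF blinfun.bounded_linear_right])+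
      have "norm (r' x - r' a) \<le> M2 * norm (x - a)" by (rule e2[OF a xc])
      also have "\<dots> \<le> M2 * norm (b - a)"
        using segment_bound1[OF x] M(3) by (intro mult_left_mono) auto
      finally show "onorm (r' x - r' a) \<le> M2 * norm (b - a)" by (simp add: norm_blinfun.rep_eq)
    qed auto
    then have e3: "\<bar>r b - r a - r' a (b - a)\<bar> \<le> M2 * (norm (b - a))\<^sup>2"
      by (simp add: blinfun.diff_right power2_eq_square algebra_simps)
    show ?thesis using e1 e2[OF a b] e3 a sK KU M by auto
  qed
  have "collar_constants e M1 M2 (norm (r' \<zeta>0))"
    unfolding collar_constants_def using e(1) M(1,3) m cK KU z0(2) est by (simp add: K_def)
  then show ?thesis by blast
qed

text \<open>Uniform continuity of \<open>r''\<close> on the compact collar makes the remainder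
  uniform in \<open>\<zeta>\<close>. The mean value inequality is used twice: for \<open>r'\<close>
  about \<open>\<zeta>\<close>, then for the second order remainder along the segment.\<close>

lemma uniform_taylor:
  assumes cc: "collar_constants e0 M1 M2 m" and eps: "\<epsilon> > 0"
  shows "\<exists>R>0. R \<le> e0 \<and> (\<forall>\<zeta>\<in>frontier D. \<forall>v. norm v \<le> R \<longrightarrow>
    \<bar>r (\<zeta> + v) - r' \<zeta> v - r'' \<zeta> v v / 2\<bar> \<le> \<epsilon> * (norm v)\<^sup>2)"
proof -
  let ?K = "{z. infdist z (frontier D) \<le> e0}"
  have K: "compact ?K" "?K \<subseteq> U" and e0: "e0 > 0" using cc by (auto simp: collar_constants_def)
  have "uniformly_continuous_on ?K r''"
    by (rule compact_uniformly_continuous[OF continuous_on_subset[OF cont_r'' K(2)] K(1)])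
  then obtain d where d: "d > 0" "\<And>x y. x \<in> ?K \<Longrightarrow> y \<in> ?K \<Longrightarrow> dist y x < d \<Longrightarrow> dist (r'' y) (r'' x) < \<epsilon>"
    unfolding uniformly_continuous_on_def using eps by metis
  define R where "R = min e0 (d / 2)"
  have R: "R > 0" "R \<le> e0" "R < d" using e0 d(1) by (auto simp: R_def)
  have "\<bar>r (\<zeta> + v) - r' \<zeta> v - r'' \<zeta> v v / 2\<bar> \<le> \<epsilon> * (norm v)\<^sup>2"
    if z: "\<zeta> \<in> frontier D" and v: "norm v \<le> R" for \<zeta> v
  proof -
    have inK: "x \<in> ?K" if "x \<in> cball \<zeta> R" for x
      using infdist_le[OF z, of x] that R by (simp add: dist_commute)
    have zR: "\<zeta> \<in> cball \<zeta> R" using R by simp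
    have r'est: "norm (r' (\<zeta> + u) - r' \<zeta> - r'' \<zeta> u) \<le> \<epsilon> * norm u" if u: "norm u \<le> R" for u
    proof -
      have "norm ((r' (\<zeta> + u) - r'' \<zeta> (\<zeta> + u)) - (r' \<zeta> - r'' \<zeta> \<zeta>)) \<le> \<epsilon> * norm ((\<zeta> + u) - \<zeta>)"
      proof (rule differentiable_bound[OF convex_cball[of \<zeta> R]])
        fix x assume x: "x \<in> cball \<zeta> R"
        have "x \<in> U" using inK[OF x] K(2) by blast
        show "((\<lambda>z. r' z - r'' \<zeta> z) has_derivative (r'' x - r'' \<zeta>)) (at x within cball \<zeta> R)"
          unfolding minus_blinfun.rep_eq
          by (rule has_derivative_diff has_derivative_at_withinI[OF r''[OF \<open>x \<in> U\<close>]]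
              bounded_linear_imp_has_derivative[OF blinfun.bounded_linear_right])+
        have "dist (r'' x) (r'' \<zeta>) < \<epsilon>"
          using x R by (intro d(2) inK zR) (auto simp: dist_commute)
        then show "onorm (r'' x - r'' \<zeta>) \<le> \<epsilon>" by (simp add: dist_norm norm_blinfun.rep_eq)
      qed (use u R in \<open>auto simp: dist_norm\<close>)
      then show ?thesis by (simp add: blinfun.add_right algebra_simps)
    qed
    define g where "g t = r (\<zeta> + t *\<^sub>R v) - t * r' \<zeta> v - t\<^sup>2 / 2 * r'' \<zeta> v v" for t
    have "norm (g 1 - g 0) \<le> (\<epsilon> * (norm v)\<^sup>2) * norm (1 - 0 :: real)"
    proof (rule differentiable_bound[OF convex_real_interval(5)[of 0 1]])
      fix t :: real assume t: "t \<in> {0..1}"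
      have tv: "norm (t *\<^sub>R v) \<le> norm v" using t by (simp add: mult_left_le_one_le)
      have "\<zeta> + t *\<^sub>R v \<in> cball \<zeta> R" using tv v by (simp add: dist_norm)
      then have U: "\<zeta> + t *\<^sub>R v \<in> U" using inK K(2) by blast
      have "((\<lambda>t. \<zeta> + t *\<^sub>R v) has_derivative (\<lambda>t. t *\<^sub>R v)) (at t)"
        by (auto intro!: derivative_eq_intros)
      from diff_chain_at[OF this r'[OF U]]
      have "((\<lambda>t. r (\<zeta> + t *\<^sub>R v)) has_derivative (\<lambda>s. s * r' (\<zeta> + t *\<^sub>R v) v)) (at t)"
        by (simp add: o_def blinfun.scaleR_right)
      then have "(g has_derivative (\<lambda>s. s * (r' (\<zeta> + t *\<^sub>R v) v - r' \<zeta> v - t * r'' \<zeta> v v))) (at t)"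
        unfolding g_def by (auto intro!: derivative_eq_intros simp: algebra_simps fun_eq_iff)
      then show "(g has_derivative (\<lambda>s. s * (r' (\<zeta> + t *\<^sub>R v) v - r' \<zeta> v - t * r'' \<zeta> v v))) (at t within {0..1})"
        by (rule has_derivative_at_withinI)
      have "\<bar>r' (\<zeta> + t *\<^sub>R v) v - r' \<zeta> v - t * r'' \<zeta> v v\<bar> = norm ((r' (\<zeta> + t *\<^sub>R v) - r' \<zeta> - r'' \<zeta> (t *\<^sub>R v)) v)"
        by (simp add: blinfun.diff_left blinfun.scaleR_right blinfun.scaleR_left)
      also have "\<dots> \<le> norm (r' (\<zeta> + t *\<^sub>R v) - r' \<zeta> - r'' \<zeta> (t *\<^sub>R v)) * norm v"
        by (rule norm_blinfun)
      also have "\<dots> \<le> (\<epsilon> * norm (t *\<^sub>R v)) * norm v"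
        using tv v by (intro mult_right_mono r'est) auto
      also have "\<dots> \<le> (\<epsilon> * norm v) * norm v"
        using tv eps by (intro mult_right_mono mult_left_mono) auto
      finally have est: "\<bar>r' (\<zeta> + t *\<^sub>R v) v - r' \<zeta> v - t * r'' \<zeta> v v\<bar> \<le> \<epsilon> * norm v * norm v" .
      show "onorm (\<lambda>s. s * (r' (\<zeta> + t *\<^sub>R v) v - r' \<zeta> v - t * r'' \<zeta> v v)) \<le> \<epsilon> * (norm v)\<^sup>2"
      proof (rule onorm_le)
        fix s
        show "norm (s * (r' (\<zeta> + t *\<^sub>R v) v - r' \<zeta> v - t * r'' \<zeta> v v)) \<le> \<epsilon> * (norm v)\<^sup>2 * norm s"
          using mult_left_mono[OF est, of "\<bar>s\<bar>"] by (simp add: abs_mult power2_eq_square mult_ac)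
      qed
    qed auto
    then show ?thesis by (simp add: g_def r_frontier[OF z])
  qed
  then show ?thesis using R by blast
qed

end


context C2_boundary
begin

lemma collar_constantsD:
  assumes "collar_constants e0 M1 M2 m" "\<zeta> \<in> frontier D" "a \<in> cball \<zeta> e0" "b \<in> cball \<zeta> e0"
  shows "a \<in> U" "norm (r' a) \<le> M1" "norm (r'' a) \<le> M2" "\<bar>r b - r a\<bar> \<le> M1 * norm (b - a)"
    "norm (r' b - r' a) \<le> M2 * norm (b - a)" "\<bar>r b - r a - r' a (b - a)\<bar> \<le> M2 * (norm (b - a))\<^sup>2"
  using assms unfolding collar_constants_def by blast+

lemma nearest_frontier_point:
  obtains \<zeta> where "\<zeta> \<in> frontier D" "infdist z (frontier D) = norm (z - \<zeta>)"
  using infdist_attains_inf[OF frontier_closed frontier_D_nonempty, of z] by (metis dist_norm)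

text \<open>Both sides are homogeneous of degree 2 in \<open>v\<close>, so compactness of the
  boundary times the unit sphere is enough. The penalty vanishes precisely on the complex tangent
  space, where the Levi form is positive.\<close>

lemma levi_lower_bound:
  "\<exists>c>0. \<exists>A>0. \<forall>\<zeta>\<in>frontier D. \<forall>v. (r'' \<zeta> v v + r'' \<zeta> (mult_i v) (mult_i v)) / 4
     \<ge> c * (norm v)\<^sup>2 - A * ((r' \<zeta> v)\<^sup>2 + (r' \<zeta> (mult_i v))\<^sup>2)"
proof -
  let ?K = "frontier D \<times> sphere (0 :: complex^'n) 1"
  let ?f = "\<lambda>x. (r'' (fst x) (snd x) (snd x) + r'' (fst x) (mult_i (snd x)) (mult_i (snd x))) / 4"
  let ?g = "\<lambda>x. (r' (fst x) (snd x))\<^sup>2 + (r' (fst x) (mult_i (snd x)))\<^sup>2"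
  have c1: "continuous_on ?K (\<lambda>x. r' (fst x))"
    by (rule continuous_on_compose2[OF continuous_r']) (use frontier_U in \<open>auto intro!: continuous_intros\<close>)
  have c2: "continuous_on ?K (\<lambda>x. r'' (fst x))"
    by (rule continuous_on_compose2[OF cont_r'']) (use frontier_U in \<open>auto intro!: continuous_intros\<close>)
  have c3: "continuous_on ?K (\<lambda>x. mult_i (snd x))"
    by (intro bounded_linear.continuous_on[OF bounded_linear_smult_right] continuous_intros)
  have "\<exists>c>0. \<exists>A>0. \<forall>x\<in>?K. c - A * ?g x \<le> ?f x"
  proof (rule compact_positive_combination)
    show "compact ?K" by (intro compact_Times compact_frontier_D) simp
    show "continuous_on ?K ?f" by (intro continuous_intros c1 c2 c3) auto
    show "continuous_on ?K ?g" by (intro continuous_intros c1 c2 c3)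
    fix x assume x: "x \<in> ?K"
    show "?g x \<ge> 0" by simp
    assume "?g x = 0"
    then have "r' (fst x) (snd x) = 0" "r' (fst x) (mult_i (snd x)) = 0" by (simp_all add: sum_power2_eq_zero_iff)
    moreover have "fst x \<in> frontier D" "snd x \<noteq> 0" using x by auto
    ultimately show "?f x > 0" using levi[of "fst x" "snd x"] by simp
  qed
  then obtain c A where cA: "c > 0" "A > 0" "\<And>x. x \<in> ?K \<Longrightarrow> c - A * ?g x \<le> ?f x" by blast
  have "(r'' \<zeta> v v + r'' \<zeta> (mult_i v) (mult_i v)) / 4
     \<ge> c * (norm v)\<^sup>2 - A * ((r' \<zeta> v)\<^sup>2 + (r' \<zeta> (mult_i v))\<^sup>2)" if z: "\<zeta> \<in> frontier D" for \<zeta> v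
  proof (cases "v = 0")
    case True
    have "mult_i (0 :: complex^'n) = 0" by (simp add: vec_eq_iff)
    then show ?thesis using True by (simp add: blinfun.zero_right)
  next
    case False
    define u where "u = v /\<^sub>R norm v"
    have nu: "norm u = 1" using False by (simp add: u_def)
    have v: "v = norm v *\<^sub>R u" using False by (simp add: u_def)
    have Jv: "mult_i v = norm v *\<^sub>R mult_i u" by (subst v) (simp add: vec_eq_iff)
    have "c - A * ((r' \<zeta> u)\<^sup>2 + (r' \<zeta> (mult_i u))\<^sup>2) \<le> (r'' \<zeta> u u + r'' \<zeta> (mult_i u) (mult_i u)) / 4"
      using cA(3)[of "(\<zeta>, u)"] z nu by simp
    then have "(norm v)\<^sup>2 * (c - A * ((r' \<zeta> u)\<^sup>2 + (r' \<zeta> (mult_i u))\<^sup>2))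
        \<le> (norm v)\<^sup>2 * ((r'' \<zeta> u u + r'' \<zeta> (mult_i u) (mult_i u)) / 4)"
      by (intro mult_left_mono) auto
    moreover have "r' \<zeta> v = norm v * r' \<zeta> u" "r' \<zeta> (mult_i v) = norm v * r' \<zeta> (mult_i u)"
      unfolding Jv by (subst v, simp add: blinfun.scaleR_right, simp add: blinfun.scaleR_right)
    moreover have "r'' \<zeta> v v = (norm v)\<^sup>2 * r'' \<zeta> u u" "r'' \<zeta> (mult_i v) (mult_i v) = (norm v)\<^sup>2 * r'' \<zeta> (mult_i u) (mult_i u)"
      unfolding Jv by (subst (1 2) v, simp add: blinfun.scaleR_right blinfun.scaleR_left power2_eq_square,
        simp add: blinfun.scaleR_right blinfun.scaleR_left power2_eq_square)
    ultimately show ?thesis by (simp add: power_mult_distrib algebra_simps)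
  qed
  then show ?thesis using cA(1,2) by blast
qed

text \<open>The gradient is bounded below near the boundary, so a step from \<open>z\<close> of
  length comparable to \<open>- r z\<close> in a direction of increase leaves \<open>D\<close>, and
  the segment meets the frontier on the way. The direction is kept in the conclusion for the
  construction of inner discs.\<close>

lemma infdist_le_defining_function:
  assumes cc: "collar_constants e0 M1 M2 m"
  shows "\<exists>e>0. \<exists>C>0. \<forall>z\<in>D. infdist z (frontier D) < e \<longrightarrow> infdist z (frontier D) \<le> C * (- r z) \<and>
     (\<exists>v. norm v = 1 \<and> r' z v \<ge> m / 4)"
proof -
  have pos: "e0 > 0" "M1 > 0" "M2 > 0" "m > 0" using cc by (auto simp: collar_constants_def)
  \<comment> \<open>In order: \<open>z\<close> stays well inside the collar, the gradient is at
    least \<open>m / 2\<close>, the step length \<open>\<tau>\<close> is at most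
    \<open>e0 / 2\<close>, and the quadratic error \<open>M2 * \<tau>\<^sup>2\<close> is at most
    \<open>- r z\<close>.\<close>
  define e where "e = Min {e0 / 2, m / (2 * M2), e0 * m / (16 * M1), m\<^sup>2 / (64 * M2 * M1)}"
  have e: "e > 0" "e \<le> e0 / 2" "e \<le> m / (2 * M2)" "e \<le> e0 * m / (16 * M1)" "e \<le> m\<^sup>2 / (64 * M2 * M1)"
    using pos by (auto simp: e_def)
  have "infdist z (frontier D) \<le> 8 / m * (- r z) \<and> (\<exists>v. norm v = 1 \<and> r' z v \<ge> m / 4)"
    if z: "z \<in> D" and ze: "infdist z (frontier D) < e" for z
  proof -
    obtain \<zeta> where zt: "\<zeta> \<in> frontier D" "infdist z (frontier D) = norm (z - \<zeta>)"
      by (rule nearest_frontier_point)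
    have zc: "z \<in> cball \<zeta> e0" "\<zeta> \<in> cball \<zeta> e0" using zt ze e pos by (auto simp: dist_norm norm_minus_commute)
    have "norm (r' \<zeta>) \<le> norm (r' z) + norm (r' \<zeta> - r' z)" using norm_triangle_ineq[of "r' z" "r' \<zeta> - r' z"] by simp
    moreover have "norm (r' \<zeta> - r' z) \<le> M2 * norm (\<zeta> - z)" by (rule collar_constantsD(5)[OF cc zt(1) zc])
    moreover have "M2 * norm (\<zeta> - z) \<le> M2 * (m / (2 * M2))"
      using zt(2) ze e(3) pos by (intro mult_left_mono) (auto simp: norm_minus_commute)
    moreover have "m \<le> norm (r' \<zeta>)" using cc zt(1) by (auto simp: collar_constants_def)
    ultimately have nz: "norm (r' z) \<ge> m / 2" using pos by simp
    have "\<exists>v. norm v = 1 \<and> r' z v \<ge> m / 4"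
    proof (rule ccontr)
      assume neg: "\<not> ?thesis"
      have "norm (r' z) \<le> m / 4"
      proof (rule norm_blinfun_bound)
        fix x show "norm (r' z x) \<le> m / 4 * norm x"
        proof (cases "x = 0")
          case False
          define u where "u = x /\<^sub>R norm x"
          have u: "norm u = 1" "norm (- u) = 1" "x = norm x *\<^sub>R u" using False by (auto simp: u_def)
          have "\<not> r' z u \<ge> m / 4" "\<not> r' z (- u) \<ge> m / 4" using neg u(1,2) by blast+
          then have "\<bar>r' z u\<bar> \<le> m / 4" by (simp add: blinfun.minus_right)
          then have "norm x * \<bar>r' z u\<bar> \<le> norm x * (m / 4)" by (intro mult_left_mono) auto
          then show ?thesis by (subst u(3)) (simp add: blinfun.scaleR_right abs_mult mult.commute)
        qed (simp add: blinfun.zero_right)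
      qed (use pos in simp)
      then show False using nz pos by simp
    qed
    then obtain v where v: "norm v = 1" "r' z v \<ge> m / 4" by blast
    define s where "s = - r z"
    \<comment> \<open>With slope at least \<open>m / 4\<close> the linear gain is at least
      \<open>2 * s\<close>; after a quadratic error of at most \<open>s\<close>, the value
      \<open>- s\<close> has been raised to at least 0.\<close>
    define \<tau> where "\<tau> = 8 * s / m"
    have zU: "z \<in> U" using collar_constantsD(1)[OF cc zt(1) zc] .
    have s: "s > 0" using mem_D_iff[OF zU] z by (simp add: s_def)
    have "\<bar>r \<zeta> - r z\<bar> \<le> M1 * norm (\<zeta> - z)" by (rule collar_constantsD(4)[OF cc zt(1) zc])
    then have "s \<le> M1 * norm (\<zeta> - z)" using r_frontier[OF zt(1)] by (simp add: s_def)
    also have "\<dots> \<le> M1 * e" using ze zt(2) pos by (intro mult_left_mono) (auto simp: norm_minus_commute)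
    finally have sM: "s \<le> M1 * e" .
    have tau: "\<tau> > 0" using s pos by (simp add: \<tau>_def)
    have te: "\<tau> \<le> e0 / 2"
    proof -
      have "M1 * e \<le> M1 * (e0 * m / (16 * M1))" using e(4) pos by (intro mult_left_mono) auto
      then have "s \<le> e0 * m / 16" using sM pos by simp
      then show ?thesis using pos by (simp add: \<tau>_def field_simps)
    qed
    define b where "b = z + \<tau> *\<^sub>R v"
    have bz: "norm (b - z) = \<tau>" "b - z = \<tau> *\<^sub>R v" using v tau by (auto simp: b_def)
    have "norm (b - \<zeta>) \<le> norm (b - z) + norm (z - \<zeta>)" using norm_triangle_ineq[of "b - z" "z - \<zeta>"] by simp
    then have bc: "b \<in> cball \<zeta> e0" using te bz zt(2) ze e(2) by (simp add: dist_norm norm_minus_commute)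
    have "\<bar>r b - r z - r' z (b - z)\<bar> \<le> M2 * \<tau>\<^sup>2"
      using collar_constantsD(6)[OF cc zt(1) zc(1) bc] bz by simp
    moreover have "r' z (b - z) \<ge> \<tau> * (m / 4)"
      unfolding bz blinfun.scaleR_right using v(2) tau by simp
    moreover have "\<tau> * (m / 4) = 2 * s" using pos by (simp add: \<tau>_def)
    moreover have "M2 * \<tau>\<^sup>2 \<le> s"
    proof -
      have "M1 * e \<le> M1 * (m\<^sup>2 / (64 * M2 * M1))" using e(5) pos by (intro mult_left_mono) auto
      then have "s \<le> m\<^sup>2 / (64 * M2)" using sM pos by simp
      then have "s * (64 * M2) \<le> m\<^sup>2" using pos by (simp add: pos_le_divide_eq)
      then have "(s * (64 * M2)) * s \<le> m\<^sup>2 * s" using s by (intro mult_right_mono) auto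
      then show ?thesis using pos by (simp add: \<tau>_def power_divide power2_eq_square field_simps)
    qed
    ultimately have "r b \<ge> 0" by (simp add: s_def)
    then have "b \<notin> D" using mem_D_iff collar_constantsD(1)[OF cc zt(1) bc bc] by force
    then have "closed_segment z b \<inter> frontier D \<noteq> {}"
      using z by (intro connected_Int_frontier) auto
    then obtain y where y: "y \<in> closed_segment z b" "y \<in> frontier D" by blast
    have "infdist z (frontier D) \<le> dist z y" using y(2) by (rule infdist_le)
    also have "\<dots> \<le> \<tau>" using segment_bound1[OF y(1)] bz by (simp add: dist_norm norm_minus_commute)
    finally show ?thesis using v by (auto simp: \<tau>_def s_def)
  qed
  then show ?thesis using e(1) pos by (intro exI[of _ e] conjI exI[of _ "8 / m"]) auto
qed

text \<open>Write \<open>x\<close> and \<open>y\<close> for \<open>r' \<zeta>\<close> at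
  \<open>v\<close> and at \<open>mult_i v\<close>. By Taylor's formula \<open>Re P\<close> is
  \<open>r z\<close> minus the Levi form plus \<open>A * (x\<^sup>2 - y\<^sup>2)\<close>, up to a
  small multiple of \<open>(norm v)\<^sup>2\<close>. The lower bound of the Levi form contributes
  \<open>A * (x\<^sup>2 + y\<^sup>2)\<close>, so the \<open>y\<^sup>2\<close> terms cancel, and
  \<open>2 * A * x\<^sup>2\<close> is harmless because \<open>x\<close> agrees with
  \<open>r z\<close> up to second order.\<close>

theorem local_peak_functions:
  "\<exists>R0>0. \<exists>c>0. \<exists>C>0. \<forall>\<zeta>\<in>frontier D. \<exists>P. holo_fun P \<and> (\<forall>z\<in>D. norm (z - \<zeta>) < R0 \<longrightarrow>
      Re (P z) \<le> - c * (norm (z - \<zeta>))\<^sup>2 \<and> Re (P z) \<le> - c * infdist z (frontier D) \<and>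
      cmod (P z) \<le> C * norm (z - \<zeta>))"
proof -
  obtain e0 M1 M2 m where cc: "collar_constants e0 M1 M2 m" using collar_constants_exist by blast
  have pos: "e0 > 0" "M1 > 0" "M2 > 0" "m > 0" using cc by (auto simp: collar_constants_def)
  obtain c A where cA: "c > 0" "A > 0" "\<And>\<zeta> v. \<zeta> \<in> frontier D \<Longrightarrow> (r'' \<zeta> v v + r'' \<zeta> (mult_i v) (mult_i v)) / 4
     \<ge> c * (norm v)\<^sup>2 - A * ((r' \<zeta> v)\<^sup>2 + (r' \<zeta> (mult_i v))\<^sup>2)"
    using levi_lower_bound by blast
  have "c / 4 > 0" using cA by simp
  then obtain R1 where R1: "R1 > 0" "R1 \<le> e0" "\<And>\<zeta> v. \<zeta> \<in> frontier D \<Longrightarrow> norm v \<le> R1 \<Longrightarrow>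
    \<bar>r (\<zeta> + v) - r' \<zeta> v - r'' \<zeta> v v / 2\<bar> \<le> c / 4 * (norm v)\<^sup>2"
    using uniform_taylor[OF cc] by blast
  obtain e C1 where eC: "e > 0" "C1 > 0" "\<And>z. z \<in> D \<Longrightarrow> infdist z (frontier D) < e \<Longrightarrow>
      infdist z (frontier D) \<le> C1 * (- r z)"
    using infdist_le_defining_function[OF cc] by blast
  \<comment> \<open>The bound 1 lets \<open>n\<^sup>2 \<le> n\<close> in the estimate of
    \<open>|P|\<close>, and \<open>e\<close> makes \<open>- r z\<close> control the boundary
    distance. The last two give \<open>t1\<close> and \<open>t2\<close>, which absorb
    \<open>2 * A * x\<^sup>2\<close> into half of \<open>- r z\<close> and a third of the quadratic
    term.\<close>
  define R where "R = Min {1, R1, e, 1 / (8 * A * M1), sqrt (c / (16 * A * M2\<^sup>2))}"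
  have R: "R > 0" "R \<le> 1" "R \<le> R1" "R \<le> e" "R \<le> 1 / (8 * A * M1)" "R \<le> sqrt (c / (16 * A * M2\<^sup>2))"
    using pos cA R1 eC by (auto simp: R_def)
  define c' where "c' = min (c / 2) (1 / (2 * C1))"
  define C where "C = 2 * M1 + M2 + 4 * A * M1\<^sup>2"
  have "\<exists>P. holo_fun P \<and> (\<forall>z\<in>D. norm (z - \<zeta>) < R \<longrightarrow>
      Re (P z) \<le> - c' * (norm (z - \<zeta>))\<^sup>2 \<and> Re (P z) \<le> - c' * infdist z (frontier D) \<and>
      cmod (P z) \<le> C * norm (z - \<zeta>))" if z: "\<zeta> \<in> frontier D" for \<zeta>
  proof (intro exI conjI ballI impI)
    let ?P = "\<lambda>z. levi_polynomial (r' \<zeta>) (r'' \<zeta>) A (z - \<zeta>)"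
    show "holo_fun ?P" by (rule holo_fun_levi_polynomial)
    fix z assume zD: "z \<in> D" and zR: "norm (z - \<zeta>) < R"
    define v where "v = z - \<zeta>"
    define n where "n = norm v"
    define x where "x = r' \<zeta> v"
    define y where "y = r' \<zeta> (mult_i v)"
    have n: "0 \<le> n" "n < R" "n \<le> 1" using zR R by (auto simp: n_def v_def)
    have zc: "z \<in> cball \<zeta> e0" "\<zeta> \<in> cball \<zeta> e0" using zR R R1 pos by (auto simp: dist_norm norm_minus_commute)
    have zU: "z \<in> U" by (rule collar_constantsD(1)[OF cc z zc])
    have rz: "r z < 0" using mem_D_iff[OF zU] zD by simp
    have r0: "r \<zeta> = 0" by (rule r_frontier[OF z])
    have T: "\<bar>r z - x - r'' \<zeta> v v / 2\<bar> \<le> c / 4 * n\<^sup>2"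
      using R1(3)[OF z, of v] n R by (simp add: n_def v_def x_def)
    have L: "(r'' \<zeta> v v + r'' \<zeta> (mult_i v) (mult_i v)) / 4 \<ge> c * n\<^sup>2 - A * (x\<^sup>2 + y\<^sup>2)"
      using cA(3)[OF z, of v] by (simp add: n_def x_def y_def)
    have lin: "\<bar>r z - x\<bar> \<le> M2 * n\<^sup>2"
      using collar_constantsD(6)[OF cc z zc(2,1)] r0 by (simp add: n_def v_def x_def)
    have rM: "- r z \<le> M1 * n"
      using collar_constantsD(4)[OF cc z zc(2,1)] r0 by (simp add: n_def v_def)
    have ReP: "Re (?P z) = x + (r'' \<zeta> v v - r'' \<zeta> (mult_i v) (mult_i v)) / 4 + A * (x\<^sup>2 - y\<^sup>2)"
      by (simp add: levi_polynomial_def wirtinger_def wirtinger2_def v_def x_def y_def power2_eq_square)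
    have step1: "Re (?P z) \<le> r z - 3 / 4 * c * n\<^sup>2 + 2 * A * x\<^sup>2"
    proof -
      have "r z \<ge> x + r'' \<zeta> v v / 2 - c / 4 * n\<^sup>2" using T by linarith
      then show ?thesis unfolding ReP using L by (simp add: field_simps)
    qed
    have xx: "x\<^sup>2 \<le> 2 * (r z)\<^sup>2 + 2 * (M2 * n\<^sup>2)\<^sup>2"
    proof -
      have "(r z - x)\<^sup>2 \<le> (M2 * n\<^sup>2)\<^sup>2" using power_mono[OF lin, of 2] by simp
      moreover have "x\<^sup>2 \<le> 2 * (r z)\<^sup>2 + 2 * (r z - x)\<^sup>2"
        using zero_le_power2[of "2 * r z - x"] by (simp add: power2_eq_square algebra_simps)
      ultimately show ?thesis by linarith
    qed
    have t1: "4 * A * (r z)\<^sup>2 \<le> - r z / 2"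
    proof -
      have "M1 * n \<le> M1 * (1 / (8 * A * M1))" using n R pos by (intro mult_left_mono) auto
      then have "- r z \<le> 1 / (8 * A)" using rM pos by simp
      then have "8 * A * (- r z) \<le> 1" using cA(2) by (simp add: field_simps)
      then have "(8 * A * (- r z)) * (- r z) \<le> 1 * (- r z)" using rz by (intro mult_right_mono) auto
      then show ?thesis by (simp add: power2_eq_square)
    qed
    have t2: "4 * A * (M2 * n\<^sup>2)\<^sup>2 \<le> c / 4 * n\<^sup>2"
    proof -
      have "n\<^sup>2 \<le> (sqrt (c / (16 * A * M2\<^sup>2)))\<^sup>2" using n R by (intro power_mono) auto
      also have "\<dots> = c / (16 * A * M2\<^sup>2)" using cA by simp
      finally have "16 * A * M2\<^sup>2 * n\<^sup>2 \<le> c" using cA(2) pos by (simp add: field_simps)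
      then have "(16 * A * M2\<^sup>2 * n\<^sup>2) * n\<^sup>2 \<le> c * n\<^sup>2" by (intro mult_right_mono) auto
      then show ?thesis by (simp add: power_mult_distrib power2_eq_square mult_ac)
    qed
    have "2 * A * x\<^sup>2 \<le> 2 * A * (2 * (r z)\<^sup>2 + 2 * (M2 * n\<^sup>2)\<^sup>2)" using xx cA(2) by (intro mult_left_mono) auto
    then have "2 * A * x\<^sup>2 \<le> 4 * A * (r z)\<^sup>2 + 4 * A * (M2 * n\<^sup>2)\<^sup>2" by (simp add: algebra_simps)
    then have main: "Re (?P z) \<le> r z / 2 - c / 2 * n\<^sup>2" using step1 t1 t2 by (simp add: field_simps)
    have "c' * n\<^sup>2 \<le> c / 2 * n\<^sup>2" by (intro mult_right_mono) (auto simp: c'_def)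
    then show "Re (?P z) \<le> - c' * (norm (z - \<zeta>))\<^sup>2" using main rz by (simp add: n_def v_def)
    have "infdist z (frontier D) \<le> norm (z - \<zeta>)" using infdist_le[OF z, of z] by (simp add: dist_norm)
    then have "infdist z (frontier D) \<le> C1 * (- r z)" using eC(3)[OF zD] zR R by simp
    then have "1 / (2 * C1) * infdist z (frontier D) \<le> 1 / (2 * C1) * (C1 * (- r z))" using eC(2) by (intro mult_left_mono) auto
    then have "1 / (2 * C1) * infdist z (frontier D) \<le> - r z / 2" using eC(2) by simp
    moreover have "c' * infdist z (frontier D) \<le> 1 / (2 * C1) * infdist z (frontier D)"
      by (intro mult_right_mono infdist_nonneg) (auto simp: c'_def)
    moreover have "c / 2 * n\<^sup>2 \<ge> 0" using cA by simp
    ultimately show "Re (?P z) \<le> - c' * infdist z (frontier D)" using main by simp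
    have w: "cmod (wirtinger (r' \<zeta>) v) \<le> 2 * M1 * n"
    proof -
      have "2 * norm (r' \<zeta>) * norm v \<le> 2 * M1 * norm v"
        using collar_constantsD(2)[OF cc z zc(2) zc(2)] by (intro mult_right_mono mult_left_mono) auto
      then show ?thesis using norm_wirtinger_le[of "r' \<zeta>" v] by (simp add: n_def)
    qed
    have w2: "cmod (wirtinger2 (r'' \<zeta>) v v) \<le> 4 * M2 * n"
    proof -
      have "4 * norm (r'' \<zeta>) * norm v * norm v \<le> 4 * M2 * n * 1"
        using collar_constantsD(3)[OF cc z zc(2) zc(2)] n pos unfolding n_def by (intro mult_mono mult_nonneg_nonneg) auto
      then show ?thesis using norm_wirtinger2_le[of "r'' \<zeta>" v v] by simp
    qed
    have w3: "(cmod (wirtinger (r' \<zeta>) v))\<^sup>2 \<le> 4 * M1\<^sup>2 * n"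
    proof -
      have "(cmod (wirtinger (r' \<zeta>) v))\<^sup>2 \<le> (2 * M1 * n)\<^sup>2" using w by (intro power_mono) auto
      also have "\<dots> = 4 * M1\<^sup>2 * n * n" by (simp add: power2_eq_square)
      also have "\<dots> \<le> 4 * M1\<^sup>2 * n * 1" using n by (intro mult_left_mono) auto
      finally show ?thesis by simp
    qed
    have "cmod (?P z) \<le> cmod (wirtinger (r' \<zeta>) v) + cmod (wirtinger2 (r'' \<zeta>) v v) / 4 + A * (cmod (wirtinger (r' \<zeta>) v))\<^sup>2"
      unfolding levi_polynomial_def v_def[symmetric] using cA(2)
      by (intro norm_triangle_le add_mono) (auto simp: norm_mult norm_power norm_divide)
    also have "\<dots> \<le> 2 * M1 * n + 4 * M2 * n / 4 + A * (4 * M1\<^sup>2 * n)"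
      using w w2 w3 cA(2) by (intro add_mono mult_left_mono divide_right_mono) auto
    finally show "cmod (?P z) \<le> C * norm (z - \<zeta>)" by (simp add: C_def n_def v_def algebra_simps)
  qed
  moreover have "c' > 0" "C > 0" using cA eC pos by (auto simp: c'_def C_def intro!: add_pos_pos)
  ultimately show ?thesis using R(1) by blast
qed

section \<open>Affine discs in the complex normal direction\<close>

lemma wirtinger_smult: "wirtinger l (c *s h) = c * wirtinger l h"
proof -
  have L: "linear (wirtinger l)" by (rule bounded_linear.linear[OF bounded_linear_wirtinger])
  have "wirtinger l (c *s h) = Re c *\<^sub>R wirtinger l h + Im c *\<^sub>R wirtinger l (mult_i h)"
    by (subst smult_eq_Re_Im) (simp only: linear_add[OF L] linear_scale[OF L])
  then show ?thesis by (simp add: wirtinger_mult_i complex_eq_iff)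
qed

text \<open>Let \<open>s = - r x\<close> and let \<open>v\<close> be a direction in which
  \<open>r\<close> grows. The disc of radius \<open>\<epsilon> + \<kappa> * s\<close> about
  \<open>x - \<epsilon> v\<close> contains \<open>x\<close> at distance \<open>\<kappa> * s\<close>
  from its edge. Membership \<open>|\<tau> + \<epsilon>| < \<epsilon>'\<close> bounds
  \<open>Re \<tau>\<close> by a multiple of \<open>s\<close> minus a multiple of
  \<open>|\<tau>|\<^sup>2\<close>, and the latter absorbs the quadratic error of \<open>r\<close>
  when \<open>\<epsilon>\<close> is small. The disc has essentially fixed size and only the gap at
  \<open>x\<close> shrinks with the depth, whence the coefficient 1/2.\<close>

theorem inner_discs:
  "\<exists>e>0. \<exists>K C. compact K \<and> K \<subseteq> D \<and> (\<forall>x\<in>D. infdist x (frontier D) < e \<longrightarrow>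
     (\<exists>\<phi> w. disc_into D \<phi> \<and> cmod w < 1 \<and> \<phi> w = x \<and> \<phi> 0 \<in> K \<and>
        poincare_dist 0 w \<le> - ln (infdist x (frontier D)) / 2 + C))"
proof -
  obtain e0 M1 M2 m where cc: "collar_constants e0 M1 M2 m" using collar_constants_exist by blast
  have pos: "e0 > 0" "M1 > 0" "M2 > 0" "m > 0" using cc by (auto simp: collar_constants_def)
  obtain e1 C1 where eC: "e1 > 0" "C1 > 0" "\<And>z. z \<in> D \<Longrightarrow> infdist z (frontier D) < e1 \<Longrightarrow>
      infdist z (frontier D) \<le> C1 * (- r z) \<and> (\<exists>v. norm v = 1 \<and> r' z v \<ge> m / 4)"
    using infdist_le_defining_function[OF cc] by blast
  \<comment> \<open>\<open>e0 / 8\<close> keeps displacements up to \<open>3 * \<epsilon>\<close> in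
    the collar; \<open>m / (8 * M2)\<close> gives \<open>2 * \<epsilon> * M2 \<le> g\<close>. The
    value of \<open>\<kappa>\<close> is dictated by \<open>g \<le> 2 * M1\<close> and
    \<open>\<epsilon>'\<^sup>2 - \<epsilon>\<^sup>2 \<le> 3 * \<epsilon> * (\<kappa> *
    s)\<close>.\<close>
  define \<epsilon> where "\<epsilon> = min (e0 / 8) (m / (8 * M2))"
  have eps: "\<epsilon> > 0" "\<epsilon> \<le> e0 / 8" "\<epsilon> \<le> m / (8 * M2)"
    using pos min.cobounded1[of "e0 / 8" "m / (8 * M2)"] min.cobounded2[of "e0 / 8" "m / (8 * M2)"]
    by (auto simp add: \<epsilon>_def simp del: min.cobounded1 min.cobounded2)
  define \<kappa> where "\<kappa> = 1 / (3 * M1)"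
  have kap: "\<kappa> > 0" using pos by (simp add: \<kappa>_def)
  define e where "e = Min {e1, e0 / 4, \<epsilon>}"
  have e: "e > 0" "e \<le> e1" "e \<le> e0 / 4" "e \<le> \<epsilon>" using pos eC eps by (auto simp: e_def)
  \<comment> \<open>Independent of \<open>x\<close>: all centres satisfy the same negative upper
    bound for \<open>r\<close>, so their distance from the base point can be bounded once and for
    all.\<close>
  define K where "K = {z \<in> {z. infdist z (frontier D) \<le> e0}. r z \<in> {.. - (m * \<epsilon> / 8)}}"
  have cK: "compact {z. infdist z (frontier D) \<le> e0}" "{z. infdist z (frontier D) \<le> e0} \<subseteq> U"
    using cc by (auto simp: collar_constants_def)
  have "closed K"
    using continuous_closed_preimage[OF continuous_on_subset[OF continuous_r cK(2)] compact_imp_closed[OF cK(1)] closed_atMost]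
    by (simp add: K_def vimage_def Int_def)
  moreover have "bounded K" by (rule bounded_subset[OF compact_imp_bounded[OF cK(1)]]) (auto simp: K_def)
  ultimately have compact_K: "compact K" by (simp add: compact_eq_bounded_closed)
  have KD: "K \<subseteq> D"
  proof
    fix z assume z: "z \<in> K"
    have "m * \<epsilon> / 8 > 0" using pos eps by simp
    then have "r z < 0" using z by (auto simp: K_def)
    moreover have "z \<in> U" using z cK(2) by (auto simp: K_def)
    ultimately show "z \<in> D" by (simp add: mem_D_iff)
  qed
  have "\<exists>\<phi> w. disc_into D \<phi> \<and> cmod w < 1 \<and> \<phi> w = x \<and> \<phi> 0 \<in> K \<and>
        poincare_dist 0 w \<le> - ln (infdist x (frontier D)) / 2 + ln (4 * \<epsilon> * C1 / \<kappa>) / 2"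
    if x: "x \<in> D" and xe: "infdist x (frontier D) < e" for x
  proof -
    obtain \<zeta> where zt: "\<zeta> \<in> frontier D" "infdist x (frontier D) = norm (x - \<zeta>)"
      by (rule nearest_frontier_point)
    have xc: "x \<in> cball \<zeta> e0" "\<zeta> \<in> cball \<zeta> e0" using zt xe e pos by (auto simp: dist_norm norm_minus_commute)
    have d: "infdist x (frontier D) > 0"
      by (rule infdist_pos_not_in_closed[OF frontier_closed frontier_D_nonempty])
         (use x open_D in \<open>simp add: frontier_def interior_open\<close>)
    define s where "s = - r x"
    have xU: "x \<in> U" by (rule collar_constantsD(1)[OF cc zt(1) xc])
    have s: "s > 0" using mem_D_iff[OF xU] x by (simp add: s_def)
    have ds: "infdist x (frontier D) \<le> C1 * s" using eC(3)[OF x] xe e(2) by (simp add: s_def)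
    have "s \<le> M1 * norm (x - \<zeta>)"
      using collar_constantsD(4)[OF cc zt(1) xc] r_frontier[OF zt(1)] by (simp add: s_def norm_minus_commute)
    also have "\<dots> \<le> M1 * \<epsilon>" using zt xe e pos by (intro mult_left_mono) auto
    finally have ks: "\<kappa> * s \<le> \<epsilon>" "\<kappa> * s > 0" using pos s eps kap by (auto simp: \<kappa>_def field_simps)
    obtain v0 where v0: "norm v0 = 1" "r' x v0 \<ge> m / 4" using eC(3)[OF x] xe e(2) by auto
    define W where "W = wirtinger (r' x) v0"
    define g where "g = cmod W"
    have gm: "g \<ge> m / 4"
      using v0(2) complex_Re_le_cmod[of W] by (simp add: W_def g_def wirtinger_def)
    then have g0: "g > 0" using pos by linarith
    have gM: "g \<le> 2 * M1"
      using norm_wirtinger_le[of "r' x" v0] v0(1) collar_constantsD(2)[OF cc zt(1) xc(1) xc(1)]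
      by (simp add: g_def W_def)
    \<comment> \<open>Rotates \<open>v0\<close> so that the complex-linear form is real and positive
      on \<open>v\<close>; then \<open>r' x (\<tau> *s v)\<close> is \<open>g * Re \<tau>\<close>
      for every complex \<open>\<tau>\<close>.\<close>
    define v where "v = (cnj W / of_real g) *s v0"
    have v: "norm v = 1" using v0(1) g0 by (simp add: v_def norm_complex_smult norm_divide g_def)
    have Wv: "wirtinger (r' x) v = of_real g"
    proof -
      have "wirtinger (r' x) v = cnj W * W / of_real g" by (simp add: v_def wirtinger_smult W_def)
      also have "cnj W * W = of_real (g\<^sup>2)"
        unfolding g_def using complex_norm_square[of W] by (simp add: mult.commute)
      finally show ?thesis using g0 by (simp add: power2_eq_square)
    qed
    have lin: "r' x (\<tau> *s v) = g * Re \<tau>" for \<tau>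
    proof -
      have "r' x (\<tau> *s v) = Re (wirtinger (r' x) (\<tau> *s v))" by (simp add: wirtinger_def)
      then show ?thesis by (simp add: wirtinger_smult Wv)
    qed
    have near: "x + \<tau> *s v \<in> cball \<zeta> e0" "r (x + \<tau> *s v) \<le> - s + g * Re \<tau> + M2 * (cmod \<tau>)\<^sup>2"
      if "cmod \<tau> \<le> 3 * \<epsilon>" for \<tau>
    proof -
      have n: "norm (\<tau> *s v) = cmod \<tau>" using v by (simp add: norm_complex_smult)
      have "norm ((x + \<tau> *s v) - \<zeta>) \<le> norm (x - \<zeta>) + norm (\<tau> *s v)"
        using norm_triangle_ineq[of "x - \<zeta>" "\<tau> *s v"] by (simp add: algebra_simps)
      then have "norm ((x + \<tau> *s v) - \<zeta>) \<le> e0" using that n zt xe e(3) eps(2) pos(1) by linarith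
      then show c: "x + \<tau> *s v \<in> cball \<zeta> e0" by (simp add: dist_norm norm_minus_commute)
      show "r (x + \<tau> *s v) \<le> - s + g * Re \<tau> + M2 * (cmod \<tau>)\<^sup>2"
        using collar_constantsD(6)[OF cc zt(1) xc(1) c] n lin[of \<tau>] by (simp add: s_def)
    qed
    define \<epsilon>' where "\<epsilon>' = \<epsilon> + \<kappa> * s"
    have eps': "\<epsilon>' > \<epsilon>" "\<epsilon>' \<le> 2 * \<epsilon>" using ks by (auto simp: \<epsilon>'_def)
    define \<phi> where "\<phi> l = x + (of_real \<epsilon>' * l - of_real \<epsilon>) *s v" for l
    have "\<phi> l \<in> D" if l: "cmod l < 1" for l
    proof -
      define \<tau> where "\<tau> = of_real \<epsilon>' * l - of_real \<epsilon>"
      have "cmod \<tau> \<le> cmod (of_real \<epsilon>' * l) + cmod (of_real \<epsilon>)" unfolding \<tau>_def by (rule norm_triangle_ineq4)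
      also have "\<dots> = \<epsilon>' * cmod l + \<epsilon>" using eps' eps by (simp add: norm_mult)
      also have "\<epsilon>' * cmod l \<le> \<epsilon>' * 1" using eps' eps l by (intro mult_left_mono) auto
      finally have t3: "cmod \<tau> \<le> 3 * \<epsilon>" using eps' by simp
      have "\<tau> + of_real \<epsilon> = of_real \<epsilon>' * l" by (simp add: \<tau>_def)
      then have "cmod (\<tau> + of_real \<epsilon>) < \<epsilon>'" using eps' eps l by (simp add: norm_mult)
      then have "(cmod (\<tau> + of_real \<epsilon>))\<^sup>2 < \<epsilon>'\<^sup>2" by (intro power_strict_mono) auto
      moreover have "(cmod (\<tau> + of_real \<epsilon>))\<^sup>2 = (cmod \<tau>)\<^sup>2 + 2 * \<epsilon> * Re \<tau> + \<epsilon>\<^sup>2"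
        unfolding cmod_power2 by (simp add: power2_eq_square algebra_simps)
      ultimately have "2 * \<epsilon> * Re \<tau> < \<epsilon>'\<^sup>2 - \<epsilon>\<^sup>2 - (cmod \<tau>)\<^sup>2" by linarith
      moreover have "\<epsilon>'\<^sup>2 - \<epsilon>\<^sup>2 \<le> 3 * \<epsilon> * (\<kappa> * s)"
      proof -
        have "(\<kappa> * s) * (\<kappa> * s) \<le> \<epsilon> * (\<kappa> * s)" using ks by (intro mult_right_mono) auto
        then show ?thesis by (simp add: \<epsilon>'_def power2_eq_square algebra_simps)
      qed
      ultimately have "2 * \<epsilon> * Re \<tau> < 3 * \<epsilon> * (\<kappa> * s) - (cmod \<tau>)\<^sup>2" by linarith
      then have "g * (2 * \<epsilon> * Re \<tau>) < g * (3 * \<epsilon> * (\<kappa> * s) - (cmod \<tau>)\<^sup>2)" using g0 by simp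
      moreover have "g * (3 * \<epsilon> * (\<kappa> * s)) \<le> 2 * M1 * (3 * \<epsilon> * (\<kappa> * s))"
        using gM eps kap s by (intro mult_right_mono mult_nonneg_nonneg) auto
      moreover have "2 * M1 * (3 * \<epsilon> * (\<kappa> * s)) = 2 * \<epsilon> * s" using pos by (simp add: \<kappa>_def)
      moreover have "2 * \<epsilon> * M2 * (cmod \<tau>)\<^sup>2 \<le> g * (cmod \<tau>)\<^sup>2"
      proof (rule mult_right_mono)
        have "\<epsilon> * M2 \<le> m / 8" using eps(3) pos by (simp add: field_simps)
        then show "2 * \<epsilon> * M2 \<le> g" using gm by simp
      qed simp
      moreover have "2 * \<epsilon> * (g * Re \<tau> + M2 * (cmod \<tau>)\<^sup>2) = g * (2 * \<epsilon> * Re \<tau>) + 2 * \<epsilon> * M2 * (cmod \<tau>)\<^sup>2"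
        by (simp add: algebra_simps)
      ultimately have "2 * \<epsilon> * (g * Re \<tau> + M2 * (cmod \<tau>)\<^sup>2) < 2 * \<epsilon> * s"
        unfolding right_diff_distrib by linarith
      then have "g * Re \<tau> + M2 * (cmod \<tau>)\<^sup>2 < s" using eps(1) by simp
      then have "r (x + \<tau> *s v) < 0" using near(2)[OF t3] by linarith
      moreover have "x + \<tau> *s v \<in> U" using collar_constantsD(1)[OF cc zt(1) near(1)[OF t3] xc(2)] .
      ultimately show ?thesis by (simp add: mem_D_iff \<phi>_def \<tau>_def)
    qed
    moreover have "(\<lambda>z. \<phi> z $ j) holomorphic_on ball 0 1" for j
      unfolding \<phi>_def by (auto intro!: holomorphic_intros)
    ultimately have "disc_into D \<phi>" unfolding disc_into_def by auto
    moreover define w where "w = complex_of_real (\<epsilon> / \<epsilon>')"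
    have nw: "cmod w = \<epsilon> / \<epsilon>'" using eps eps' by (simp add: w_def norm_divide)
    then have "cmod w < 1" using eps eps' by simp
    moreover have "\<phi> w = x" using eps eps' by (simp add: \<phi>_def w_def vec_eq_iff)
    moreover have "\<phi> 0 \<in> K"
    proof -
      let ?t = "- complex_of_real \<epsilon>"
      have t3: "cmod ?t \<le> 3 * \<epsilon>" using eps by simp
      have p0: "\<phi> 0 = x + ?t *s v" by (simp add: \<phi>_def)
      have "r (\<phi> 0) \<le> - s - g * \<epsilon> + M2 * \<epsilon>\<^sup>2" using near(2)[OF t3] eps unfolding p0 by simp
      moreover have "M2 * \<epsilon>\<^sup>2 \<le> m / 8 * \<epsilon>"
      proof -
        have "M2 * \<epsilon> \<le> m / 8" using eps(3) pos by (simp add: field_simps)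
        then have "M2 * \<epsilon> * \<epsilon> \<le> m / 8 * \<epsilon>" using eps by (intro mult_right_mono) auto
        then show ?thesis by (simp add: power2_eq_square mult.assoc)
      qed
      moreover have "m / 4 * \<epsilon> \<le> g * \<epsilon>" using gm eps by (intro mult_right_mono) auto
      ultimately have "r (\<phi> 0) \<le> - (m * \<epsilon> / 8)" using s by simp
      moreover have "infdist (\<phi> 0) (frontier D) \<le> e0"
        using near(1)[OF t3] infdist_le[OF zt(1), of "\<phi> 0"] unfolding p0 by (simp add: dist_commute)
      ultimately show ?thesis by (simp add: K_def)
    qed
    moreover have "poincare_dist 0 w \<le> - ln (infdist x (frontier D)) / 2 + ln (4 * \<epsilon> * C1 / \<kappa>) / 2"
    proof -
      define q where "q = \<epsilon> / \<epsilon>'"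
      have q: "0 < q" "q < 1" using eps eps' by (auto simp: q_def)
      have "1 - q = \<kappa> * s / \<epsilon>'" using eps eps' by (simp add: q_def \<epsilon>'_def field_simps)
      then have "(1 + q) / (1 - q) = (1 + q) * \<epsilon>' / (\<kappa> * s)" by simp
      also have "\<dots> \<le> 2 * (2 * \<epsilon>) / (\<kappa> * s)"
        using q eps eps' ks by (intro divide_right_mono mult_mono) auto
      also have "\<dots> = 4 * \<epsilon> * C1 / \<kappa> / (C1 * s)" using eC(2) by simp
      also have "\<dots> \<le> 4 * \<epsilon> * C1 / \<kappa> / infdist x (frontier D)"
        using ds d eps eC(2) kap s by (intro divide_left_mono mult_pos_pos divide_nonneg_pos mult_nonneg_nonneg) auto
      finally have "ln ((1 + q) / (1 - q)) \<le> ln (4 * \<epsilon> * C1 / \<kappa> / infdist x (frontier D))"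
        using q by (intro ln_mono) auto
      also have "\<dots> = ln (4 * \<epsilon> * C1 / \<kappa>) - ln (infdist x (frontier D))"
        using d eps eC(2) kap by (simp add: ln_div ln_mult)
      finally have "ln ((1 + q) / (1 - q)) \<le> ln (4 * \<epsilon> * C1 / \<kappa>) - ln (infdist x (frontier D))" .
      moreover have "poincare_dist 0 w = ln ((1 + q) / (1 - q)) / 2"
        unfolding poincare_dist_artanh artanh_norm_def using nw by (simp add: q_def)
      ultimately show ?thesis by simp
    qed
    ultimately show ?thesis by blast
  qed
  then show ?thesis using e(1) compact_K KD by blast
qed

end


section \<open>Nontangential boundary values of bounded holomorphic functions\<close>

text \<open>Cauchy's formula at \<open>z\<close> for \<open>k w (R\<^sup>2 - |z|\<^sup>2) / (R\<^sup>2 - cnj z w)\<close>.\<close>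

lemma poisson_formula_0:
  fixes k :: "complex \<Rightarrow> complex" and R :: real
  assumes k: "k holomorphic_on ball 0 1" and R: "R < 1" and z: "cmod z < R"
  shows "((\<lambda>t. k (R * cis t) * of_real ((R\<^sup>2 - (cmod z)\<^sup>2) / (cmod (R * cis t - z))\<^sup>2))
           has_integral (2 * pi * k z)) {0..2 * pi}"
proof -
  have R0: "R > 0" using z norm_ge_zero[of z] by linarith
  define f where "f = (\<lambda>w. k w * of_real (R\<^sup>2 - (cmod z)\<^sup>2) / (of_real (R\<^sup>2) - cnj z * w))"
  have nz: "of_real (R\<^sup>2) - cnj z * w \<noteq> 0" if "cmod w \<le> R" for w
  proof
    assume "of_real (R\<^sup>2) - cnj z * w = 0"
    then have "cnj z * w = of_real (R\<^sup>2)" by simp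
    then have "cmod (cnj z * w) = R\<^sup>2" by (metis norm_of_real abs_power2)
    then have "cmod z * cmod w = R * R" by (simp add: norm_mult power2_eq_square)
    moreover have "cmod z * cmod w \<le> cmod z * R" using that by (intro mult_left_mono) auto
    moreover have "cmod z * R < R * R" using z R0 by simp
    ultimately show False by simp
  qed
  have "f holomorphic_on cball 0 R"
    unfolding f_def using nz
    by (intro holomorphic_intros holomorphic_on_subset[OF k]) (use R in auto)
  then have "((\<lambda>u. f u / (u - z)) has_contour_integral (2 * of_real pi * \<i> * f z)) (circlepath 0 R)"
    by (rule Cauchy_integral_circlepath_simple) (use z in simp)
  then have "((\<lambda>t. f (R * cis t) / (R * cis t - z) * R * \<i> * cis t) has_integral (2 * of_real pi * \<i> * f z)) {0..2 * pi}"
    unfolding circlepath_def by (subst (asm) has_contour_integral_part_circlepath_iff) auto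
  moreover have "f z = k z"
  proof -
    have "cnj z * z = of_real ((cmod z)\<^sup>2)"
      using complex_norm_square[of z] by (simp add: mult.commute)
    then show ?thesis using nz[of z] z by (simp add: f_def)
  qed
  moreover have "f (R * cis t) / (R * cis t - z) * R * \<i> * cis t
      = \<i> * (k (R * cis t) * of_real ((R\<^sup>2 - (cmod z)\<^sup>2) / (cmod (R * cis t - z))\<^sup>2))" for t
  proof -
    define w where "w = R * cis t"
    have w: "cmod w = R" using R0 by (simp add: w_def norm_mult)
    have "w - z \<noteq> 0" using w z by auto
    have w0: "w \<noteq> 0" using w R0 by auto
    \<comment> \<open>On the circle \<open>R\<^sup>2 = w * cnj w\<close>, so the denominator of
      \<open>f\<close> supplies the conjugate factor that completes \<open>w - z\<close> to
      \<open>(cmod (w - z))\<^sup>2\<close>.\<close>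
    have "of_real (R\<^sup>2) = w * cnj w" using w by (simp add: complex_norm_square[symmetric])
    then have e: "of_real (R\<^sup>2) - cnj z * w = w * cnj (w - z)" by (simp add: algebra_simps)
    have "f w / (w - z) * \<i> * w = \<i> * (k w * of_real (R\<^sup>2 - (cmod z)\<^sup>2) / ((w - z) * cnj (w - z)))"
      unfolding f_def e using w0 by (simp add: mult_ac)
    also have "(w - z) * cnj (w - z) = of_real ((cmod (w - z))\<^sup>2)"
      by (rule complex_norm_square[symmetric])
    finally show ?thesis by (simp add: w_def mult_ac)
  qed
  ultimately have "((\<lambda>t. \<i> * (k (R * cis t) * of_real ((R\<^sup>2 - (cmod z)\<^sup>2) / (cmod (R * cis t - z))\<^sup>2)))
      has_integral (2 * of_real pi * \<i> * k z)) {0..2 * pi}"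
    by simp
  from has_integral_mult_right[OF this, of "- \<i>"] show ?thesis
    by (simp add: mult.assoc[symmetric]) (simp add: mult_ac)
qed

text \<open>Centring the interval at \<open>\<theta>\<close> makes
  \<open>|t - \<theta>| \<le> pi\<close> available for the kernel bound. It is achieved by rotating
  the function by \<open>- cis \<theta>\<close>.\<close>

lemma poisson_formula:
  fixes k :: "complex \<Rightarrow> complex" and R :: real
  assumes k: "k holomorphic_on ball 0 1" and R: "R < 1" and z: "cmod z < R"
  shows "((\<lambda>t. k (R * cis t) * of_real ((R\<^sup>2 - (cmod z)\<^sup>2) / (cmod (R * cis t - z))\<^sup>2))
           has_integral (2 * pi * k z)) {\<theta> - pi..\<theta> + pi}"
proof -
  define e where "e = - cis \<theta>"
  have e: "cmod e = 1" "e * cnj e = 1" "e * (cnj e * w) = w" for w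
    by (auto simp: e_def cis_cnj cis_mult mult.assoc[symmetric])
  have h: "(\<lambda>w. k (e * w)) holomorphic_on ball 0 1"
    by (rule holomorphic_on_compose_gen[OF _ k, unfolded o_def])
       (use e in \<open>auto intro!: holomorphic_intros simp: norm_mult\<close>)
  have "cmod (cnj e * z) < R" using z e by (simp add: norm_mult)
  from poisson_formula_0[OF h R this]
  have "((\<lambda>t. k (e * (R * cis t)) * of_real ((R\<^sup>2 - (cmod z)\<^sup>2) / (cmod (R * cis t - cnj e * z))\<^sup>2))
      has_integral (2 * pi * k z)) {0..2 * pi}"
    using e by (simp add: norm_mult)
  moreover have "e * (R * cis t) = R * cis (\<theta> - pi + t)" for t
    by (simp add: e_def cis_mult[symmetric] cis_divide[symmetric])
  moreover have "cmod (R * cis t - cnj e * z) = cmod (R * cis (\<theta> - pi + t) - z)" for t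
  proof -
    have "cmod (R * cis t - cnj e * z) = cmod (e * (R * cis t - cnj e * z))" using e by (simp add: norm_mult)
    also have "e * (R * cis t - cnj e * z) = R * cis (\<theta> - pi + t) - z"
      using e(3)[of z] calculation by (simp add: right_diff_distrib \<open>\<And>t. e * (R * cis t) = R * cis (\<theta> - pi + t)\<close>)
    finally show ?thesis .
  qed
  ultimately show ?thesis
    using has_integral_shift_Icc_real[of "\<lambda>t. k (R * cis t) * of_real ((R\<^sup>2 - (cmod z)\<^sup>2) / (cmod (R * cis t - z))\<^sup>2)"
        "\<theta> - pi" "2 * pi * k z" 0 "2 * pi"]
    by (simp add: o_def add.commute)
qed

section \<open>Domination of nontangential values by a maximal function\<close>

lemma abs_le_cis_minus_one:
  assumes "\<bar>s\<bar> \<le> pi" shows "\<bar>s\<bar> \<le> 3 * cmod (cis s - 1)"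
proof -
  \<comment> \<open>Concavity would give the slope \<open>2 / pi\<close>; the weaker
    \<open>1 / 3\<close> follows from the mean value theorem up to \<open>pi / 3\<close> and from
    \<open>sin x \<ge> 4 / 5\<close> beyond.\<close>
  have sin: "x / 3 \<le> sin x" if x: "0 \<le> x" "x \<le> pi / 2" for x :: real
  proof (cases "x \<le> pi / 3")
    case True
    have "\<exists>y. 0 \<le> y \<and> y \<le> x \<and> sin x - sin 0 = (x - 0) * cos y"
    proof (cases "x = 0")
      case False
      then have "0 < x" using x by simp
      then obtain y where "0 < y" "y < x" "sin x - sin 0 = (x - 0) * cos y"
        using MVT2[of 0 x sin cos] by (auto intro: DERIV_sin)
      then show ?thesis by (intro exI[of _ y]) auto
    qed auto
    then obtain y where y: "0 \<le> y" "y \<le> x" "sin x = x * cos y" by auto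
    have "cos y \<ge> cos (pi / 3)" using y x True by (intro cos_monotone_0_pi_le) auto
    then have "cos y \<ge> 1 / 3" by (simp add: cos_60)
    then have "x * (1 / 3) \<le> x * cos y" using x by (intro mult_left_mono) auto
    then show ?thesis using y by simp
  next
    case False
    have "sin (pi / 3) \<le> sin x" using False x by (intro sin_monotone_2pi_le) auto
    moreover have "sin (pi / 3) \<ge> 4 / 5"
      unfolding sin_60 using real_le_rsqrt[of "8/5" 3] by (simp add: power2_eq_square)
    moreover have "x / 3 \<le> 4 / 6" using x pi_less_4 by simp
    ultimately show ?thesis by simp
  qed
  have "(cmod (cis s - 1))\<^sup>2 = (2 * \<bar>sin (s / 2)\<bar>)\<^sup>2"
  proof -
    have c: "cos s = 1 - 2 * (sin (s / 2))\<^sup>2" using cos_double_sin[of "s / 2"] by simp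
    have "(cmod (cis s - 1))\<^sup>2 = (cos s - 1)\<^sup>2 + (sin s)\<^sup>2" by (simp add: cmod_power2)
    also have "\<dots> = ((cos s)\<^sup>2 + (sin s)\<^sup>2) + 1 - 2 * cos s" by (simp add: power2_eq_square algebra_simps)
    also have "\<dots> = 4 * (sin (s / 2))\<^sup>2" by (subst sin_cos_squared_add2) (simp add: c)
    finally show ?thesis by (simp add: power_mult_distrib)
  qed
  then have "cmod (cis s - 1) = 2 * \<bar>sin (s / 2)\<bar>" by (rule power2_eq_imp_eq) auto
  moreover have "\<bar>sin (s / 2)\<bar> = \<bar>sin (\<bar>s\<bar> / 2)\<bar>" by (simp add: abs_if)
  moreover have "\<bar>s\<bar> / 2 / 3 \<le> sin (\<bar>s\<bar> / 2)" using assms by (intro sin) auto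
  ultimately show ?thesis by linarith
qed

text \<open>Nontangentiality enters here: \<open>R * cis \<theta>\<close> lies within a multiple of
  \<open>d = R - cmod z\<close> of \<open>z\<close>. As \<open>cmod (R * cis t - z)\<close> is at
  least \<open>d\<close>, up to constants it dominates \<open>|t - \<theta>|\<close> too, by the
  triangle inequality. The lower bound for \<open>R\<close> makes \<open>1 - cmod z\<close>
  comparable to \<open>d\<close>.\<close>

lemma poisson_kernel_bound:
  fixes R C t :: real
  assumes C: "C > 1" and z: "cmod (z - cis \<theta>) < C * (1 - cmod z)"
    and R: "(1 + cmod z) / 2 \<le> R" "R < 1" and t: "\<bar>t - \<theta>\<bar> \<le> pi"
  shows "(R\<^sup>2 - (cmod z)\<^sup>2) / (cmod (R * cis t - z))\<^sup>2
    \<le> 2 * (R - cmod z) * (18 * (2 * C + 3))\<^sup>2 / (max (R - cmod z) \<bar>t - \<theta>\<bar>)\<^sup>2"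
proof -
  define d where "d = R - cmod z"
  define K where "K = 18 * (2 * C + 3)"
  define D where "D = cmod (R * cis t - z)"
  have "0 < C * (1 - cmod z)" using z norm_ge_zero[of "z - cis \<theta>"] by linarith
  then have z1: "cmod z < 1" using C by (simp add: zero_less_mult_iff)
  have "R \<ge> 1/2" using R(1) norm_ge_zero[of z] unfolding add_divide_distrib by linarith
  then have d: "d > 0" "1 - cmod z \<le> 2 * d" "1 - R \<le> 2 * d" "R > 0" "R \<ge> 1/2"
    using R z1 by (auto simp: d_def)
  have K: "K > 1" using C by (simp add: K_def)
  have Rt: "cmod (R * cis t) = R" using d by (simp add: norm_mult)
  have D1: "D \<ge> d" unfolding D_def d_def using norm_triangle_ineq2[of "R * cis t" z] Rt by simp
  have "cmod (R * cis \<theta> - z) \<le> cmod (R * cis \<theta> - cis \<theta>) + cmod (cis \<theta> - z)"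
    using norm_triangle_ineq[of "R * cis \<theta> - cis \<theta>" "cis \<theta> - z"] by simp
  also have "cmod (R * cis \<theta> - cis \<theta>) = 1 - R"
  proof -
    have "R * cis \<theta> - cis \<theta> = of_real (R - 1) * cis \<theta>" by (simp add: algebra_simps)
    then show ?thesis using R by (simp only: norm_mult norm_of_real) simp
  qed
  also have "cmod (cis \<theta> - z) \<le> C * (2 * d)"
  proof -
    have "C * (1 - cmod z) \<le> C * (2 * d)" using d C by (intro mult_left_mono) auto
    then show ?thesis using z by (simp add: norm_minus_commute)
  qed
  finally have D2: "cmod (R * cis \<theta> - z) \<le> (2 * C + 2) * d" using d by (simp add: algebra_simps)
  have "R * cis t - R * cis \<theta> = of_real R * cis \<theta> * (cis (t - \<theta>) - 1)"
    by (simp add: algebra_simps cis_mult)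
  then have "cmod (R * cis t - R * cis \<theta>) = R * cmod (cis (t - \<theta>) - 1)" using d by (simp add: norm_mult)
  moreover have "1 / 2 * cmod (cis (t - \<theta>) - 1) \<le> R * cmod (cis (t - \<theta>) - 1)"
    using d by (intro mult_right_mono) auto
  ultimately have "\<bar>t - \<theta>\<bar> \<le> 6 * cmod (R * cis t - R * cis \<theta>)"
    using abs_le_cis_minus_one[OF t] by linarith
  also have "cmod (R * cis t - R * cis \<theta>) \<le> D + cmod (R * cis \<theta> - z)"
    unfolding D_def using norm_triangle_ineq4[of "R * cis t - z" "R * cis \<theta> - z"] by simp
  also have "\<dots> \<le> D + (2 * C + 2) * D"
  proof -
    have "(2 * C + 2) * d \<le> (2 * C + 2) * D" using D1 C by (intro mult_left_mono) auto
    then show ?thesis using D2 by linarith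
  qed
  finally have "\<bar>t - \<theta>\<bar> \<le> K * D"
    using D1 d C by (simp add: K_def algebra_simps)
  moreover have "d \<le> K * D"
    using mult_right_mono[of 1 K D] K D1 d by linarith
  ultimately have m: "max d \<bar>t - \<theta>\<bar> \<le> K * D" "max d \<bar>t - \<theta>\<bar> > 0" using d by auto
  have "(R\<^sup>2 - (cmod z)\<^sup>2) = d * (R + cmod z)" by (simp add: d_def power2_eq_square algebra_simps)
  also have "\<dots> \<le> d * 2" using d R z1 by (intro mult_left_mono) auto
  finally have "(R\<^sup>2 - (cmod z)\<^sup>2) / D\<^sup>2 \<le> 2 * d / D\<^sup>2"
    by (intro divide_right_mono) auto
  also have "\<dots> = 2 * d * K\<^sup>2 / (K * D)\<^sup>2" using K by (simp add: power_mult_distrib)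
  also have "\<dots> \<le> 2 * d * K\<^sup>2 / (max d \<bar>t - \<theta>\<bar>)\<^sup>2"
    using m d K D1 by (intro divide_left_mono power_mono mult_pos_pos zero_less_power) auto
  finally show ?thesis by (simp add: d_def K_def D_def)
qed

text \<open>A measure on the line rather than on the circle, so that a covering lemma for intervals
  applies. The square is chosen because Parseval's identity controls it.\<close>

definition circle_energy :: "(complex \<Rightarrow> complex) \<Rightarrow> real \<Rightarrow> real measure" where
  "circle_energy k R = density lborel (\<lambda>t. ennreal ((cmod (k (R * cis t)))\<^sup>2))"

lemma continuous_on_circle:
  fixes k :: "complex \<Rightarrow> complex" and R :: real
  assumes "k holomorphic_on ball 0 1" "0 \<le> R" "R < 1"
  shows "continuous_on S (\<lambda>t. k (R * cis t))"
  by (rule continuous_on_compose2[OF holomorphic_on_imp_continuous_on[OF assms(1)]])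
     (use assms in \<open>auto intro!: continuous_intros simp: norm_mult\<close>)

text \<open>The Poisson formula for the holomorphic function \<open>k\<^sup>2\<close>, with absolute
  values taken under the integral, expresses the subharmonicity of
  \<open>|k|\<^sup>2\<close>.\<close>

lemma poisson_energy_bound:
  fixes k :: "complex \<Rightarrow> complex" and R :: real
  assumes k: "k holomorphic_on ball 0 1" and R: "R < 1" and z: "cmod z < R"
  shows "ennreal (2 * pi * (cmod (k z))\<^sup>2) \<le>
    (\<integral>\<^sup>+t. ennreal ((R\<^sup>2 - (cmod z)\<^sup>2) / (cmod (R * cis t - z))\<^sup>2) * indicator {\<theta> - pi..\<theta> + pi} t \<partial>circle_energy k R)"
proof -
  have R0: "R > 0" using z norm_ge_zero[of z] by linarith
  define P where "P t = (R\<^sup>2 - (cmod z)\<^sup>2) / (cmod (R * cis t - z))\<^sup>2" for t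
  have nz: "R * cis t - z \<noteq> 0" for t
  proof
    assume "R * cis t - z = 0"
    then have "cmod z = cmod (R * cis t)" by simp
    then show False using z R0 by (simp add: norm_mult)
  qed
  have P0: "P t \<ge> 0" for t
    unfolding P_def using z by (intro divide_nonneg_nonneg) (auto intro: power_mono)
  have cP: "continuous_on S P" for S
    unfolding P_def using nz by (intro continuous_intros) auto
  have ck: "continuous_on S (\<lambda>t. k (R * cis t))" for S
    by (rule continuous_on_circle[OF k]) (use R R0 in auto)
  have "(\<lambda>w. (k w)\<^sup>2) holomorphic_on ball 0 1" by (intro holomorphic_intros k)
  from poisson_formula[OF this R z]
  have I: "((\<lambda>t. (k (R * cis t))\<^sup>2 * of_real (P t)) has_integral (2 * pi * (k z)\<^sup>2)) {\<theta> - pi..\<theta> + pi}"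
    by (simp add: P_def)
  define g where "g t = (cmod (k (R * cis t)))\<^sup>2 * P t" for t
  have g: "(g has_integral (integral {\<theta> - pi..\<theta> + pi} g)) {\<theta> - pi..\<theta> + pi}"
    unfolding g_def
    by (intro integrable_integral integrable_continuous_interval continuous_intros ck cP)
  have "2 * pi * (cmod (k z))\<^sup>2 = cmod (2 * pi * (k z)\<^sup>2)" by (simp add: norm_mult norm_power)
  also have "2 * pi * (k z)\<^sup>2 = integral {\<theta> - pi..\<theta> + pi} (\<lambda>t. (k (R * cis t))\<^sup>2 * of_real (P t))"
    using I by (rule integral_unique[symmetric])
  also have "cmod \<dots> \<le> integral {\<theta> - pi..\<theta> + pi} g"
    using I g by (intro integral_norm_bound_integral) (auto simp: g_def norm_mult norm_power P0 has_integral_integrable)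
  finally have "ennreal (2 * pi * (cmod (k z))\<^sup>2) \<le> ennreal (integral {\<theta> - pi..\<theta> + pi} g)"
    by (rule ennreal_leI)
  also have "\<dots> = (\<integral>\<^sup>+t. ennreal (g t) * indicator {\<theta> - pi..\<theta> + pi} t \<partial>lborel)"
    by (rule nn_integral_has_integral_lebesgue'[symmetric, OF _ g]) (simp add: g_def P0)
  also have "\<dots> = (\<integral>\<^sup>+t. ennreal ((cmod (k (R * cis t)))\<^sup>2) * (ennreal (P t) * indicator {\<theta> - pi..\<theta> + pi} t) \<partial>lborel)"
    by (intro nn_integral_cong) (simp add: g_def ennreal_mult P0 mult.assoc)
  also have "\<dots> = (\<integral>\<^sup>+t. ennreal (P t) * indicator {\<theta> - pi..\<theta> + pi} t \<partial>circle_energy k R)"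
  proof -
    have [measurable]: "P \<in> borel_measurable borel" "(\<lambda>t. k (R * cis t)) \<in> borel_measurable borel"
      by (intro borel_measurable_continuous_onI ck cP)+
    show ?thesis
      unfolding circle_energy_def by (intro nn_integral_density[symmetric]) measurable
  qed
  finally show ?thesis by (simp add: P_def)
qed

lemma inverse_square_dyadic:
  fixes d s :: real
  assumes d: "d > 0" and s: "s \<ge> 0" "s \<le> 2 ^ n * d"
  shows "1 / (max d s)\<^sup>2 \<le> (\<Sum>j\<le>n. 4 / (2 ^ j * d)\<^sup>2 * (if s \<le> 2 ^ j * d then 1 else 0))"
proof -
  have "\<exists>j\<le>n. s \<le> 2 ^ j * d \<and> 1 / (max d s)\<^sup>2 \<le> 4 / (2 ^ j * d)\<^sup>2"
  proof (cases "s \<le> d")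
    case True
    then show ?thesis using d by (intro exI[of _ 0]) (simp add: max_def divide_right_mono)
  next
    case False
    define j where "j = (LEAST j. s \<le> 2 ^ j * d)"
    have j: "s \<le> 2 ^ j * d" unfolding j_def by (rule LeastI[of _ n]) (rule s)
    have jn: "j \<le> n" unfolding j_def by (rule Least_le) (rule s)
    have "j \<noteq> 0" using j False by (cases j) auto
    then obtain i where i: "j = Suc i" using not0_implies_Suc by blast
    have "\<not> s \<le> 2 ^ i * d" using not_less_Least[of i "\<lambda>j. s \<le> 2 ^ j * d"] i by (simp add: j_def)
    then have "2 ^ j * d / 2 \<le> max d s" by (simp add: i)
    then have "(2 ^ j * d / 2)\<^sup>2 \<le> (max d s)\<^sup>2" using d by (intro power_mono) auto
    then have "1 / (max d s)\<^sup>2 \<le> 1 / (2 ^ j * d / 2)\<^sup>2"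
      using d by (intro divide_left_mono mult_pos_pos zero_less_power) auto
    also have "\<dots> = 4 / (2 ^ j * d)\<^sup>2" by (simp add: power_divide)
    finally show ?thesis using j jn by blast
  qed
  then obtain j where j: "j \<le> n" "s \<le> 2 ^ j * d" "1 / (max d s)\<^sup>2 \<le> 4 / (2 ^ j * d)\<^sup>2" by blast
  have "4 / (2 ^ j * d)\<^sup>2 = 4 / (2 ^ j * d)\<^sup>2 * (if s \<le> 2 ^ j * d then 1 else 0)" using j by simp
  also have "\<dots> \<le> (\<Sum>j\<le>n. 4 / (2 ^ j * d)\<^sup>2 * (if s \<le> 2 ^ j * d then 1 else 0))"
    using j by (intro member_le_sum) auto
  finally show ?thesis using j by linarith
qed

text \<open>The kernel is majorised by indicators of dyadic intervals about \<open>\<theta>\<close>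
  with heights proportional to \<open>1 / 4 ^ j\<close>, while the hypothesis bounds their energies
  by multiples of \<open>2 ^ j\<close>; the resulting geometric series has a bound independent of
  \<open>z\<close>.\<close>

lemma nontangential_value_le_maximal:
  fixes k :: "complex \<Rightarrow> complex" and R :: real
  assumes k: "k holomorphic_on ball 0 1" and C: "C > 1" and z: "cmod (z - cis \<theta>) < C * (1 - cmod z)"
    and R: "(1 + cmod z) / 2 \<le> R" "R < 1" and L: "L \<ge> 0"
    and M: "\<And>r. 0 < r \<Longrightarrow> r \<le> pi \<Longrightarrow> emeasure (circle_energy k R) {\<theta> - r..\<theta> + r} \<le> ennreal (L * r)"
  shows "2 * pi * (cmod (k z))\<^sup>2 \<le> 16 * (18 * (2 * C + 3))\<^sup>2 * L"
proof -
  define d where "d = R - cmod z"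
  define K where "K = 18 * (2 * C + 3)"
  have "0 < C * (1 - cmod z)" using z norm_ge_zero[of "z - cis \<theta>"] by linarith
  then have z1: "cmod z < 1" using C by (simp add: zero_less_mult_iff)
  have zR: "cmod z < R" and d: "d > 0" using R z1 by (auto simp: d_def)
  have "\<exists>n. pi / d < 2 ^ n" by (rule real_arch_pow) simp
  then obtain n where n: "pi < 2 ^ n * d" using d by (auto simp: field_simps)
  \<comment> \<open>Cut off at \<open>pi\<close> because the hypothesis \<open>M\<close> speaks only
    of such radii; for \<open>t\<close> in the interval of integration the indicators stay the
    same.\<close>
  define r where "r j = min pi (2 ^ j * d)" for j :: nat
  define a where "a j = 8 * K\<^sup>2 / (4 ^ j * d)" for j :: nat
  have a0: "a j \<ge> 0" for j using d by (simp add: a_def)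
  have r0: "0 < r j" "r j \<le> pi" for j using d by (auto simp: r_def)
  let ?P = "\<lambda>t. (R\<^sup>2 - (cmod z)\<^sup>2) / (cmod (R * cis t - z))\<^sup>2"
  have pt: "?P t * (if t \<in> {\<theta> - pi..\<theta> + pi} then 1 else 0)
      \<le> (\<Sum>j\<le>n. a j * (if t \<in> {\<theta> - r j..\<theta> + r j} then 1 else 0))" for t
  proof (cases "t \<in> {\<theta> - pi..\<theta> + pi}")
    case True
    then have t: "\<bar>t - \<theta>\<bar> \<le> pi" by (auto simp: abs_if)
    have "?P t \<le> 2 * d * K\<^sup>2 * (1 / (max d \<bar>t - \<theta>\<bar>)\<^sup>2)"
      using poisson_kernel_bound[OF C z R t] by (simp add: d_def K_def)
    also have "\<dots> \<le> 2 * d * K\<^sup>2 * (\<Sum>j\<le>n. 4 / (2 ^ j * d)\<^sup>2 * (if \<bar>t - \<theta>\<bar> \<le> 2 ^ j * d then 1 else 0))"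
      using d t n by (intro mult_left_mono inverse_square_dyadic) auto
    also have "\<dots> = (\<Sum>j\<le>n. a j * (if \<bar>t - \<theta>\<bar> \<le> 2 ^ j * d then 1 else 0))"
      unfolding sum_distrib_left
    proof (rule sum.cong[OF refl])
      fix j
      have "(2 ^ j * d)\<^sup>2 = 4 ^ j * d * d"
        by (simp add: power_mult_distrib power2_eq_square flip: power_mult_distrib)
      then show "2 * d * K\<^sup>2 * (4 / (2 ^ j * d)\<^sup>2 * (if \<bar>t - \<theta>\<bar> \<le> 2 ^ j * d then 1 else 0))
          = a j * (if \<bar>t - \<theta>\<bar> \<le> 2 ^ j * d then 1 else 0)"
        using d by (simp add: a_def)
    qed
    also have "\<dots> = (\<Sum>j\<le>n. a j * (if t \<in> {\<theta> - r j..\<theta> + r j} then 1 else 0))"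
      using t by (intro sum.cong refl arg_cong2[where f="(*)"] if_cong) (auto simp: r_def abs_if split: if_splits)
    finally show ?thesis using True by simp
  next
    case False
    then show ?thesis using a0 by (subst if_not_P) (auto intro!: sum_nonneg)
  qed
  have pt': "ennreal (?P t) * indicator {\<theta> - pi..\<theta> + pi} t
      \<le> (\<Sum>j\<le>n. ennreal (a j) * indicator {\<theta> - r j..\<theta> + r j} t)" for t
  proof -
    have "ennreal (?P t) * indicator {\<theta> - pi..\<theta> + pi} t = ennreal (?P t * (if t \<in> {\<theta> - pi..\<theta> + pi} then 1 else 0))"
      by simp
    also have "\<dots> \<le> ennreal (\<Sum>j\<le>n. a j * (if t \<in> {\<theta> - r j..\<theta> + r j} then 1 else 0))"
      by (rule ennreal_leI[OF pt])
    also have "\<dots> = (\<Sum>j\<le>n. ennreal (a j * (if t \<in> {\<theta> - r j..\<theta> + r j} then 1 else 0)))"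
      using a0 by (intro sum_ennreal[symmetric]) auto
    also have "\<dots> = (\<Sum>j\<le>n. ennreal (a j) * indicator {\<theta> - r j..\<theta> + r j} t)"
      by (intro sum.cong refl) auto
    finally show ?thesis .
  qed
  have "ennreal (2 * pi * (cmod (k z))\<^sup>2)
      \<le> (\<integral>\<^sup>+t. ennreal (?P t) * indicator {\<theta> - pi..\<theta> + pi} t \<partial>circle_energy k R)"
    by (rule poisson_energy_bound[OF k R(2) zR])
  also have "\<dots> \<le> (\<integral>\<^sup>+t. (\<Sum>j\<le>n. ennreal (a j) * indicator {\<theta> - r j..\<theta> + r j} t) \<partial>circle_energy k R)"
    by (intro nn_integral_mono pt')
  also have "\<dots> = (\<Sum>j\<le>n. ennreal (a j) * emeasure (circle_energy k R) {\<theta> - r j..\<theta> + r j})"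
    by (subst nn_integral_sum) (auto simp: nn_integral_cmult_indicator circle_energy_def)
  also have "\<dots> \<le> (\<Sum>j\<le>n. ennreal (a j) * ennreal (L * r j))"
    using r0 by (intro sum_mono mult_left_mono M) auto
  also have "\<dots> = ennreal (\<Sum>j\<le>n. a j * (L * r j))"
    using a0 L r0 by (subst sum_ennreal[symmetric]) (auto simp: ennreal_mult less_imp_le)
  finally have "2 * pi * (cmod (k z))\<^sup>2 \<le> (\<Sum>j\<le>n. a j * (L * r j))"
    using a0 L r0 by (subst (asm) ennreal_le_iff) (auto intro!: sum_nonneg mult_nonneg_nonneg simp: less_imp_le)
  also have "\<dots> \<le> (\<Sum>j\<le>n. 8 * K\<^sup>2 * L * (1 / 2) ^ j)"
  proof (rule sum_mono)
    fix j
    have "a j * (L * r j) \<le> a j * (L * (2 ^ j * d))"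
      using a0 L by (intro mult_left_mono) (auto simp: r_def)
    also have "\<dots> = 8 * K\<^sup>2 * L * (2 ^ j / 4 ^ j)" using d by (simp add: a_def)
    also have "(2::real) ^ j / 4 ^ j = (1 / 2) ^ j" by (simp flip: power_divide)
    finally show "a j * (L * r j) \<le> 8 * K\<^sup>2 * L * (1 / 2) ^ j" .
  qed
  also have "\<dots> = 8 * K\<^sup>2 * L * (\<Sum>j\<le>n. (1 / 2) ^ j)" by (simp add: sum_distrib_left)
  also have "(\<Sum>j\<le>n. (1 / 2 :: real) ^ j) = 2 - (1 / 2) ^ n"
    by (induction n) auto
  then have "(\<Sum>j\<le>n. (1 / 2 :: real) ^ j) \<le> 2" by simp
  then have "8 * K\<^sup>2 * L * (\<Sum>j\<le>n. (1 / 2) ^ j) \<le> 8 * K\<^sup>2 * L * 2"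
    using L by (intro mult_left_mono) auto
  finally show ?thesis by (simp add: K_def)
qed


section \<open>A weak type estimate by covering\<close>

lemma emeasure_UN_countable_le_finite:
  assumes I: "countable I" and X: "\<And>i. i \<in> I \<Longrightarrow> X i \<in> sets M"
    and fin: "\<And>F. finite F \<Longrightarrow> F \<subseteq> I \<Longrightarrow> emeasure M (\<Union>i\<in>F. X i) \<le> A"
  shows "emeasure M (\<Union>i\<in>I. X i) \<le> A"
proof (cases "I = {}")
  case False
  define G where "G n = (\<Union>i\<in>from_nat_into I ` {..<n}. X i)" for n
  have sub: "from_nat_into I ` S \<subseteq> I" for S using from_nat_into[OF False] by auto
  have "range G \<subseteq> sets M"
    unfolding G_def using X sub by (auto intro!: sets.finite_UN)
  moreover have "incseq G" unfolding G_def by (intro incseq_SucI UN_mono) auto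
  ultimately have "(SUP n. emeasure M (G n)) = emeasure M (\<Union>n. G n)" by (rule SUP_emeasure_incseq)
  moreover have "(\<Union>n. G n) = (\<Union>i\<in>I. X i)"
  proof
    show "(\<Union>n. G n) \<subseteq> (\<Union>i\<in>I. X i)" unfolding G_def using sub by blast
    show "(\<Union>i\<in>I. X i) \<subseteq> (\<Union>n. G n)"
    proof
      fix x assume "x \<in> (\<Union>i\<in>I. X i)"
      then obtain i where i: "i \<in> I" "x \<in> X i" by blast
      then have "from_nat_into I (to_nat_on I i) = i" using I by simp
      then have "x \<in> G (Suc (to_nat_on I i))" using i unfolding G_def by force
      then show "x \<in> (\<Union>n. G n)" by blast
    qed
  qed
  moreover have "(SUP n. emeasure M (G n)) \<le> A"
    unfolding G_def using sub by (intro SUP_least fin) auto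
  ultimately show ?thesis by simp
qed simp

text \<open>By Vitali's covering lemma the intervals with too much mass can be thinned out to
  disjoint ones, whose radii sum to at most \<open>A / L\<close>, and whose fivefold enlargements,
  of length \<open>10 * r\<close>, cover \<open>S\<close>. The window \<open>{-pi..3 * pi}\<close>
  holds all intervals about points of \<open>{0..2 * pi}\<close>. The Borel cover \<open>W\<close>
  avoids the question whether \<open>S\<close> is measurable.\<close>

lemma maximal_weak_type:
  fixes \<nu> :: "real measure" and L A :: real
  assumes sets_nu: "sets \<nu> = sets borel" and L: "L > 0" and A0: "A \<ge> 0"
    and A: "emeasure \<nu> {-pi..3 * pi} \<le> ennreal A"
  defines "S \<equiv> {\<theta>\<in>{0..2 * pi}. \<exists>r. 0 < r \<and> r \<le> pi \<and> \<not> emeasure \<nu> {\<theta> - r..\<theta> + r} \<le> ennreal (L * r)}"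
  shows "\<exists>W\<in>sets borel. S \<subseteq> W \<and> emeasure lborel W \<le> ennreal (10 * A / L)"
proof -
  have "\<exists>r. \<forall>\<theta>\<in>S. 0 < r \<theta> \<and> r \<theta> \<le> pi \<and> \<not> emeasure \<nu> {\<theta> - r \<theta>..\<theta> + r \<theta>} \<le> ennreal (L * r \<theta>)"
    unfolding S_def by (intro bchoice) blast
  then obtain r where r: "\<And>\<theta>. \<theta> \<in> S \<Longrightarrow> 0 < r \<theta>" "\<And>\<theta>. \<theta> \<in> S \<Longrightarrow> r \<theta> \<le> pi"
    "\<And>\<theta>. \<theta> \<in> S \<Longrightarrow> \<not> emeasure \<nu> {\<theta> - r \<theta>..\<theta> + r \<theta>} \<le> ennreal (L * r \<theta>)" by blast
  obtain C where C: "countable C" "C \<subseteq> S" "pairwise (\<lambda>i j. disjnt (cball i (r i)) (cball j (r j))) C"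
    "\<And>i. i \<in> S \<Longrightarrow> \<exists>j. j \<in> C \<and> \<not> disjnt (cball i (r i)) (cball j (r j)) \<and> cball i (r i) \<subseteq> ball j (5 * r j)"
    using Vitali_covering_lemma_cballs_balls[of S r pi id] r(1,2) by auto
  define W where "W = (\<Union>j\<in>C. ball j (5 * r j))"
  have "S \<subseteq> W"
  proof
    fix x assume x: "x \<in> S"
    then obtain j where "j \<in> C" "cball x (r x) \<subseteq> ball j (5 * r j)" using C(4) by blast
    moreover have "x \<in> cball x (r x)" using r(1)[OF x] by simp
    ultimately show "x \<in> W" unfolding W_def by blast
  qed
  moreover have "W \<in> sets borel" unfolding W_def by (intro borel_open open_UN) auto
  moreover have "emeasure lborel W \<le> ennreal (10 * A / L)"
    unfolding W_def
  proof (rule emeasure_UN_countable_le_finite[OF C(1)])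
    fix F assume F: "finite F" "F \<subseteq> C"
    have FS: "F \<subseteq> S" using F C by blast
    have "ennreal (L * (\<Sum>j\<in>F. r j)) = (\<Sum>j\<in>F. ennreal (L * r j))"
      unfolding sum_distrib_left using r(1) FS L
      by (intro sum_ennreal[symmetric]) (auto simp: less_imp_le subset_iff)
    also have "\<dots> \<le> (\<Sum>j\<in>F. emeasure \<nu> (cball j (r j)))"
      using r(3) FS by (intro sum_mono) (auto simp: cball_eq_atLeastAtMost subset_iff not_le less_imp_le)
    also have "\<dots> = emeasure \<nu> (\<Union>j\<in>F. cball j (r j))"
    proof (rule sum_emeasure)
      show "disjoint_family_on (\<lambda>j. cball j (r j)) F"
        using C(3) F(2) unfolding disjoint_family_on_def pairwise_def disjnt_def by blast
    qed (use F sets_nu in auto)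
    also have "\<dots> \<le> emeasure \<nu> {-pi..3 * pi}"
    proof (rule emeasure_mono)
      have "cball j (r j) \<subseteq> {-pi..3 * pi}" if "j \<in> F" for j
      proof -
        have "j \<in> {0..2 * pi}" "r j \<le> pi" using that FS r(2) by (auto simp: S_def)
        then show ?thesis by (auto simp: cball_eq_atLeastAtMost)
      qed
      then show "(\<Union>j\<in>F. cball j (r j)) \<subseteq> {-pi..3 * pi}" by blast
    qed (simp add: sets_nu)
    also note A
    finally have "L * (\<Sum>j\<in>F. r j) \<le> A" using A0 by simp
    then have "10 * (\<Sum>j\<in>F. r j) \<le> 10 * A / L" using L by (simp add: field_simps)
    then have s: "(\<Sum>j\<in>F. 10 * r j) \<le> 10 * A / L" unfolding sum_distrib_left .
    have "emeasure lborel (\<Union>j\<in>F. ball j (5 * r j)) \<le> (\<Sum>j\<in>F. emeasure lborel (ball j (5 * r j)))"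
      by (intro emeasure_subadditive_finite F) auto
    also have "\<dots> = (\<Sum>j\<in>F. ennreal (10 * r j))"
      using r(1) FS by (intro sum.cong refl) (auto simp: ball_eq_greaterThanLessThan subset_iff less_imp_le)
    also have "\<dots> = ennreal (\<Sum>j\<in>F. 10 * r j)"
      using r(1) FS by (intro sum_ennreal) (auto simp: less_imp_le subset_iff)
    also have "\<dots> \<le> ennreal (10 * A / L)" by (rule ennreal_leI[OF s])
    finally show "emeasure lborel (\<Union>j\<in>F. ball j (5 * r j)) \<le> ennreal (10 * A / L)" .
  qed auto
  ultimately show ?thesis by blast
qed

text \<open>Superlevel set of the nontangential maximal function of \<open>k\<close>. The cut-off at
  \<open>\<rho>\<close> allows all \<open>z\<close> to be compared with one circle of radius below 1
  before \<open>\<rho>\<close> tends to 1.\<close>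

definition nontangentially_large :: "(complex \<Rightarrow> complex) \<Rightarrow> real \<Rightarrow> real \<Rightarrow> real \<Rightarrow> real set" where
  "nontangentially_large k C l \<rho> =
     {\<theta>. \<exists>z. cmod z < \<rho> \<and> cmod (k z) > l \<and> cmod (z - cis \<theta>) < C * (1 - cmod z)}"

lemma open_nontangentially_large: "open (nontangentially_large k C l \<rho>)"
proof -
  have "nontangentially_large k C l \<rho> =
      (\<Union>z\<in>{z. cmod z < \<rho> \<and> cmod (k z) > l}. {\<theta>. cmod (z - cis \<theta>) < C * (1 - cmod z)})"
    by (auto simp: nontangentially_large_def)
  moreover have "open {\<theta>. cmod (z - cis \<theta>) < C * (1 - cmod z)}" for z
    by (intro open_Collect_less continuous_intros)
  ultimately show ?thesis by auto
qed

lemma nontangentially_large_measurable: "nontangentially_large k C l \<rho> \<inter> {0..2 * pi} \<in> sets lborel"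
  using sets.Int[OF borel_open[OF open_nontangentially_large] atLeastAtMost_borel] by simp

lemma nontangentially_large_mono:
  "\<rho> \<le> \<rho>' \<Longrightarrow> nontangentially_large k C l \<rho> \<subseteq> nontangentially_large k C l \<rho>'"
  unfolding nontangentially_large_def by (auto intro: order_less_le_trans)

lemma sets_circle_energy: "sets (circle_energy k R) = sets borel"
  by (simp add: circle_energy_def)

lemma nontangential_weak_type:
  fixes k :: "complex \<Rightarrow> complex" and C l A :: real
  assumes k: "k holomorphic_on ball 0 1" and C: "C > 1" and l: "l > 0" and A0: "A \<ge> 0"
    and A: "\<And>R. 0 \<le> R \<Longrightarrow> R < 1 \<Longrightarrow> emeasure (circle_energy k R) {-pi..3 * pi} \<le> ennreal A"
  shows "emeasure lborel (nontangentially_large k C l 1 \<inter> {0..2 * pi})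
    \<le> ennreal (80 * (18 * (2 * C + 3))\<^sup>2 / (pi * l\<^sup>2) * A)"
proof -
  define K where "K = 18 * (2 * C + 3)"
  \<comment> \<open>Solves \<open>16 * K\<^sup>2 * L = 2 * pi * l\<^sup>2\<close>, so that angles
    outside the cover cannot see a value above \<open>l\<close>.\<close>
  define L where "L = pi * l\<^sup>2 / (8 * K\<^sup>2)"
  have K: "K > 0" using C by (simp add: K_def)
  have L: "L > 0" using l K by (simp add: L_def)
  have fin: "emeasure lborel (nontangentially_large k C l \<rho> \<inter> {0..2 * pi}) \<le> ennreal (10 * A / L)"
    if rho: "0 \<le> \<rho>" "\<rho> < 1" for \<rho>
  proof -
    define R where "R = (1 + \<rho>) / 2"
    have R: "0 \<le> R" "R < 1" using rho by (auto simp: R_def)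
    obtain W where W: "W \<in> sets borel" "emeasure lborel W \<le> ennreal (10 * A / L)"
      "{\<theta>\<in>{0..2 * pi}. \<exists>r. 0 < r \<and> r \<le> pi \<and> \<not> emeasure (circle_energy k R) {\<theta> - r..\<theta> + r} \<le> ennreal (L * r)} \<subseteq> W"
      using maximal_weak_type[OF sets_circle_energy L A0 A[OF R]] by blast
    have "nontangentially_large k C l \<rho> \<inter> {0..2 * pi} \<subseteq> W"
    proof
      fix \<theta> assume t: "\<theta> \<in> nontangentially_large k C l \<rho> \<inter> {0..2 * pi}"
      then obtain z where z: "cmod z < \<rho>" "cmod (k z) > l" "cmod (z - cis \<theta>) < C * (1 - cmod z)"
        by (auto simp: nontangentially_large_def)
      show "\<theta> \<in> W"
      proof (rule ccontr)
        assume "\<theta> \<notin> W"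
        then have M: "emeasure (circle_energy k R) {\<theta> - r..\<theta> + r} \<le> ennreal (L * r)" if "0 < r" "r \<le> pi" for r
          using W(3) t that by blast
        have "(1 + cmod z) / 2 \<le> R" using z(1) by (simp add: R_def)
        then have "2 * pi * (cmod (k z))\<^sup>2 \<le> 16 * K\<^sup>2 * L"
          unfolding K_def
          by (rule nontangential_value_le_maximal[OF k C z(3) _ R(2) less_imp_le[OF L]]) (rule M)
        also have "\<dots> = 2 * pi * l\<^sup>2" using K by (simp add: L_def)
        finally have "(cmod (k z))\<^sup>2 \<le> l\<^sup>2" by simp
        then have "cmod (k z) \<le> l" using l by (rule power2_le_imp_le[OF _ less_imp_le])
        then show False using z by simp
      qed
    qed
    then have "emeasure lborel (nontangentially_large k C l \<rho> \<inter> {0..2 * pi}) \<le> emeasure lborel W"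
      using W by (intro emeasure_mono) auto
    then show ?thesis using W(2) by simp
  qed
  have "nontangentially_large k C l 1 \<inter> {0..2 * pi}
      = (\<Union>n. nontangentially_large k C l (1 - 1 / real (n + 2)) \<inter> {0..2 * pi})"
  proof -
    have "\<exists>n. x < 1 - 1 / real (n + 2)" if "x < 1" for x
    proof -
      obtain n where "1 / (1 - x) < real n" using reals_Archimedean2 by blast
      then have "1 / (1 - x) < real (n + 2)" by simp
      then have "1 / real (n + 2) < 1 - x" using that by (simp add: field_simps)
      then show ?thesis by (intro exI[of _ n]) simp
    qed
    then have "nontangentially_large k C l 1 \<subseteq> (\<Union>n. nontangentially_large k C l (1 - 1 / real (n + 2)))"
      unfolding nontangentially_large_def by blast
    moreover have "nontangentially_large k C l (1 - 1 / real (n + 2)) \<subseteq> nontangentially_large k C l 1" for n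
      by (rule nontangentially_large_mono) simp
    ultimately show ?thesis by blast
  qed
  also have "emeasure lborel \<dots> \<le> ennreal (10 * A / L)"
  proof (rule emeasure_UN_countable_le_finite)
    fix F :: "nat set" assume F: "finite F"
    define m where "m = Max (insert 0 F)"
    have le: "1 - 1 / real (n + 2) \<le> 1 - 1 / real (m + 2)" if "n \<in> F" for n
      using that F by (auto simp: m_def intro!: divide_left_mono)
    have "(\<Union>n\<in>F. nontangentially_large k C l (1 - 1 / real (n + 2)) \<inter> {0..2 * pi})
       \<subseteq> nontangentially_large k C l (1 - 1 / real (m + 2)) \<inter> {0..2 * pi}"
      using nontangentially_large_mono[OF le] by blast
    then have "emeasure lborel (\<Union>n\<in>F. nontangentially_large k C l (1 - 1 / real (n + 2)) \<inter> {0..2 * pi})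
       \<le> emeasure lborel (nontangentially_large k C l (1 - 1 / real (m + 2)) \<inter> {0..2 * pi})"
      by (intro emeasure_mono nontangentially_large_measurable)
    also have "\<dots> \<le> ennreal (10 * A / L)" by (rule fin) (auto simp: field_simps)
    finally show "emeasure lborel (\<Union>n\<in>F. nontangentially_large k C l (1 - 1 / real (n + 2)) \<inter> {0..2 * pi})
       \<le> ennreal (10 * A / L)" .
  qed (rule countableI_type nontangentially_large_measurable)+
  also have "10 * A / L = 80 * K\<^sup>2 / (pi * l\<^sup>2) * A" by (simp add: L_def)
  finally show ?thesis by (simp add: K_def)
qed

section \<open>Parseval's identity and the energy of power series\<close>

lemma has_integral_cis_multiple:
  "((\<lambda>t. cis (of_int m * t)) has_integral (if m = 0 then of_real (2 * pi) else 0)) {a..a + 2 * pi}"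
proof (cases "m = 0")
  case True
  then show ?thesis using has_integral_const_real[of "1::complex" a "a + 2 * pi"] by (simp add: scaleR_conv_of_real)
next
  case False
  define F where "F t = cis (of_int m * t) / (\<i> * of_int m)" for t
  have "((\<lambda>t. cis (of_int m * t)) has_integral (F (a + 2 * pi) - F a)) {a..a + 2 * pi}"
  proof (rule fundamental_theorem_of_calculus)
    fix t
    show "(F has_vector_derivative cis (of_int m * t)) (at t within {a..a + 2 * pi})"
      unfolding F_def using False
      by (auto intro!: derivative_eq_intros simp: has_vector_derivative_def scaleR_conv_of_real fun_eq_iff complex_eq_iff)
  qed simp
  moreover have "F (a + 2 * pi) = F a"
  proof -
    have "of_int m * (a + 2 * pi) = of_int m * a + 2 * pi * of_int m" by (simp add: algebra_simps)
    then have "cis (of_int m * (a + 2 * pi)) = cis (of_int m * a) * cis (2 * pi * of_int m)"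
      by (simp only: cis_mult)
    also have "cis (2 * pi * of_int m) = 1" by (simp add: cis_multiple_2pi)
    finally show ?thesis by (simp add: F_def)
  qed
  ultimately show ?thesis using False by simp
qed

lemma trig_polynomial_energy:
  fixes d :: "nat \<Rightarrow> complex"
  shows "((\<lambda>t. (\<Sum>n<N. d n * cis (real n * t)) * cnj (\<Sum>n<N. d n * cis (real n * t)))
    has_integral of_real (2 * pi * (\<Sum>n<N. (cmod (d n))\<^sup>2))) {a..a + 2 * pi}"
proof -
  have e: "(\<Sum>n<N. d n * cis (real n * t)) * cnj (\<Sum>n<N. d n * cis (real n * t))
      = (\<Sum>n<N. \<Sum>m<N. d n * cnj (d m) * cis (of_int (int n - int m) * t))" for t
    unfolding cnj_sum sum_product
    by (intro sum.cong refl) (simp add: cis_cnj cis_mult algebra_simps)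
  have "((\<lambda>t. \<Sum>n<N. \<Sum>m<N. d n * cnj (d m) * cis (of_int (int n - int m) * t)) has_integral
      (\<Sum>n<N. \<Sum>m<N. d n * cnj (d m) * (if int n - int m = 0 then of_real (2 * pi) else 0))) {a..a + 2 * pi}"
    by (intro has_integral_sum has_integral_mult_right has_integral_cis_multiple finite_lessThan)
  also have "(\<Sum>n<N. \<Sum>m<N. d n * cnj (d m) * (if int n - int m = 0 then of_real (2 * pi) else 0))
      = (\<Sum>n<N. d n * cnj (d n) * of_real (2 * pi))"
  proof (rule sum.cong[OF refl])
    fix n assume "n \<in> {..<N}"
    have "(\<Sum>m<N. d n * cnj (d m) * (if int n - int m = 0 then of_real (2 * pi) else 0))
       = (\<Sum>m<N. if m = n then d n * cnj (d n) * of_real (2 * pi) else 0)"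
      by (intro sum.cong refl) auto
    then show "(\<Sum>m<N. d n * cnj (d m) * (if int n - int m = 0 then of_real (2 * pi) else 0))
       = d n * cnj (d n) * of_real (2 * pi)" using \<open>n \<in> {..<N}\<close> by simp
  qed
  also have "\<dots> = of_real (2 * pi * (\<Sum>n<N. (cmod (d n))\<^sup>2))"
    unfolding of_real_mult[of "2 * pi"] of_real_sum complex_norm_square sum_distrib_left
    by (intro sum.cong refl) (simp add: mult_ac)
  finally show ?thesis unfolding e .
qed

text \<open>On a circle of radius below 1 the power series converges uniformly, so the energies of
  the partial sums, computed by orthogonality, converge to that of \<open>k\<close>.\<close>

lemma parseval_circle:
  fixes k :: "complex \<Rightarrow> complex" and R a :: real
  assumes k: "\<And>z. cmod z < 1 \<Longrightarrow> (\<lambda>n. c n * z ^ n) sums k z" and R: "0 \<le> R" "R < 1"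
  shows "(\<lambda>N. 2 * pi * (\<Sum>n<N. (cmod (c n) * R ^ n)\<^sup>2)) \<longlonglongrightarrow>
      integral {a..a + 2 * pi} (\<lambda>t. (cmod (k (R * cis t)))\<^sup>2)"
    and "(\<lambda>t. (cmod (k (R * cis t)))\<^sup>2) integrable_on {a..a + 2 * pi}"
proof -
  define f where "f N t = (\<Sum>n<N. c n * R ^ n * cis (real n * t))" for N t
  define g where "g t = k (R * cis t)" for t
  let ?I = "{a..a + 2 * pi}"
  have term_eq: "c n * R ^ n * cis (real n * t) = c n * (R * cis t) ^ n" for n t
    by (simp add: power_mult_distrib Complex.DeMoivre)
  have Rt: "cmod (R * cis t) < 1" for t using R by (simp add: norm_mult)
  have gs: "g t = (\<Sum>n. c n * R ^ n * cis (real n * t))" for t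
    unfolding term_eq g_def using k[OF Rt[of t]] by (rule sums_unique)
  have summ: "summable (\<lambda>n. cmod (c n) * R ^ n)"
  proof -
    obtain s where s: "R < s" "s < 1" using R dense by blast
    have "summable (\<lambda>n. c n * (of_real s) ^ n)"
      using k[of "of_real s"] s R by (auto intro: sums_summable)
    then have "summable (\<lambda>n. norm (c n * (of_real R) ^ n))"
      by (rule powser_insidea) (use s R in auto)
    then show ?thesis using R by (simp add: norm_mult norm_power)
  qed
  have u: "uniform_limit ?I f g sequentially"
    unfolding f_def gs[abs_def]
    by (rule Weierstrass_m_test[OF _ summ]) (use R in \<open>simp add: norm_mult norm_power\<close>)
  have cf: "continuous_on ?I (f N)" for N
    unfolding f_def by (intro continuous_intros)
  have cg: "continuous_on ?I g"
    by (rule uniform_limit_theorem[OF _ u]) (simp_all add: cf)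
  have b: "bounded (g ` ?I)" using compact_continuous_image[OF cg] by (simp add: compact_imp_bounded)
  have uc: "uniform_limit ?I (\<lambda>N t. cnj (f N t)) (\<lambda>t. cnj (g t)) sequentially"
    by (rule bounded_linear.uniform_limit[OF bounded_linear_cnj u])
  have bc: "bounded ((\<lambda>t. cnj (g t)) ` ?I)"
    using b by (auto simp: bounded_iff)
  have "uniform_limit ?I (\<lambda>N t. f N t * cnj (f N t)) (\<lambda>t. g t * cnj (g t)) sequentially"
    by (rule uniform_lim_mult[OF u uc b bc])
  moreover have "continuous_on ?I (\<lambda>t. f N t * cnj (f N t))" for N
    by (intro continuous_intros cf)
  ultimately obtain I J where I: "\<And>N. ((\<lambda>t. f N t * cnj (f N t)) has_integral I N) ?I"
      "((\<lambda>t. g t * cnj (g t)) has_integral J) ?I" "I \<longlonglongrightarrow> J"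
    by (rule uniform_limit_integral) auto
  have IN: "I N = of_real (2 * pi * (\<Sum>n<N. (cmod (c n) * R ^ n)\<^sup>2))" for N
  proof -
    have "((\<lambda>t. f N t * cnj (f N t)) has_integral of_real (2 * pi * (\<Sum>n<N. (cmod (c n * R ^ n))\<^sup>2))) ?I"
      unfolding f_def by (rule trig_polynomial_energy)
    then show ?thesis using I(1)[of N] has_integral_unique R by (simp add: norm_mult norm_power) blast
  qed
  have "((\<lambda>t. Re (g t * cnj (g t))) has_integral Re J) ?I"
    using has_integral_linear[OF I(2) bounded_linear_Re] by (simp add: o_def)
  moreover have "Re (g t * cnj (g t)) = (cmod (g t))\<^sup>2" for t
    by (simp add: complex_norm_square[symmetric] flip: of_real_power)
  ultimately have J: "((\<lambda>t. (cmod (g t))\<^sup>2) has_integral Re J) ?I" by simp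
  have "(\<lambda>N. Re (I N)) \<longlonglongrightarrow> Re J" by (intro tendsto_Re I)
  then have "(\<lambda>N. 2 * pi * (\<Sum>n<N. (cmod (c n) * R ^ n)\<^sup>2)) \<longlonglongrightarrow> Re J" unfolding IN by simp
  then show "(\<lambda>N. 2 * pi * (\<Sum>n<N. (cmod (c n) * R ^ n)\<^sup>2)) \<longlonglongrightarrow>
      integral ?I (\<lambda>t. (cmod (k (R * cis t)))\<^sup>2)"
    using integral_unique[OF J] by (simp add: g_def)
  show "(\<lambda>t. (cmod (k (R * cis t)))\<^sup>2) integrable_on ?I"
    using J unfolding g_def by blast
qed


lemma emeasure_circle_energy:
  fixes k :: "complex \<Rightarrow> complex" and R a :: real
  assumes "(\<lambda>t. (cmod (k (R * cis t)))\<^sup>2) integrable_on {a..a + 2 * pi}"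
    and "k holomorphic_on ball 0 1" "0 \<le> R" "R < 1"
  shows "emeasure (circle_energy k R) {a..a + 2 * pi}
    = ennreal (integral {a..a + 2 * pi} (\<lambda>t. (cmod (k (R * cis t)))\<^sup>2))"
proof -
  have [measurable]: "(\<lambda>t. k (R * cis t)) \<in> borel_measurable borel"
    by (intro borel_measurable_continuous_onI continuous_on_circle assms)
  have "emeasure (circle_energy k R) {a..a + 2 * pi}
      = (\<integral>\<^sup>+t. ennreal ((cmod (k (R * cis t)))\<^sup>2) * indicator {a..a + 2 * pi} t \<partial>lborel)"
    unfolding circle_energy_def by (rule emeasure_density) measurable
  also have "\<dots> = ennreal (integral {a..a + 2 * pi} (\<lambda>t. (cmod (k (R * cis t)))\<^sup>2))"
    by (intro nn_integral_has_integral_lebesgue' integrable_integral assms) simp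
  finally show ?thesis .
qed

lemma circle_energy_le:
  fixes k :: "complex \<Rightarrow> complex" and R A :: real
  assumes k: "\<And>z. cmod z < 1 \<Longrightarrow> (\<lambda>n. c n * z ^ n) sums k z" and hol: "k holomorphic_on ball 0 1"
    and R: "0 \<le> R" "R < 1" and A: "\<And>N. (\<Sum>n<N. (cmod (c n))\<^sup>2) \<le> A"
  shows "emeasure (circle_energy k R) {-pi..3 * pi} \<le> ennreal (4 * pi * A)"
proof -
  have A0: "A \<ge> 0" using A[of 0] by simp
  have half: "emeasure (circle_energy k R) {a..a + 2 * pi} \<le> ennreal (2 * pi * A)" for a
  proof -
    have "(\<Sum>n<N. (cmod (c n) * R ^ n)\<^sup>2) \<le> A" for N
    proof -
      have "(cmod (c n) * R ^ n)\<^sup>2 \<le> (cmod (c n))\<^sup>2" for n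
      proof (rule power_mono)
        have "R ^ n \<le> 1" using R by (simp add: power_le_one)
        then show "cmod (c n) * R ^ n \<le> cmod (c n)" by (simp add: mult_left_le)
      qed (use R in auto)
      then have "(\<Sum>n<N. (cmod (c n) * R ^ n)\<^sup>2) \<le> (\<Sum>n<N. (cmod (c n))\<^sup>2)" by (intro sum_mono)
      then show ?thesis using A[of N] by linarith
    qed
    then have "2 * pi * (\<Sum>n<N. (cmod (c n) * R ^ n)\<^sup>2) \<le> 2 * pi * A" for N
      by (intro mult_left_mono) auto
    then have "integral {a..a + 2 * pi} (\<lambda>t. (cmod (k (R * cis t)))\<^sup>2) \<le> 2 * pi * A"
      by (intro LIMSEQ_le_const2[OF parseval_circle(1)[OF k R]]) auto
    then show ?thesis
      using emeasure_circle_energy[where k = k and R = R and a = a, OF parseval_circle(2)[OF k R] hol R]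
      by (simp add: ennreal_leI)
  qed
  have "{-pi..3 * pi} = {-pi..-pi + 2 * pi} \<union> {pi..pi + 2 * pi}" by auto
  then have "emeasure (circle_energy k R) {-pi..3 * pi}
      \<le> emeasure (circle_energy k R) {-pi..-pi + 2 * pi} + emeasure (circle_energy k R) {pi..pi + 2 * pi}"
    by (simp only:) (intro emeasure_subadditive, auto simp: sets_circle_energy)
  also have "\<dots> \<le> ennreal (2 * pi * A) + ennreal (2 * pi * A)" by (intro add_mono half)
  also have "\<dots> = ennreal (4 * pi * A)" using A0 by (simp flip: ennreal_plus)
  finally show ?thesis .
qed

lemma bounded_imp_square_summable_coeffs:
  fixes h :: "complex \<Rightarrow> complex" and B :: real
  assumes h: "\<And>z. cmod z < 1 \<Longrightarrow> (\<lambda>n. c n * z ^ n) sums h z"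
    and B: "\<And>z. cmod z < 1 \<Longrightarrow> cmod (h z) \<le> B"
  shows "(\<Sum>n<N. (cmod (c n))\<^sup>2) \<le> B\<^sup>2"
proof -
  have le: "(\<Sum>n<N. (cmod (c n) * R ^ n)\<^sup>2) \<le> B\<^sup>2" if R: "0 \<le> R" "R < 1" for R
  proof -
    let ?s = "\<lambda>N. 2 * pi * (\<Sum>n<N. (cmod (c n) * R ^ n)\<^sup>2)"
    have "incseq ?s" by (intro incseq_SucI) simp
    then have "?s N \<le> integral {0..0 + 2 * pi} (\<lambda>t. (cmod (h (R * cis t)))\<^sup>2)"
      by (rule incseq_le[OF _ parseval_circle(1)[OF h R]])
    also have "\<dots> \<le> integral {0..0 + 2 * pi} (\<lambda>t. B\<^sup>2)"
      using R by (intro integral_le parseval_circle(2)[OF h R] integrable_const_ivl power_mono B)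
        (auto simp: norm_mult)
    also have "\<dots> = 2 * pi * B\<^sup>2" by simp
    finally show ?thesis by simp
  qed
  have "(\<lambda>j. \<Sum>n<N. (cmod (c n) * (1 - 1 / real (Suc j)) ^ n)\<^sup>2) \<longlonglongrightarrow> (\<Sum>n<N. (cmod (c n) * (1 - 0) ^ n)\<^sup>2)"
    by (intro tendsto_intros LIMSEQ_inverse_real_of_nat[unfolded inverse_eq_divide])
  then have "(\<lambda>j. \<Sum>n<N. (cmod (c n) * (1 - 1 / real (Suc j)) ^ n)\<^sup>2) \<longlonglongrightarrow> (\<Sum>n<N. (cmod (c n))\<^sup>2)" by simp
  then show ?thesis
    by (rule LIMSEQ_le_const2) (intro exI[of _ 0] allI impI le, auto simp: field_simps)
qed

text \<open>Fatou's theorem in Cauchy form. \<open>h\<close> is a polynomial, continuous up to the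
  circle, plus a tail \<open>k N\<close> whose energy tends to 0. By the weak type estimate the
  angles where the tail exceeds \<open>\<epsilon>\<close> nontangentially have measure tending to 0,
  so almost every angle escapes for some \<open>N\<close>. There the oscillation is at most
  \<open>2 * \<epsilon>\<close> from the tail and \<open>\<epsilon>\<close> from the
  polynomial.\<close>

lemma nontangential_oscillation:
  fixes h :: "complex \<Rightarrow> complex" and B C \<epsilon> :: real
  assumes h: "h holomorphic_on ball 0 1" and B: "\<And>z. cmod z < 1 \<Longrightarrow> cmod (h z) \<le> B"
    and C: "C > 1" and e: "\<epsilon> > 0"
  shows "\<exists>Z\<in>null_sets lborel. \<forall>\<theta>\<in>{0..2 * pi} - Z. \<exists>d>0. \<forall>z\<in>stolz_region (cis \<theta>) C. \<forall>w\<in>stolz_region (cis \<theta>) C.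
    cmod (z - cis \<theta>) < d \<longrightarrow> cmod (w - cis \<theta>) < d \<longrightarrow> cmod (h z - h w) \<le> 3 * \<epsilon>"
proof -
  define c where "c n = (deriv ^^ n) h 0 / fact n" for n
  have hs: "(\<lambda>n. c n * z ^ n) sums h z" if "cmod z < 1" for z
    using holomorphic_power_series[OF h, of z] that by (simp add: c_def)
  have part: "(\<Sum>n<N. (cmod (c n))\<^sup>2) \<le> B\<^sup>2" for N
    by (rule bounded_imp_square_summable_coeffs[OF hs B])
  have summ: "summable (\<lambda>n. (cmod (c n))\<^sup>2)"
    by (rule summableI_nonneg_bounded[OF _ part]) simp
  define S where "S = (\<Sum>n. (cmod (c n))\<^sup>2)"
  define p where "p N z = (\<Sum>n<N. c n * z ^ n)" for N z
  define k where "k N z = h z - p N z" for N z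
  define T where "T N = S - (\<Sum>n<N. (cmod (c n))\<^sup>2)" for N
  have hk: "k N holomorphic_on ball 0 1" for N
    unfolding k_def p_def by (intro holomorphic_intros h)
  have sumsk: "(\<lambda>n. (if n < N then 0 else c n) * z ^ n) sums k N z" if "cmod z < 1" for N z
  proof -
    have "(\<lambda>n. if n < N then c n * z ^ n else 0) sums p N z"
      using sums_If_finite_set[of "{..<N}" "\<lambda>n. c n * z ^ n"] by (simp add: p_def)
    from sums_diff[OF hs[OF that] this] show ?thesis
      unfolding k_def by (rule sums_cong[THEN iffD1, rotated]) auto
  qed
  have T: "(\<Sum>n<m. (cmod (if n < N then 0 else c n))\<^sup>2) \<le> T N" for N m
  proof -
    have "(\<Sum>n<m. (cmod (if n < N then 0 else c n))\<^sup>2) \<le> (\<Sum>n<N + m. (cmod (if n < N then 0 else c n))\<^sup>2)"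
      by (intro sum_mono2) auto
    also have "\<dots> = (\<Sum>n<N + m. (cmod (c n))\<^sup>2 - (if n < N then (cmod (c n))\<^sup>2 else 0))"
      by (intro sum.cong) auto
    also have "\<dots> = (\<Sum>n<N + m. (cmod (c n))\<^sup>2) - (\<Sum>n<N. (cmod (c n))\<^sup>2)"
    proof -
      have "{..<N + m} \<inter> {n. n < N} = {..<N}" by auto
      then show ?thesis by (simp add: sum_subtractf sum.If_cases)
    qed
    also have "\<dots> \<le> T N" unfolding T_def S_def using sum_le_suminf[OF summ, of "{..<N + m}"] by simp
    finally show ?thesis .
  qed
  have T0: "T N \<ge> 0" for N using T[where m = 0 and N = N] by simp
  have Tlim: "T \<longlonglongrightarrow> 0"
    unfolding T_def using tendsto_diff[OF tendsto_const summable_LIMSEQ[OF summ], of S] by (simp add: S_def)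
  define Z where "Z = (\<Inter>N. nontangentially_large (k N) C \<epsilon> 1 \<inter> {0..2 * pi})"
  have sets: "nontangentially_large (k N) C \<epsilon> 1 \<inter> {0..2 * pi} \<in> sets borel" for N
    using nontangentially_large_measurable by simp
  define Q where "Q = 80 * (18 * (2 * C + 3))\<^sup>2 / (pi * \<epsilon>\<^sup>2)"
  have em: "emeasure lborel Z \<le> ennreal (Q * (4 * pi * T N))" for N
  proof -
    have "emeasure lborel Z \<le> emeasure lborel (nontangentially_large (k N) C \<epsilon> 1 \<inter> {0..2 * pi})"
      using sets[of N] by (intro emeasure_mono) (auto simp: Z_def)
    also have "\<dots> \<le> ennreal (Q * (4 * pi * T N))"
      unfolding Q_def
      by (intro nontangential_weak_type[OF hk C e] circle_energy_le[OF sumsk hk _ _ T]) (use T0 in auto)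
    finally show ?thesis .
  qed
  have "(\<lambda>N. ennreal (Q * (4 * pi * T N))) \<longlonglongrightarrow> ennreal (Q * (4 * pi * 0))"
    by (intro tendsto_intros Tlim)
  then have "emeasure lborel Z \<le> ennreal (Q * (4 * pi * 0))"
    by (rule LIMSEQ_le_const) (use em in auto)
  moreover have "Z \<in> sets borel"
    unfolding Z_def by (rule sets.countable_INT) (use sets in auto)
  ultimately have null: "Z \<in> null_sets lborel" by (simp add: null_sets_def)
  have "\<exists>d>0. \<forall>z\<in>stolz_region (cis \<theta>) C. \<forall>w\<in>stolz_region (cis \<theta>) C.
    cmod (z - cis \<theta>) < d \<longrightarrow> cmod (w - cis \<theta>) < d \<longrightarrow> cmod (h z - h w) \<le> 3 * \<epsilon>"
    if th: "\<theta> \<in> {0..2 * pi} - Z" for \<theta>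
  proof -
    obtain N where "\<theta> \<notin> nontangentially_large (k N) C \<epsilon> 1" 
      using th unfolding Z_def by blast
    then have small: "cmod (k N z) \<le> \<epsilon>" if "z \<in> stolz_region (cis \<theta>) C" for z
      using that by (force simp: nontangentially_large_def stolz_region_def)
    have "isCont (p N) (cis \<theta>)" unfolding p_def by (intro continuous_intros)
    then obtain d where d: "d > 0" "\<And>z. cmod (z - cis \<theta>) < d \<Longrightarrow> cmod (p N z - p N (cis \<theta>)) < \<epsilon> / 2"
      using e unfolding continuous_at_eps_delta by (metis dist_norm half_gt_zero)
    have "cmod (h z - h w) \<le> 3 * \<epsilon>"
      if z: "z \<in> stolz_region (cis \<theta>) C" "cmod (z - cis \<theta>) < d"
        and w: "w \<in> stolz_region (cis \<theta>) C" "cmod (w - cis \<theta>) < d" for z w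
    proof -
      have "h z - h w = (k N z - k N w) + ((p N z - p N (cis \<theta>)) - (p N w - p N (cis \<theta>)))"
        by (simp add: k_def)
      also have "cmod \<dots> \<le> (cmod (k N z) + cmod (k N w)) + (cmod (p N z - p N (cis \<theta>)) + cmod (p N w - p N (cis \<theta>)))"
        by (intro norm_triangle_le add_mono norm_triangle_ineq4)
      also have "\<dots> \<le> 3 * \<epsilon>" using small[OF z(1)] small[OF w(1)] d(2)[OF z(2)] d(2)[OF w(2)] by simp
      finally show ?thesis .
    qed
    then show ?thesis using d(1) by blast
  qed
  then show ?thesis using null by blast
qed

section \<open>Jensen's inequality and radial uniqueness\<close>

lemma holomorphic_divide_out_zero:
  assumes f: "f holomorphic_on S" and S: "open S" "connected S" and a: "a \<in> S"
    and nc: "\<not> f constant_on S"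
  obtains g n where "g holomorphic_on S" "\<And>w. w \<in> S \<Longrightarrow> f w = (w - a) ^ n * g w" "g a \<noteq> 0"
proof (cases "f a = 0")
  case False
  then show thesis using that[of f 0] f by simp
next
  case True
  obtain g r n where g: "0 < n" "0 < r" "ball a r \<subseteq> S" "g holomorphic_on ball a r"
    "\<And>w. w \<in> ball a r \<Longrightarrow> f w = (w - a) ^ n * g w" "\<And>w. w \<in> ball a r \<Longrightarrow> g w \<noteq> 0"
    using holomorphic_factor_zero_nonconstant[OF f S a True nc] by metis
  define G where "G w = (if w = a then g a else f w / (w - a) ^ n)" for w
  have "G holomorphic_on ball a r"
    by (rule holomorphic_transform[OF g(4)]) (use g(5) in \<open>auto simp: G_def\<close>)
  moreover have "G holomorphic_on (S - {a})"
    by (rule holomorphic_transform[of "\<lambda>w. f w / (w - a) ^ n"])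
       (auto simp: G_def intro!: holomorphic_intros holomorphic_on_subset[OF f])
  ultimately have "G holomorphic_on (ball a r \<union> (S - {a}))"
    using S by (intro holomorphic_on_Un) (auto simp: open_delete)
  moreover have "ball a r \<union> (S - {a}) = S" using g(2,3) a by auto
  ultimately have "G holomorphic_on S" by simp
  moreover have "f w = (w - a) ^ n * G w" if "w \<in> S" for w
    using True g(1) by (auto simp: G_def)
  moreover have "G a \<noteq> 0" using g(2,6) by (simp add: G_def)
  ultimately show thesis by (rule that)
qed

lemma holomorphic_circle_mean:
  fixes g :: "complex \<Rightarrow> complex" and R r :: real
  assumes g: "g holomorphic_on ball 0 r" and R: "0 < R" "R < r"
  shows "((\<lambda>t. g (R * cis t)) has_integral (2 * pi * g 0)) {0..2 * pi}"
proof -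
  have "(\<lambda>w. g (r * w)) holomorphic_on ball 0 1"
    by (rule holomorphic_on_compose_gen[OF _ g, unfolded o_def])
       (use R in \<open>auto intro!: holomorphic_intros simp: norm_mult\<close>)
  from poisson_formula_0[OF this, of "R / r" 0] show ?thesis
    using R by (simp add: norm_mult norm_divide power_divide)
qed

text \<open>A zero \<open>a\<close> is removed by replacing \<open>w - a\<close> with \<open>(R\<^sup>2 - cnj a w) / R\<close>, which has the same
  modulus on the circle of radius \<open>R\<close> and a larger one at \<open>0\<close>.\<close>

lemma jensen_inequality:
  fixes h :: "complex \<Rightarrow> complex" and R :: real
  assumes "h holomorphic_on ball 0 1" "h 0 \<noteq> 0" "0 < R" "R < 1" "\<And>z. cmod z = R \<Longrightarrow> h z \<noteq> 0"
  shows "2 * pi * ln (cmod (h 0)) \<le> integral {0..2 * pi} (\<lambda>t. ln (cmod (h (R * cis t))))"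
  using assms
proof (induction "card {z \<in> cball 0 R. h z = 0}" arbitrary: h rule: less_induct)
  case less
  note h = less.prems
  show ?case
  proof (cases "{z \<in> cball 0 R. h z = 0} = {}")
    case True
    define Z where "Z = {z \<in> cball 0 ((1 + R) / 2). h z = 0}"
    have "continuous_on (cball 0 ((1 + R) / 2)) h"
      using h(4) by (intro holomorphic_on_imp_continuous_on holomorphic_on_subset[OF h(1)]) auto
    then have "closed Z"
      unfolding Z_def by (rule continuous_closed_preimage_constant) simp
    moreover have "bounded Z"
      by (rule bounded_subset[OF bounded_cball[of 0 "(1 + R) / 2"]]) (auto simp: Z_def)
    ultimately have "compact Z" by (simp add: compact_eq_bounded_closed)
    \<comment> \<open>A holomorphic logarithm is wanted on an open disc containing the circle of
      radius \<open>R\<close>. Zeros in a bigger compact disc have a smallest modulus, which exceeds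
      \<open>R\<close>.\<close>
    have "\<exists>r>R. r < 1 \<and> (\<forall>z. cmod z < r \<longrightarrow> h z \<noteq> 0)"
    proof (cases "Z = {}")
      case True
      then have "h z \<noteq> 0" if "cmod z < (1 + R) / 2" for z using that by (auto simp: Z_def)
      then show ?thesis using h(4) by (intro exI[of _ "(1 + R) / 2"]) auto
    next
      case False
      then obtain x where x: "x \<in> Z" "\<And>y. y \<in> Z \<Longrightarrow> cmod x \<le> cmod y"
        using continuous_attains_inf[OF \<open>compact Z\<close>, of cmod] continuous_on_norm_id by blast
      have "x \<notin> {z \<in> cball 0 R. h z = 0}" using True by blast
      then have xx: "R < cmod x" "cmod x \<le> (1 + R) / 2" using x(1) by (auto simp: Z_def)
      have "h z \<noteq> 0" if "cmod z < cmod x" for z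
      proof
        assume "h z = 0"
        then have "z \<in> Z" using that xx by (simp add: Z_def)
        then show False using x(2)[of z] that by simp
      qed
      then show ?thesis using xx h(4) by (intro exI[of _ "cmod x"]) auto
    qed
    then obtain r where r: "R < r" "r < 1" "\<And>z. cmod z < r \<Longrightarrow> h z \<noteq> 0" by blast
    have hr: "h holomorphic_on ball 0 r" by (rule holomorphic_on_subset[OF h(1)]) (use r in auto)
    obtain g where g: "g holomorphic_on ball 0 r" "\<And>z. z \<in> ball 0 r \<Longrightarrow> h z = exp (g z)"
      using contractible_imp_holomorphic_log[OF hr convex_imp_contractible] r(3) by (metis convex_ball dist_0_norm mem_ball)
    have "((\<lambda>t. Re (g (R * cis t))) has_integral Re (2 * pi * g 0)) {0..2 * pi}"
      using has_integral_linear[OF holomorphic_circle_mean[OF g(1) h(3) r(1)] bounded_linear_Re] by (simp add: o_def)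
    then have "integral {0..2 * pi} (\<lambda>t. Re (g (R * cis t))) = 2 * pi * Re (g 0)"
      by (simp add: integral_unique)
    moreover have "ln (cmod (h z)) = Re (g z)" if "cmod z < r" for z using g(2)[of z] that by simp
    ultimately show ?thesis using h(3) r by (simp add: norm_mult)
  next
    case False
    then obtain a where a: "cmod a \<le> R" "h a = 0" by auto
    have nc: "\<not> h constant_on ball 0 1"
      using a h(2,4) unfolding constant_on_def by (metis centre_in_ball dist_0_norm mem_ball order_le_less_trans zero_less_one)
    have aR: "cmod a < R" using a h(5)[of a] by force
    have a1: "a \<in> ball 0 1" using aR h(4) by simp
    \<comment> \<open>The full multiplicity \<open>n\<close> is split off at once, so that the
      number of distinct zeros, which drives the induction, drops by one.\<close>
    obtain g n where g: "g holomorphic_on ball 0 1" "\<And>w. w \<in> ball 0 1 \<Longrightarrow> h w = (w - a) ^ n * g w" "g a \<noteq> 0"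
      using holomorphic_divide_out_zero[OF h(1) open_ball connected_ball a1 nc] by metis
    define b where "b w = (of_real (R\<^sup>2) - cnj a * w) / of_real R" for w
    define H where "H w = b w ^ n * g w" for w
    have b0: "b w \<noteq> 0" if "cmod w \<le> R" for w
    proof -
      have "cmod (cnj a * w) \<le> cmod a * R" unfolding norm_mult complex_mod_cnj using that by (intro mult_left_mono) auto
      also have "\<dots> < R * R" using aR h(3) by simp
      finally have "cmod (cnj a * w) < cmod (of_real (R\<^sup>2))"
        unfolding norm_of_real by (simp add: power2_eq_square)
      then have "of_real (R\<^sup>2) \<noteq> cnj a * w" by force
      then show ?thesis using h(3) by (simp add: b_def)
    qed
    have bn: "cmod (b w) = cmod (w - a)" if "cmod w = R" for w
    proof -
      have "of_real (R\<^sup>2) = w * cnj w" using that by (simp add: complex_norm_square[symmetric])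
      then have "b w = w * cnj (w - a) / of_real R" by (simp add: b_def algebra_simps)
      then have "cmod (b w) = cmod w * cmod (w - a) / R" using h(3) by (simp add: norm_mult norm_divide flip: complex_cnj_diff)
      then show ?thesis using that h(3) by simp
    qed
    have HH: "H holomorphic_on ball 0 1"
      unfolding H_def b_def using h(3) by (intro holomorphic_intros g(1)) auto
    have eq: "cmod (H w) = cmod (h w)" if "cmod w = R" for w
      using g(2)[of w] that h(4) bn[OF that] by (simp add: H_def norm_mult norm_power)
    have zeros: "{z \<in> cball 0 R. H z = 0} = {z \<in> cball 0 R. h z = 0} - {a}"
    proof -
      have "H z = 0 \<longleftrightarrow> h z = 0 \<and> z \<noteq> a" if "cmod z \<le> R" for z
        using g(2)[of z] g(3) that h(4) b0[OF that] by (auto simp: H_def)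
      then show ?thesis by auto
    qed
    have fin: "finite {z \<in> cball 0 R. h z = 0}"
      using h(4) by (intro holomorphic_compact_finite_zeros[OF h(1) open_ball connected_ball compact_cball _ nc]) auto
    have "card {z \<in> cball 0 R. H z = 0} < card {z \<in> cball 0 R. h z = 0}"
      unfolding zeros using fin a by (intro psubset_card_mono) auto
    moreover have g0: "h 0 = (- a) ^ n * g 0" using g(2)[of 0] by simp
    then have "g 0 \<noteq> 0" using h(2) by auto
    then have "H 0 \<noteq> 0" using b0[of 0] h(3) by (simp add: H_def)
    moreover have "H z \<noteq> 0" if "cmod z = R" for z using eq[OF that] h(5)[OF that] by force
    ultimately have IH: "2 * pi * ln (cmod (H 0)) \<le> integral {0..2 * pi} (\<lambda>t. ln (cmod (H (R * cis t))))"
      using less.hyps[of H] HH h(3,4) by blast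
    have ceq: "(\<lambda>t. ln (cmod (H (R * cis t)))) = (\<lambda>t. ln (cmod (h (R * cis t))))"
      using eq h(3) by (simp add: norm_mult)
    have "ln (cmod (h 0)) \<le> ln (cmod (H 0))"
    proof (rule ln_mono)
      have "b 0 = of_real R" using h(3) by (simp add: b_def power2_eq_square)
      then have "cmod (H 0) = R ^ n * cmod (g 0)" using h(3) by (simp add: H_def norm_mult norm_power)
      moreover have "cmod (h 0) = cmod a ^ n * cmod (g 0)" unfolding g0 by (simp add: norm_mult norm_power)
      moreover have "cmod a ^ n \<le> R ^ n" using aR by (intro power_mono) auto
      ultimately show "cmod (h 0) \<le> cmod (H 0)" by (simp add: mult_right_mono)
    qed (use h(2) in simp)
    then have "2 * pi * ln (cmod (h 0)) \<le> 2 * pi * ln (cmod (H 0))" by simp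
    from order_trans[OF this IH[unfolded ceq]] show ?thesis .
  qed
qed


lemma exists_radius_without_zeros:
  fixes h :: "complex \<Rightarrow> complex" and s :: real
  assumes h: "h holomorphic_on ball 0 1" "h 0 \<noteq> 0" and s: "s < 1"
  shows "\<exists>R. s < R \<and> R < 1 \<and> (\<forall>z. cmod z = R \<longrightarrow> h z \<noteq> 0)"
proof -
  define \<rho> where "\<rho> = (1 + max s 0) / 2"
  have rho: "max s 0 < \<rho>" "\<rho> < 1" using s by (auto simp: \<rho>_def max_def)
  have "finite {z \<in> cball 0 \<rho>. h z = 0}"
  proof (cases "h constant_on ball 0 1")
    case True
    have "0 \<in> ball (0::complex) 1" by simp
    then have "h z \<noteq> 0" if "z \<in> ball 0 1" for z
      using h(2) True that unfolding constant_on_def by metis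
    then have "{z \<in> cball 0 \<rho>. h z = 0} = {}" using rho(2) by force
    then show ?thesis by (metis finite.emptyI)
  next
    case False
    then show ?thesis
      using rho by (intro holomorphic_compact_finite_zeros[OF h(1) open_ball connected_ball compact_cball]) auto
  qed
  then have "finite (cmod ` {z \<in> cball 0 \<rho>. h z = 0})" by (rule finite_imageI)
  moreover have "infinite {max s 0<..<\<rho>}" using rho(1) by simp
  ultimately have "\<not> {max s 0<..<\<rho>} \<subseteq> cmod ` {z \<in> cball 0 \<rho>. h z = 0}"
    using finite_subset by blast
  then obtain R where R: "R \<in> {max s 0<..<\<rho>}" "R \<notin> cmod ` {z \<in> cball 0 \<rho>. h z = 0}" by blast
  then have "h z \<noteq> 0" if "cmod z = R" for z using that by auto
  then show ?thesis using R(1) rho(2) by (intro exI[of _ R]) auto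
qed

text \<open>Let \<open>g\<close> be \<open>h\<close> without its zero at 0. Jensen's inequality
  bounds the integrals of \<open>ln M - ln |g| \<ge> 0\<close> over circles of radius tending to 1
  by one constant \<open>Q\<close>. A radial limit 0 makes this integrand exceed any
  \<open>K\<close> eventually at each point of \<open>T\<close>, so by Chebyshev's inequality
  \<open>T\<close> has measure at most \<open>Q / K\<close> for every \<open>K\<close>.\<close>

lemma radial_uniqueness:
  fixes h :: "complex \<Rightarrow> complex" and B :: real
  assumes h: "h holomorphic_on ball 0 1" and B: "\<And>z. cmod z < 1 \<Longrightarrow> cmod (h z) \<le> B"
    and T: "T \<subseteq> {0..2 * pi}" "emeasure lebesgue T > 0"
    and lim: "\<And>\<theta> e. \<theta> \<in> T \<Longrightarrow> e > 0 \<Longrightarrow> \<exists>s<(1::real). \<forall>r::real. s < r \<and> r < 1 \<longrightarrow> cmod (h (r * cis \<theta>)) < e"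
    and z: "cmod z < 1"
  shows "h z = 0"
proof (rule ccontr)
  assume hz: "h z \<noteq> 0"
  obtain \<theta>0 where t0: "\<theta>0 \<in> T" using T(2) by fastforce
  have nc: "\<not> h constant_on ball 0 1"
  proof
    assume "h constant_on ball 0 1"
    then obtain c where c: "\<And>w. w \<in> ball 0 1 \<Longrightarrow> h w = c" unfolding constant_on_def by blast
    then have "c = h z" using z by simp
    then have c0: "cmod c > 0" using hz by simp
    obtain s :: real where s: "s < 1" "\<And>r::real. s < r \<Longrightarrow> r < 1 \<Longrightarrow> cmod (h (r * cis \<theta>0)) < cmod c"
      using lim[OF t0 c0] by blast
    obtain r where r: "max s 0 < r" "r < 1" using s(1) dense[of "max s 0" 1] by auto
    then have "h (r * cis \<theta>0) = c" by (intro c) (simp add: norm_mult)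
    then show False using s(2)[of r] r by simp
  qed
  obtain g n where g: "g holomorphic_on ball 0 1" "\<And>w. w \<in> ball 0 1 \<Longrightarrow> h w = (w - 0) ^ n * g w" "g 0 \<noteq> 0"
    using holomorphic_divide_out_zero[OF h open_ball connected_ball _ nc, of 0] by auto
  define M where "M = 2 ^ n * (\<bar>B\<bar> + 1)"
  have M: "M > 0" by (simp add: M_def)
  have gh: "cmod (g w) \<le> 2 ^ n * cmod (h w)" if "1 / 2 \<le> cmod w" "cmod w < 1" for w
  proof -
    have "(1 / 2) ^ n * cmod (g w) \<le> cmod w ^ n * cmod (g w)"
      using that by (intro mult_right_mono power_mono) auto
    also have "\<dots> = cmod (h w)" using g(2)[of w] that by (simp add: norm_mult norm_power)
    finally show ?thesis by (simp add: power_divide field_simps)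
  qed
  have gM: "cmod (g w) \<le> M" if "1 / 2 \<le> cmod w" "cmod w < 1" for w
  proof -
    have "2 ^ n * cmod (h w) \<le> 2 ^ n * (\<bar>B\<bar> + 1)" using B[OF that(2)] by (intro mult_left_mono) auto
    from order_trans[OF gh[OF that] this] show ?thesis unfolding M_def .
  qed
  have "\<exists>R. \<forall>j. 1 - 1 / real (j + 2) < R j \<and> R j < 1 \<and> (\<forall>z. cmod z = R j \<longrightarrow> g z \<noteq> 0)"
    by (intro choice allI exists_radius_without_zeros[OF g(1,3)]) simp
  then obtain R where R: "\<And>j. 1 - 1 / real (j + 2) < R j" "\<And>j. R j < 1" "\<And>j z. cmod z = R j \<Longrightarrow> g z \<noteq> 0"
    by blast
  have R2: "1 / 2 < R j" "cmod (R j * cis t) = R j" for j t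
  proof -
    have "1 / real (j + 2) \<le> 1 / 2" by (intro divide_left_mono) auto
    then show "1 / 2 < R j" using R(1)[of j] by linarith
    then show "cmod (R j * cis t) = R j" by (simp add: norm_mult)
  qed
  define u where "u j t = ln M - ln (cmod (g (R j * cis t)))" for j t
  have gnz: "g (R j * cis t) \<noteq> 0" for j t using R(3) R2(2) by blast
  have u0: "u j t \<ge> 0" for j t
    unfolding u_def using gnz M gM[of "R j * cis t"] R2[of j] R(2)[of j] by (simp add: less_imp_le)
  have cg: "continuous_on S (\<lambda>t. g (R j * cis t))" for S j
    by (rule continuous_on_circle[OF g(1)]) (use R2[of j] R(2)[of j] in auto)
  have cu: "continuous_on S (u j)" for S j
    unfolding u_def using gnz by (intro continuous_intros cg) auto
  define Q where "Q = 2 * pi * (ln M - ln (cmod (g 0)))"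
  have Q: "integral {0..2 * pi} (u j) \<le> Q" for j
  proof -
    have "continuous_on {0..2 * pi} (\<lambda>t. ln (cmod (g (R j * cis t))))"
      using gnz by (intro continuous_intros cg) auto
    then have "integral {0..2 * pi} (u j) = 2 * pi * ln M - integral {0..2 * pi} (\<lambda>t. ln (cmod (g (R j * cis t))))"
      unfolding u_def by (subst integral_diff) (auto intro: integrable_continuous_interval)
    moreover have "R j > 0" using R2(1)[of j] by linarith
    then have "2 * pi * ln (cmod (g 0)) \<le> integral {0..2 * pi} (\<lambda>t. ln (cmod (g (R j * cis t))))"
      by (rule jensen_inequality[OF g(1,3) _ R(2) R(3)])
    ultimately show ?thesis by (simp add: Q_def algebra_simps)
  qed
  have small: "emeasure lebesgue T \<le> ennreal (Q / K)" if K: "K > 0" for K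
  proof -
    define S where "S j = {t \<in> {0..2 * pi}. K \<le> u j t}" for j
    have "{t. K \<le> u j t} \<in> sets borel" for j
      by (intro borel_closed closed_Collect_le continuous_on_const cu)
    then have Sb: "S j \<in> sets borel" for j
      using sets.Int[of "{0..2 * pi}" borel "{t. K \<le> u j t}"] by (simp add: S_def Int_def)
    have Sm: "emeasure lborel (S j) \<le> ennreal (Q / K)" for j
    proof -
      have "ennreal K * emeasure lborel (S j) = (\<integral>\<^sup>+t. ennreal K * indicator (S j) t \<partial>lborel)"
        using Sb by (simp add: nn_integral_cmult_indicator)
      also have "\<dots> \<le> (\<integral>\<^sup>+t. ennreal (u j t) * indicator {0..2 * pi} t \<partial>lborel)"
        by (intro nn_integral_mono) (auto simp: S_def indicator_def ennreal_leI)
      also have "\<dots> = ennreal (integral {0..2 * pi} (u j))"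
        by (intro nn_integral_has_integral_lebesgue' integrable_integral integrable_continuous_interval u0 cu)
      also have "\<dots> \<le> ennreal Q" by (rule ennreal_leI[OF Q])
      finally have *: "ennreal K * emeasure lborel (S j) \<le> ennreal Q" .
      have "emeasure lborel (S j) = ennreal (1 / K) * (ennreal K * emeasure lborel (S j))"
        using K by (simp add: mult.assoc[symmetric] flip: ennreal_mult')
      also have "\<dots> \<le> ennreal (1 / K) * ennreal Q" using * by (rule mult_left_mono) simp
      also have "\<dots> = ennreal (Q / K)" using K by (simp flip: ennreal_mult')
      finally show ?thesis .
    qed
    \<comment> \<open>The index from which \<open>u j \<theta> \<ge> K\<close> holds depends on
      \<open>\<theta>\<close>; the increasing sets \<open>G i\<close> collect the angles that are
      good from \<open>i\<close> on.\<close>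
    define G where "G i = (\<Inter>j\<in>{i..}. S j)" for i :: nat
    have Gb: "G i \<in> sets lborel" for i
      unfolding G_def using Sb by (intro sets.countable_INT'') (auto intro: sets.countable_INT)
    have TG: "T \<subseteq> (\<Union>i. G i)"
    proof
      fix \<theta> assume th: "\<theta> \<in> T"
      have pos: "M * exp (- K) / 2 ^ n > 0" using M by simp
      obtain s :: real where s: "s < 1" "\<And>r::real. s < r \<Longrightarrow> r < 1 \<Longrightarrow> cmod (h (r * cis \<theta>)) < M * exp (- K) / 2 ^ n"
        using lim[OF th pos] by blast
      obtain i where i: "1 / (1 - s) < real i" using reals_Archimedean2 by blast
      have "\<theta> \<in> S j" if j: "j \<ge> i" for j
      proof -
        have "1 / (1 - s) < real (j + 2)" using i j by linarith
        then have "1 / real (j + 2) < 1 - s" using s(1) by (simp add: field_simps)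
        then have "s < R j" using R(1)[of j] by linarith
        then have "cmod (h (R j * cis \<theta>)) < M * exp (- K) / 2 ^ n" using s(2) R(2) by blast
        then have "2 ^ n * cmod (h (R j * cis \<theta>)) < M * exp (- K)" by (simp add: field_simps)
        then have "cmod (g (R j * cis \<theta>)) \<le> M * exp (- K)"
          using gh[of "R j * cis \<theta>"] R2[of j] R(2)[of j] by (smt (verit))
        then have "ln (cmod (g (R j * cis \<theta>))) \<le> ln (M * exp (- K))" using gnz by (intro ln_mono) auto
        then have "K \<le> u j \<theta>" using M by (simp add: u_def ln_mult)
        then show ?thesis using th T(1) by (auto simp: S_def)
      qed
      then show "\<theta> \<in> (\<Union>i. G i)" unfolding G_def by blast
    qed
    have "emeasure lebesgue T \<le> emeasure lebesgue (\<Union>i. G i)"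
      using TG Gb by (intro emeasure_mono) (auto intro!: sets.countable_UN)
    also have "\<dots> = emeasure lborel (\<Union>i. G i)"
    proof -
      have "(\<Union>i. G i) \<in> sets lborel" using Gb by (intro sets.countable_UN) auto
      then show ?thesis by simp
    qed
    also have "\<dots> \<le> ennreal (Q / K)"
    proof (rule emeasure_UN_countable_le_finite[OF countableI_type Gb])
      fix F :: "nat set" assume F: "finite F"
      have "(\<Union>i\<in>F. G i) \<subseteq> S (Max (insert 0 F))"
        using F unfolding G_def by (auto simp: Max_ge_iff)
      then have "emeasure lborel (\<Union>i\<in>F. G i) \<le> emeasure lborel (S (Max (insert 0 F)))"
        using Sb by (intro emeasure_mono) auto
      then show "emeasure lborel (\<Union>i\<in>F. G i) \<le> ennreal (Q / K)" using Sm by (rule order_trans)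
    qed
    finally show ?thesis .
  qed
  have "(\<lambda>m. ennreal (Q / real (Suc m))) \<longlonglongrightarrow> ennreal 0"
    by (intro tendsto_ennrealI real_tendsto_divide_at_top[OF tendsto_const] filterlim_compose[OF filterlim_real_sequentially filterlim_Suc])
  then have "emeasure lebesgue T \<le> ennreal 0"
    by (rule LIMSEQ_le_const) (use small in auto)
  then show False using T(2) by simp
qed

lemma stolz_region_mono: "C \<le> C' \<Longrightarrow> stolz_region z0 C \<subseteq> stolz_region z0 C'"
proof -
  assume "C \<le> C'"
  then have "C * (1 - cmod z) \<le> C' * (1 - cmod z)" if "cmod z < 1" for z
    using that by (intro mult_right_mono) auto
  then show ?thesis unfolding stolz_region_def by (auto intro: order_less_le_trans)
qed

text \<open>A single sequence controls \<open>h\<close> only along itself. Outside a null set,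
  however, \<open>h\<close> has small oscillation in a Stolz region holding both the sequence and
  the end of the radius, so the radial limit is 0 as well.\<close>

theorem nontangential_uniqueness:
  fixes h :: "complex \<Rightarrow> complex" and B :: real
  assumes h: "h holomorphic_on ball 0 1" and B: "\<And>z. cmod z < 1 \<Longrightarrow> cmod (h z) \<le> B"
    and E: "linearly_measurable E" "linear_measure E > 0"
    and lim: "\<And>z0. z0 \<in> E \<Longrightarrow> \<exists>z. converges_nontangentially z z0 \<and> (\<lambda>n. h (z n)) \<longlonglongrightarrow> 0"
    and z: "cmod z < 1"
  shows "h z = 0"
proof -
  \<comment> \<open>The aperture varies with the point of \<open>E\<close>, so apertures
    \<open>c + 2\<close> for natural \<open>c\<close>, all greater than 1, and tolerances
    \<open>1 / Suc m\<close> are used: the exceptional sets are then countably many.\<close>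
  let ?P = "\<lambda>c m \<theta> d. \<forall>z\<in>stolz_region (cis \<theta>) (real c + 2). \<forall>w\<in>stolz_region (cis \<theta>) (real c + 2).
    cmod (z - cis \<theta>) < d \<longrightarrow> cmod (w - cis \<theta>) < d \<longrightarrow> cmod (h z - h w) \<le> 3 * (1 / real (Suc m))"
  have "\<exists>Z. Z \<in> null_sets lborel \<and> (\<forall>\<theta>\<in>{0..2 * pi} - Z. \<exists>d>0. ?P c m \<theta> d)" for c m
    using nontangential_oscillation[OF h B, of "real c + 2" "1 / real (Suc m)"] by auto
  then obtain Z where Z: "\<And>c m. Z c m \<in> null_sets lborel"
    "\<And>c m \<theta>. \<theta> \<in> {0..2 * pi} - Z c m \<Longrightarrow> \<exists>d>0. ?P c m \<theta> d"
    by metis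
  define N where "N = (\<Union>c. \<Union>m. Z c m)"
  have N: "N \<in> null_sets lebesgue"
    unfolding N_def using Z(1) by (intro null_sets_completionI null_sets_UN) auto
  define T where "T = circle_angles E - N"
  have "emeasure lebesgue T = linear_measure E"
    unfolding T_def linear_measure_def using E(1) N
    by (intro emeasure_Diff_null_set) (auto simp: linearly_measurable_def)
  then have Tpos: "emeasure lebesgue T > 0" using E(2) by simp
  have Tsub: "T \<subseteq> {0..2 * pi}" by (auto simp: T_def circle_angles_def)
  show ?thesis
  proof (rule radial_uniqueness[OF h B Tsub Tpos _ z])
    fix \<theta> e :: real assume th: "\<theta> \<in> T" and e: "e > 0"
    have "cis \<theta> \<in> E" using th by (auto simp: T_def circle_angles_def)
    then obtain w where w: "converges_nontangentially w (cis \<theta>)" "(\<lambda>n. h (w n)) \<longlonglongrightarrow> 0" using lim by blast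
    then obtain C where C: "\<And>n. w n \<in> stolz_region (cis \<theta>) C" and wl: "w \<longlonglongrightarrow> cis \<theta>"
      unfolding converges_nontangentially_def by blast
    obtain c where c: "C \<le> real c" using real_arch_simple by blast
    then have wc: "w n \<in> stolz_region (cis \<theta>) (real c + 2)" for n
      using C[of n] stolz_region_mono[of C "real c + 2"] by (auto simp: subset_iff)
    obtain m where "6 / e < real m" using reals_Archimedean2 by blast
    then have "6 / e < real (Suc m)" by simp
    then have m: "3 * (1 / real (Suc m)) < e / 2" using e by (simp add: field_simps)
    obtain d where d: "d > 0" "?P c m \<theta> d"
    proof -
      have "\<theta> \<in> {0..2 * pi} - Z c m" using th Tsub by (auto simp: T_def N_def)
      then show thesis using Z(2) that by blast
    qed
    have "\<forall>\<^sub>F n in sequentially. dist (w n) (cis \<theta>) < d"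
      using wl d(1) by (rule tendstoD)
    moreover have "\<forall>\<^sub>F n in sequentially. dist (h (w n)) 0 < e / 2"
      using w(2) e by (intro tendstoD) auto
    ultimately have "\<forall>\<^sub>F n in sequentially. dist (w n) (cis \<theta>) < d \<and> dist (h (w n)) 0 < e / 2"
      by (rule eventually_conj)
    then obtain n where n: "cmod (w n - cis \<theta>) < d" "cmod (h (w n)) < e / 2"
      by (auto simp: dist_norm dest: eventually_happens)
    have "cmod (h (r * cis \<theta>)) < e" if r: "max (1 - d) 0 < r" "r < 1" for r :: real
    proof -
      have "r * cis \<theta> - cis \<theta> = of_real (r - 1) * cis \<theta>" by (simp add: algebra_simps)
      then have nr: "cmod (r * cis \<theta> - cis \<theta>) = 1 - r" using r by (simp only: norm_mult norm_of_real) simp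
      have "1 * (1 - r) < (real c + 2) * (1 - r)" using r by (intro mult_strict_right_mono) auto
      then have "r * cis \<theta> \<in> stolz_region (cis \<theta>) (real c + 2)"
        using r nr by (simp add: stolz_region_def norm_mult)
      moreover have "cmod (r * cis \<theta> - cis \<theta>) < d" using nr r by simp
      ultimately have "cmod (h (r * cis \<theta>) - h (w n)) \<le> 3 * (1 / real (Suc m))"
        using d(2) wc[of n] n(1) by blast
      then show ?thesis using m n(2) norm_triangle_ineq2[of "h (r * cis \<theta>)" "h (w n)"] by linarith
    qed
    then show "\<exists>s<(1::real). \<forall>r::real. s < r \<and> r < 1 \<longrightarrow> cmod (h (r * cis \<theta>)) < e"
      using d(1) by (intro exI[of _ "max (1 - d) 0"]) auto
  qed
qed


section \<open>The Gromov product and the uniqueness theorem\<close>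

lemma strongly_pseudoconvex_C2_boundary:
  fixes D :: "(complex^'n) set"
  assumes "strongly_pseudoconvex_domain D"
  shows "\<exists>U r r' r''. C2_boundary U r r' r'' D"
proof -
  obtain U r where U: "open U" "frontier D \<subseteq> U" "C2_on r U" "D \<inter> U = {z\<in>U. r z < 0}"
    "\<forall>p\<in>frontier D. frechet_derivative r (at p) \<noteq> (\<lambda>v. 0)"
    "\<forall>p\<in>frontier D. \<forall>w\<in>complex_tangent_space r p. w \<noteq> 0 \<longrightarrow> levi_form r p w > 0"
    using assms unfolding strongly_pseudoconvex_domain_def by (elim conjE exE) (rule that)
  obtain r' :: "complex^'n \<Rightarrow> (complex^'n) \<Rightarrow>\<^sub>L real" and r'' :: "complex^'n \<Rightarrow> (complex^'n) \<Rightarrow>\<^sub>L (complex^'n) \<Rightarrow>\<^sub>L real"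
    where r: "\<And>z. z \<in> U \<Longrightarrow> (r has_derivative blinfun_apply (r' z)) (at z)"
      "\<And>z. z \<in> U \<Longrightarrow> (r' has_derivative blinfun_apply (r'' z)) (at z)" "continuous_on U r''"
    using U(3) unfolding C2_on_def by blast
  interpret C2_function U r r' r'' by unfold_locales (use U(1) r in auto)
  have "C2_boundary U r r' r'' D"
  proof
    show "open D" "D \<noteq> {}" "bounded D" using assms unfolding strongly_pseudoconvex_domain_def by auto
    show "frontier D \<subseteq> U" "D \<inter> U = {z\<in>U. r z < 0}" by (fact U)+
    fix \<zeta> assume z: "\<zeta> \<in> frontier D"
    then have zU: "\<zeta> \<in> U" using U(2) by blast
    show "r' \<zeta> \<noteq> 0"
      using bspec[OF U(5) z] frechet_derivative_at[OF r(1)[OF zU]] by (auto simp: zero_blinfun.rep_eq)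
    fix w :: "complex^'n" assume "w \<noteq> 0" "r' \<zeta> w = 0" "r' \<zeta> (mult_i w) = 0"
    then show "r'' \<zeta> w w + r'' \<zeta> (mult_i w) (mult_i w) > 0"
      using bspec[OF U(6) z] by (simp add: complex_tangent_space_iff[OF zU] levi_form_eq[OF zU])
  qed
  then show ?thesis by blast
qed

lemma cart_chain_rule:
  fixes H :: "complex^'n \<Rightarrow> complex^'m" and f :: "complex \<Rightarrow> complex^'n"
  assumes H: "H holo_map_on S" "f z \<in> S"
    and f: "\<And>j. (\<lambda>w. f w $ j) field_differentiable (at z)"
  shows "(\<lambda>w. H (f w) $ j) field_differentiable (at z)"
proof -
  obtain d where d: "\<And>j. ((\<lambda>w. f w $ j) has_field_derivative d j) (at z)"
    using f unfolding field_differentiable_def by metis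
  obtain H' where H': "(H has_derivative H') (at (f z))" "\<And>c v. H' (c *s v) = c *s H' v"
    using H unfolding holo_map_on_def by meson
  have "(H \<circ> f has_derivative H' \<circ> (\<lambda>h. h *s (\<chi> j. d j))) (at z)"
    by (rule diff_chain_at[OF has_derivative_cart_complex[OF d] H'(1)])
  from bounded_linear.has_derivative[OF bounded_linear_vec_nth this]
  have "((\<lambda>w. H (f w) $ j) has_derivative (\<lambda>h. h * (H' (\<chi> j. d j) $ j))) (at z)"
    by (simp add: o_def H'(2))
  then have "((\<lambda>w. H (f w) $ j) has_field_derivative (H' (\<chi> j. d j) $ j)) (at z)"
    unfolding has_field_derivative_def by (simp add: mult.commute[of _ "H' _ $ _"])
  then show ?thesis unfolding field_differentiable_def by blast
qed

section \<open>Transport to the manifold\<close>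

locale biholomorphic_image =
  fixes X :: "'a topology" and \<A> :: "('a, 'n::finite) chart set" and D :: "(complex^'n) set"
    and F :: "'a \<Rightarrow> complex^'n" and G :: "complex^'n \<Rightarrow> 'a"
  assumes manifold: "complex_manifold X \<A>" and domain: "strongly_pseudoconvex_domain D"
    and biholo: "biholomorphic_to X \<A> D"
    and homeo: "homeomorphic_maps X (top_of_set D) F G"
    and F_holo: "\<And>U \<phi>. (U, \<phi>) \<in> \<A> \<Longrightarrow> (F \<circ> inv_into U \<phi>) holo_map_on (\<phi> ` U)"
    and G_holo: "\<And>U \<phi>. (U, \<phi>) \<in> \<A> \<Longrightarrow> (\<phi> \<circ> G) holo_map_on {z\<in>D. G z \<in> U}"
begin

lemma F_mem: "x \<in> topspace X \<Longrightarrow> F x \<in> D"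
  using homeo continuous_map_image_subset_topspace[of X "top_of_set D" F] unfolding homeomorphic_maps_def by auto

lemma G_mem: "y \<in> D \<Longrightarrow> G y \<in> topspace X"
  using homeo continuous_map_image_subset_topspace[of "top_of_set D" X G] unfolding homeomorphic_maps_def by auto

lemma G_F: "x \<in> topspace X \<Longrightarrow> G (F x) = x"
  using homeo unfolding homeomorphic_maps_def by auto

lemma open_D: "open D" and bounded_D: "bounded D" and D_nonempty: "D \<noteq> {}"
  using domain unfolding strongly_pseudoconvex_domain_def by auto

lemma connected_X: "connected_space X"
  by (rule biholomorphic_to_domain_connected[OF domain biholo])

lemma holo_curve_imp_disc_into:
  assumes h: "holo_curve X \<A> (ball 0 1) h"
  shows "disc_into D (F \<circ> h)"
proof -
  have ch: "continuous_map (top_of_set (ball 0 1)) X h" using h by (simp add: holo_curve_def)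
  have hX: "h z \<in> topspace X" if "z \<in> ball 0 1" for z
    using continuous_map_image_subset_topspace[OF ch] that by auto
  have "(\<lambda>z. F (h z) $ j) field_differentiable (at z)" if z: "z \<in> ball 0 1" for j z
  proof -
    obtain U \<phi> where U: "(U, \<phi>) \<in> \<A>" "h z \<in> U"
      using hX[OF z] manifold unfolding complex_manifold_def by auto
    have oU: "openin X U" and hom: "homeomorphic_map (subtopology X U) (top_of_set (\<phi> ` U)) \<phi>"
      using manifold U(1) unfolding complex_manifold_def by auto
    have inj: "inj_on \<phi> U"
      using homeomorphic_imp_injective_map[OF hom] openin_subset[OF oU] by (simp add: Int_absorb1)
    define V where "V = {w \<in> ball 0 1. h w \<in> U}"
    have "openin (top_of_set (ball 0 1)) V"
      using openin_continuous_map_preimage[OF ch oU] by (simp add: V_def)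
    then have oV: "open V" using openin_open_eq[of "ball 0 1" V] by simp
    have zV: "z \<in> V" using z U by (simp add: V_def)
    have hol: "(\<lambda>w. \<phi> (h w) $ j) holomorphic_on V" for j
      using h U(1) unfolding holo_curve_def V_def by blast
    have "(\<lambda>w. (F \<circ> inv_into U \<phi>) (\<phi> (h w)) $ j) field_differentiable (at z)"
    proof (rule cart_chain_rule[OF F_holo[OF U(1)]])
      show "\<phi> (h z) \<in> \<phi> ` U" using U by simp
      show "(\<lambda>w. \<phi> (h w) $ j) field_differentiable (at z)" for j
        using hol oV zV by (rule holomorphic_on_imp_differentiable_at)
    qed
    then obtain d where d: "((\<lambda>w. (F \<circ> inv_into U \<phi>) (\<phi> (h w)) $ j) has_field_derivative d) (at z)"
      unfolding field_differentiable_def by blast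
    have "((\<lambda>w. F (h w) $ j) has_field_derivative d) (at z)"
      by (rule has_field_derivative_transform_within_open[OF d oV zV]) (use inj in \<open>simp add: V_def\<close>)
    then show ?thesis unfolding field_differentiable_def by blast
  qed
  then have "(\<lambda>z. F (h z) $ j) holomorphic_on ball 0 1" for j
    by (simp add: holomorphic_on_open field_differentiable_def)
  then show ?thesis using hX F_mem by (auto simp: disc_into_def)
qed

lemma disc_into_imp_holo_curve:
  assumes \<psi>: "disc_into D \<psi>"
  shows "holo_curve X \<A> (ball 0 1) (G \<circ> \<psi>)"
proof -
  have hj: "(\<lambda>z. \<psi> z $ j) holomorphic_on ball 0 1" for j using \<psi> by (simp add: disc_into_def)
  have "continuous_on (ball 0 1) (\<lambda>z. \<chi> j. \<psi> z $ j)"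
    by (intro continuous_on_vec_lambda holomorphic_on_imp_continuous_on hj)
  then have cpsi: "continuous_on (ball 0 1) \<psi>" by simp
  have "continuous_map (top_of_set (ball 0 1)) (top_of_set D) \<psi>"
    using cpsi \<psi> by (auto simp: disc_into_def)
  moreover have "continuous_map (top_of_set D) X G" using homeo by (simp add: homeomorphic_maps_def)
  ultimately have c: "continuous_map (top_of_set (ball 0 1)) X (G \<circ> \<psi>)" by (rule continuous_map_compose)
  have "(\<lambda>z. \<phi> ((G \<circ> \<psi>) z) $ j) holomorphic_on {z \<in> ball 0 1. (G \<circ> \<psi>) z \<in> U}"
    if U: "(U, \<phi>) \<in> \<A>" for U and \<phi> :: "'a \<Rightarrow> complex^'n" and j
  proof -
    have "(\<lambda>w. (\<phi> \<circ> G) (\<psi> w) $ j) field_differentiable (at z)"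
      if "z \<in> {z \<in> ball 0 1. (G \<circ> \<psi>) z \<in> U}" for z
    proof (rule cart_chain_rule[OF G_holo[OF U]])
      show "\<psi> z \<in> {z \<in> D. G z \<in> U}" using that disc_into_mem[OF \<psi>] by simp
      show "(\<lambda>w. \<psi> w $ j) field_differentiable (at z)" for j
        using hj open_ball by (rule holomorphic_on_imp_differentiable_at) (use that in simp)
    qed
    then show ?thesis
      unfolding holomorphic_on_def by (auto intro: field_differentiable_at_within)
  qed
  then show ?thesis using c unfolding holo_curve_def by blast
qed

abbreviation kob :: "'a \<Rightarrow> 'a \<Rightarrow> real" where "kob \<equiv> kobayashi_dist X \<A>"

lemma kob_contracting: "disk_contracting X \<A> kob"
  by (rule kobayashi_dist_greatest(1)[OF manifold connected_X])

lemma kob_pseudodistance: "pseudodistance_on (topspace X) kob"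
  using kob_contracting by (simp add: disk_contracting_def)

lemma kob_triangle:
  "x \<in> topspace X \<Longrightarrow> y \<in> topspace X \<Longrightarrow> z \<in> topspace X \<Longrightarrow> kob x z \<le> kob x y + kob y z"
  by (rule pseudodistance_on_triangle[OF kob_pseudodistance])

lemma kob_sym: "x \<in> topspace X \<Longrightarrow> y \<in> topspace X \<Longrightarrow> kob x y = kob y x"
  using kob_pseudodistance unfolding pseudodistance_on_def by blast

lemma kob_disc:
  assumes "disc_into D \<psi>" "cmod a < 1" "cmod b < 1"
  shows "kob (G (\<psi> a)) (G (\<psi> b)) \<le> poincare_dist a b"
  using kob_contracting disc_into_imp_holo_curve[OF assms(1)] assms(2,3)
  unfolding disk_contracting_def by fastforce

lemma kob_lower:
  assumes u: "infinitesimally_contracting D u" and x: "x \<in> topspace X" and y: "y \<in> topspace X"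
  shows "u (F x) - u (F y) \<le> kob x y"
proof -
  have "disk_contracting X \<A> (\<lambda>x y. \<bar>u (F x) - u (F y)\<bar>)"
    unfolding disk_contracting_def
  proof (intro conjI allI impI ballI)
    show "pseudodistance_on (topspace X) (\<lambda>x y. \<bar>u (F x) - u (F y)\<bar>)"
      by (auto simp: pseudodistance_on_def)
    fix h and a b :: complex assume h: "holo_curve X \<A> (ball 0 1) h" and ab: "a \<in> ball 0 1" "b \<in> ball (0::complex) 1"
    show "\<bar>u (F (h a)) - u (F (h b))\<bar> \<le> poincare_dist a b"
      using infinitesimally_contracting_imp_contracting[OF u holo_curve_imp_disc_into[OF h], of a b] ab by simp
  qed
  from kobayashi_dist_greatest(2)[OF manifold connected_X this x y] show ?thesis by linarith
qed

text \<open>Discs in a chart bound the distance near each point, and a finite subcover makes the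
  bound uniform.\<close>

lemma kob_bounded_on_compact:
  assumes x0: "x0 \<in> topspace X" and K: "compact K" "K \<subseteq> D"
  shows "\<exists>C. \<forall>y\<in>K. kob x0 (G y) \<le> C"
proof -
  have "\<exists>W C. open W \<and> z \<in> W \<and> (\<forall>y\<in>W. y \<in> D \<longrightarrow> kob x0 (G y) \<le> C)" if z: "z \<in> K" for z
  proof -
    have zD: "z \<in> D" using z K by blast
    obtain V C where V: "openin X V" "G z \<in> V"
      "\<And>y d. y \<in> V \<Longrightarrow> disk_contracting X \<A> d \<Longrightarrow> d (G z) y \<le> C"
      using disk_contracting_locally_bounded[OF manifold G_mem[OF zD]] by metis
    have "openin (top_of_set D) {y \<in> topspace (top_of_set D). G y \<in> V}"
      using homeo V(1) by (intro openin_continuous_map_preimage) (auto simp: homeomorphic_maps_def)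
    then have "open {y \<in> D. G y \<in> V}" using open_D openin_open_eq[of D] by simp
    moreover have "kob x0 (G y) \<le> kob x0 (G z) + C" if "y \<in> {y \<in> D. G y \<in> V}" for y
      using kob_triangle[OF x0 G_mem[OF zD] G_mem[of y]] V(3)[OF _ kob_contracting, of "G y"] that by simp
    ultimately show ?thesis using zD V(2) by (intro exI[of _ "{y \<in> D. G y \<in> V}"]) blast
  qed
  then obtain W C where W: "\<And>z. z \<in> K \<Longrightarrow> open (W z)" "\<And>z. z \<in> K \<Longrightarrow> z \<in> W z"
    "\<And>z y. z \<in> K \<Longrightarrow> y \<in> W z \<Longrightarrow> y \<in> D \<Longrightarrow> kob x0 (G y) \<le> C z"
    by metis
  obtain T where T: "T \<subseteq> K" "finite T" "K \<subseteq> (\<Union>z\<in>T. W z)"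
    using compactE_image[OF K(1), of K W] W(1,2) by blast
  have "kob x0 (G y) \<le> Max (insert 0 (C ` T))" if y: "y \<in> K" for y
  proof -
    obtain z where z: "z \<in> T" "y \<in> W z" using T y by blast
    then have "kob x0 (G y) \<le> C z" using W(3) T K y by blast
    also have "\<dots> \<le> Max (insert 0 (C ` T))" using T z by (intro Max_ge) auto
    finally show ?thesis .
  qed
  then show ?thesis by blast
qed

text \<open>Points of the closure outside \<open>D\<close> lie on the frontier and have depth 0, so
  \<open>closure D\<close> may replace \<open>D\<close> in the set.\<close>

lemma compact_deep_part: "compact {z \<in> D. e \<le> infdist z (frontier D)}" if "e > 0"
proof -
  have "{z \<in> D. e \<le> infdist z (frontier D)} = closure D \<inter> {z. e \<le> infdist z (frontier D)}"
  proof -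
    have "z \<in> D" if "z \<in> closure D" "e \<le> infdist z (frontier D)" for z
    proof (rule ccontr)
      assume "z \<notin> D"
      then have "z \<in> frontier D" using that open_D by (simp add: frontier_def interior_open)
      then show False using that \<open>e > 0\<close> by simp
    qed
    then show ?thesis using closure_subset by auto
  qed
  moreover have "closed {z. e \<le> infdist z (frontier D)}"
    by (intro closed_Collect_le continuous_intros continuous_on_infdist continuous_on_id)
  ultimately show ?thesis
    using bounded_D by (simp add: compact_Int_closed compact_closure)
qed

text \<open>By the triangle inequality the Gromov product is at most the distance from
  \<open>x0\<close> to either point, which settles the case of a point away from the boundary. If
  both are close to it, the logarithms in the upper bounds for \<open>kob x0 x\<close> and
  \<open>kob x0 y\<close> cancel against those in the lower bound for
  \<open>kob x y\<close>.\<close>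

theorem gromov_product_bounded:
  assumes x0: "x0 \<in> topspace X" and eta: "\<eta> > 0"
  shows "\<exists>B. \<forall>x\<in>topspace X. \<forall>y\<in>topspace X. norm (F x - F y) \<ge> \<eta> \<longrightarrow> gromov_product X \<A> x0 x y \<le> B"
proof -
  let ?d = "\<lambda>z. infdist z (frontier D)"
  obtain U r r' r'' where "C2_boundary U r r' r'' D" using strongly_pseudoconvex_C2_boundary[OF domain] by blast
  then interpret C2_boundary U r r' r'' D .
  obtain R0 c C where pk: "R0 > 0" "c > 0" "C > 0" "\<And>\<zeta>. \<zeta> \<in> frontier D \<Longrightarrow> \<exists>P. holo_fun P \<and> (\<forall>z\<in>D. norm (z - \<zeta>) < R0 \<longrightarrow>
      Re (P z) \<le> - c * (norm (z - \<zeta>))\<^sup>2 \<and> Re (P z) \<le> - c * ?d z \<and> cmod (P z) \<le> C * norm (z - \<zeta>))"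
    using local_peak_functions by blast
  obtain M where M: "\<And>z. z \<in> D \<Longrightarrow> norm z \<le> M" using bounded_D by (auto simp: bounded_iff)
  \<comment> \<open>Peak functions remain such on a smaller ball; shrinking it to
    \<open>\<eta> / 2\<close> makes the given separation at least \<open>2 * R\<close>, as
    \<open>contracting_function_separating\<close> requires.\<close>
  define R where "R = min R0 (\<eta> / 2)"
  have R: "R > 0" "R \<le> R0" "2 * R \<le> \<eta>" using pk eta by (auto simp: R_def)
  interpret peak_domain D M R c C
  proof
    show "open D" "D \<noteq> {}" by (rule open_D, rule D_nonempty)
    show "norm z \<le> M" if "z \<in> D" for z by (rule M[OF that])
    show "R > 0" "c > 0" "C > 0" by (fact R pk)+
    fix \<zeta> assume "\<zeta> \<in> frontier D"
    then show "\<exists>P. holo_fun P \<and> (\<forall>z\<in>D. norm (z - \<zeta>) < R \<longrightarrow>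
      Re (P z) \<le> - c * (norm (z - \<zeta>))\<^sup>2 \<and> Re (P z) \<le> - c * ?d z \<and> cmod (P z) \<le> C * norm (z - \<zeta>))"
      using pk(4) R(2) by (meson order_less_le_trans)
  qed
  obtain e K where sep: "e > 0" "\<And>x y. x \<in> D \<Longrightarrow> y \<in> D \<Longrightarrow> ?d x < e \<Longrightarrow> ?d y < e \<Longrightarrow> norm (x - y) \<ge> 2 * R \<Longrightarrow>
     \<exists>u. infinitesimally_contracting D u \<and> u x - u y \<ge> - ln (?d x) / 2 - ln (?d y) / 2 - K"
    using contracting_function_separating by metis
  obtain e' Q C' where disc: "e' > 0" "compact Q" "Q \<subseteq> D" "\<And>x. x \<in> D \<Longrightarrow> ?d x < e' \<Longrightarrow>
     \<exists>\<phi> w. disc_into D \<phi> \<and> cmod w < 1 \<and> \<phi> w = x \<and> \<phi> 0 \<in> Q \<and> poincare_dist 0 w \<le> - ln (?d x) / 2 + C'"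
    using inner_discs by metis
  define \<epsilon> where "\<epsilon> = min e e'"
  have eps: "\<epsilon> > 0" "\<epsilon> \<le> e" "\<epsilon> \<le> e'" using sep(1) disc(1) by (auto simp: \<epsilon>_def)
  obtain B1 where B1: "\<And>y. y \<in> Q \<Longrightarrow> kob x0 (G y) \<le> B1"
    using kob_bounded_on_compact[OF x0 disc(2,3)] by blast
  obtain B2 where B2: "\<And>y. y \<in> D \<Longrightarrow> \<epsilon> \<le> ?d y \<Longrightarrow> kob x0 (G y) \<le> B2"
    using kob_bounded_on_compact[OF x0 compact_deep_part[OF eps(1)]] by auto
  have upper: "kob x0 x \<le> B1 - ln (?d (F x)) / 2 + C'" if x: "x \<in> topspace X" "?d (F x) < \<epsilon>" for x
  proof -
    obtain \<phi> w where \<phi>: "disc_into D \<phi>" "cmod w < 1" "\<phi> w = F x" "\<phi> 0 \<in> Q"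
      "poincare_dist 0 w \<le> - ln (?d (F x)) / 2 + C'"
      using disc(4)[OF F_mem[OF x(1)]] x(2) eps(3) by auto
    have "kob (G (\<phi> 0)) x \<le> poincare_dist 0 w"
      using kob_disc[OF \<phi>(1), of 0 w] \<phi>(2,3) G_F[OF x(1)] by simp
    moreover have "kob x0 x \<le> kob x0 (G (\<phi> 0)) + kob (G (\<phi> 0)) x"
      using \<phi>(4) disc(3) by (intro kob_triangle x0 x G_mem) auto
    ultimately show ?thesis using B1[OF \<phi>(4)] \<phi>(5) by linarith
  qed
  have "gromov_product X \<A> x0 x y \<le> max B2 (B1 + C' + K / 2)"
    if x: "x \<in> topspace X" and y: "y \<in> topspace X" and xy: "norm (F x - F y) \<ge> \<eta>" for x y
  proof -
    have gx: "gromov_product X \<A> x0 x y \<le> kob x0 x"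
      using kob_triangle[OF x0 x y] unfolding gromov_product_def by simp
    have gy: "gromov_product X \<A> x0 x y \<le> kob x0 y"
      using kob_triangle[OF x0 y x] kob_sym[OF x y] unfolding gromov_product_def by simp
    consider "\<epsilon> \<le> ?d (F x)" | "\<epsilon> \<le> ?d (F y)" | "?d (F x) < \<epsilon>" "?d (F y) < \<epsilon>" by linarith
    then show ?thesis
    proof cases
      case 1
      then show ?thesis using B2[OF F_mem[OF x]] gx G_F[OF x] by simp
    next
      case 2
      then show ?thesis using B2[OF F_mem[OF y]] gy G_F[OF y] by simp
    next
      case 3
      obtain u where u: "infinitesimally_contracting D u"
        "u (F x) - u (F y) \<ge> - ln (?d (F x)) / 2 - ln (?d (F y)) / 2 - K"
        using sep(2)[OF F_mem[OF x] F_mem[OF y]] 3 eps xy R(3) by auto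
      have "kob x y \<ge> - ln (?d (F x)) / 2 - ln (?d (F y)) / 2 - K"
        using kob_lower[OF u(1) x y] u(2) by linarith
      then have "gromov_product X \<A> x0 x y \<le> B1 + C' + K / 2"
        using upper[OF x 3(1)] upper[OF y 3(2)] unfolding gromov_product_def by (simp add: field_simps)
      then show ?thesis by simp
    qed
  qed
  then show ?thesis by blast
qed

lemma gromov_product_tendsto_imp_close:
  assumes x0: "x0 \<in> topspace X" and xy: "\<And>n. x n \<in> topspace X" "\<And>n. y n \<in> topspace X"
    and lim: "filterlim (\<lambda>n. gromov_product X \<A> x0 (x n) (y n)) at_top sequentially"
  shows "(\<lambda>n. F (x n) - F (y n)) \<longlonglongrightarrow> 0"
proof (rule tendstoI)
  fix \<eta> :: real assume "\<eta> > 0"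
  then obtain B where B: "\<And>x y. x \<in> topspace X \<Longrightarrow> y \<in> topspace X \<Longrightarrow> norm (F x - F y) \<ge> \<eta> \<Longrightarrow> gromov_product X \<A> x0 x y \<le> B"
    using gromov_product_bounded[OF x0] by blast
  have "\<forall>\<^sub>F n in sequentially. B < gromov_product X \<A> x0 (x n) (y n)"
    using lim by (simp add: filterlim_at_top_dense)
  then show "\<forall>\<^sub>F n in sequentially. dist (F (x n) - F (y n)) 0 < \<eta>"
    by eventually_elim (use B[OF xy] in \<open>force simp: not_le[symmetric]\<close>)
qed

end

theorem mainTheorem3:
  fixes X :: "'a topology" and \<A> :: "('a, 'n::finite) chart set"
    and D :: "(complex^'n) set"
    and x0 :: 'a and f g :: "complex \<Rightarrow> 'a" and E :: "complex set"
  assumes "complex_manifold X \<A>"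
    and "strongly_pseudoconvex_domain D"
    and "biholomorphic_to X \<A> D"
    and "x0 \<in> topspace X"
    and "holo_curve X \<A> (ball 0 1) f"
    and "holo_curve X \<A> (ball 0 1) g"
    and "linearly_measurable E"
    and "linear_measure E > 0"
    and "\<And>z0. z0 \<in> E \<Longrightarrow>
           \<exists>z. (\<forall>n. z n \<in> ball 0 1) \<and> converges_nontangentially z z0 \<and>
               filterlim (\<lambda>n. gromov_product X \<A> x0 (f (z n)) (g (z n))) at_top sequentially"
  shows "\<forall>z\<in>ball 0 1. f z = g z"
proof -
  obtain F G where FG: "homeomorphic_maps X (top_of_set D) F G"
    "\<And>U \<phi>. (U, \<phi>) \<in> \<A> \<Longrightarrow> (F \<circ> inv_into U \<phi>) holo_map_on (\<phi> ` U)"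
    "\<And>U \<phi>. (U, \<phi>) \<in> \<A> \<Longrightarrow> (\<phi> \<circ> G) holo_map_on {z\<in>D. G z \<in> U}"
    using assms(3) unfolding biholomorphic_to_def by blast
  interpret biholomorphic_image X \<A> D F G
    by unfold_locales (fact assms FG)+
  have "continuous_map (top_of_set (ball 0 1)) X f" "continuous_map (top_of_set (ball 0 1)) X g"
    using assms(5,6) by (auto simp: holo_curve_def)
  from this[THEN continuous_map_image_subset_topspace]
  have X: "f z \<in> topspace X" "g z \<in> topspace X" if "z \<in> ball 0 1" for z
    using that by auto
  have df: "disc_into D (F \<circ> f)" "disc_into D (F \<circ> g)"
    by (rule holo_curve_imp_disc_into[OF assms(5)], rule holo_curve_imp_disc_into[OF assms(6)])
  obtain M where M: "\<And>w. w \<in> D \<Longrightarrow> norm w \<le> M" using bounded_D by (auto simp: bounded_iff)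
  \<comment> \<open>Uniqueness for bounded scalar functions is applied to each coordinate of the
    difference; boundedness comes from \<open>D\<close>.\<close>
  have eq: "F (f z) $ j - F (g z) $ j = 0" if z: "z \<in> ball 0 1" for z j
  proof (rule nontangential_uniqueness[where h = "\<lambda>z. F (f z) $ j - F (g z) $ j" and B = "2 * M"])
    show "(\<lambda>z. F (f z) $ j - F (g z) $ j) holomorphic_on ball 0 1"
      using df unfolding disc_into_def o_def by (intro holomorphic_on_diff) auto
    show "cmod (F (f z) $ j - F (g z) $ j) \<le> 2 * M" if "cmod z < 1" for z
    proof -
      have "cmod (F (f z) $ j - F (g z) $ j) \<le> cmod (F (f z) $ j) + cmod (F (g z) $ j)"
        by (rule norm_triangle_ineq4)
      also have "\<dots> \<le> norm (F (f z)) + norm (F (g z))"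
        by (intro add_mono Finite_Cartesian_Product.norm_nth_le)
      also have "\<dots> \<le> 2 * M"
        using M[OF disc_into_mem[OF df(1) that]] M[OF disc_into_mem[OF df(2) that]] by simp
      finally show ?thesis .
    qed
    fix z0 assume "z0 \<in> E"
    then obtain w where w: "\<And>n. w n \<in> ball 0 1" "converges_nontangentially w z0"
      "filterlim (\<lambda>n. gromov_product X \<A> x0 (f (w n)) (g (w n))) at_top sequentially"
      using assms(9) by blast
    have "(\<lambda>n. F (f (w n)) - F (g (w n))) \<longlonglongrightarrow> 0"
      by (rule gromov_product_tendsto_imp_close[OF assms(4) X(1)[OF w(1)] X(2)[OF w(1)] w(3)])
    from tendsto_vec_nth[OF this, of j]
    have "(\<lambda>n. F (f (w n)) $ j - F (g (w n)) $ j) \<longlonglongrightarrow> 0" by simp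
    then show "\<exists>w. converges_nontangentially w z0 \<and> (\<lambda>n. F (f (w n)) $ j - F (g (w n)) $ j) \<longlonglongrightarrow> 0"
      using w(2) by blast
  qed (use assms(7,8) z in auto)
  show ?thesis
  proof
    fix z :: complex assume z: "z \<in> ball 0 1"
    have "F (f z) = F (g z)" using eq[OF z] by (simp add: vec_eq_iff)
    then show "f z = g z" using G_F X[OF z] by metis
  qed
qed

end
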